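(* Consider a standard gambling game $(X,Y,\Gamma,\Lambda,u)$ which is idempotent and such that both $\Gamma$ and $\Lambda$ have vanishing $L_1$-variation. Then the uniform value $v$ exists (with both players having optimal uniform strategies), and strategies adapted to $v$ are uniformly optimal: any strategy of Player 1 adapted to $v$, and any strategy of Player 2 adapted to $v$, uniformly guarantees $v$. Moreover, $v$ is the unique function in $\mathcal B(X\times Y)$ that is excessive, depressive and satisfies (Q1) for all $(x,y)\in X\times Y$ there is $p\in\Gamma(x)$ with $v(x,y)=\tilde v(p,y)\le\tilde u(p,y)$, and (Q2) for all $(x,y)\in X\times Y$ there is $q\in\Lambda(y)$ with $v(x,y)=\tilde v(x,q)\ge\tilde u(x,q)$.
   Context: For a compact metric space $S$: $\Delta(S)$ is the set of Borel probabilities on $S$ (weak-* topology, metrized by the Kantorovich–Rubinstein distance $d_{KR}(p,p')=\sup\{|\int f\,dp-\int f\,dp'| : f \text{ 1-Lipschitz on } S\}$), $\mathcal B(S)$ the bounded measurable real functions, $\delta_s$ the Dirac mass at $s$ (identified with $s$). For $v\in\mathcal B(X\times Y)$, $\tilde v(p,q)=\int\int v(x,y)\,dp(x)\,dq(y)$, $\tilde v(p,y)=\tilde v(p,\delta_y)$, $\tilde v(x,q)=\tilde v(\delta_x,q)$; likewise $\tilde u$. A standard gambling game consists of nonempty compact metric spaces $X,Y$, a continuous payoff $u:X\times Y\to\mathbb R$, and multifunctions $\Gamma:X\rightrightarrows\Delta(X)$, $\Lambda:Y\rightrightarrows\Delta(Y)$ with nonempty convex compact values which are leavable ($\delta_x\in\Gamma(x)$,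 $\delta_y\in\Lambda(y)$ for all $x,y$) and non expansive (for all $x,x'\in X$ and $p\in\Gamma(x)$ there is $p'\in\Gamma(x')$ with $d_{KR}(p,p')\le d(x,x')$; similarly for $\Lambda$). $\tilde\Gamma:\Delta(X)\rightrightarrows\Delta(X)$ is the multifunction whose graph is the closed convex hull of $\{(\delta_x,p):x\in X,\,p\in\Gamma(x)\}$ in $\Delta(X)\times\Delta(X)$; similarly $\tilde\Lambda$. The game is idempotent if $\Gamma\circ\Gamma=\Gamma$ and $\Lambda\circ\Lambda=\Lambda$, i.e. $\bigcup_{p\in\Gamma(x)}\tilde\Gamma(p)=\Gamma(x)$ for all $x$ and similarly for $\Lambda$. $\Gamma$ has vanishing $L_1$-variation if for every $\varepsilon>0$ there is $N$ such that for all $n\ge N$ and any sequence $(p_t)_{t\ge1}$ in $\Delta(X)$ with $p_{t+1}\in\tilde\Gamma(p_t)$ for all $t$, $\frac1n\sum_{t=1}^n d_{KR}(p_{t+1},p_t)\le\varepsilon$; similarly for $\Lambda$. $v\in\mathcal B(X\times Y)$ is excessive if $v(x,y)=\max_{p\in\Gamma(x)}\tilde v(p,y)$ for all $(x,y)$, and depressive if $v(x,y)=\min_{q\in\Lambda(y)}\tilde v(x,q)$ for all $(x,y)$. Play: at each stage $t\ge1$, knowing past and current states, Player 1 chooses a probability in $\Gamma(x_t)$ and Player 2 simultaneously chooses a probability in $\Lambda(y_t)$; $x_{t+1},y_{t+1}$ are drawn independently from these and publicly announced; the stage payoff (to Player 1, who maximizes) is $u(x_t,y_t)$. A strategy of Player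 1 (resp. 2) is a measurable rule giving at each stage $t$, as a function of past and current states, an element of $\Gamma(x_t)$ (resp. $\Lambda(y_t)$). Initial states and a pair $(\sigma,\tau)$ define a probability on plays with expectation $\mathbb E_{(x_1,y_1),\sigma,\tau}$. A strategy $\sigma$ of Player 1 uniformly guarantees $w\in\mathcal B(X\times Y)$ if for every $\varepsilon>0$ there is $N$ such that for all $n\ge N$, all $(x_1,y_1)$ and all $\tau$, $\mathbb E_{(x_1,y_1),\sigma,\tau}(\frac1n\sum_{t=1}^n u(x_t,y_t))\ge w(x_1,y_1)-\varepsilon$. A strategy $\tau$ of Player 2 uniformly guarantees $w$ if for every $\varepsilon>0$ there is $N$ such that for all $n\ge N$, all $(x_1,y_1)$ and all $\sigma$, $\mathbb E_{(x_1,y_1),\sigma,\tau}(\frac1n\sum_{t=1}^n u(x_t,y_t))\le w(x_1,y_1)+\varepsilon$. $w$ is the uniform value, with optimal uniform strategies, if each player has a strategy that uniformly guarantees $w$. A strategy of Player 1 is adapted to $w$ if whenever the current state is $(x,y)$ it plays some $p\in\Gamma(x)$ with $w(x,y)\le\tilde w(p,y)\le\tilde u(p,y)$; a strategy of Player 2 is adapted to $w$ if whenever the current state is $(x,y)$ it plays some $q\in\Lambda(y)$ with $w(x,y)\ge\tilde w(x,q)\ge\tilde u(x,q)$. *)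

theory Defs
  imports "HOL-Probability.Probability"
begin

class compact_metric_space = metric_space +
  assumes compact_space_UNIV: "compact UNIV"

instance compact_metric_space \<subseteq> polish_space
proof
  fix X :: "nat \<Rightarrow> 'a"
  assume "Cauchy X"
  then show "convergent X"
    using compact_imp_complete[OF compact_space_UNIV]
    by (auto simp: complete_def convergent_def)
next
  have "\<exists>k. finite k \<and> (UNIV::'a set) \<subseteq> (\<Union>x\<in>k. ball x (1 / real (Suc n)))" for n
    using compact_eq_totally_bounded[of "UNIV::'a set"] compact_space_UNIV by auto
  then obtain k :: "nat \<Rightarrow> 'a set"
    where k: "\<And>n. finite (k n)" "\<And>n. UNIV \<subseteq> (\<Union>x\<in>k n. ball x (1 / real (Suc n)))"
    by metis
  define B where "B = (\<Union>n. (\<lambda>x. ball x (1 / real (Suc n))) ` k n)"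
  have "countable B"
    unfolding B_def using k(1) by (auto intro: countable_finite)
  moreover have "topological_basis B"
  proof (rule topological_basisI)
    show "open b" if "b \<in> B" for b using that by (auto simp: B_def)
    fix O' :: "'a set" and x assume "open O'" "x \<in> O'"
    then obtain e where e: "e > 0" "ball x e \<subseteq> O'" by (meson openE)
    obtain n where n: "1 / real (Suc n) < e / 2"
      using e(1) nat_approx_posE[of "e/2"] by auto
    obtain y where y: "y \<in> k n" "dist y x < 1 / real (Suc n)"
      using k(2)[of n] by fastforce
    have "ball y (1 / real (Suc n)) \<subseteq> ball x e"
    proof
      fix z assume "z \<in> ball y (1 / real (Suc n))"
      then have "dist y z < e / 2" "dist y x < e / 2" using n y by auto
      then show "z \<in> ball x e" using dist_triangle[of x z y] by (simp add: dist_commute)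
    qed
    then show "\<exists>B'\<in>B. x \<in> B' \<and> B' \<subseteq> O'"
      using e(2) y by (intro bexI[of _ "ball y (1 / real (Suc n))"]) (auto simp: B_def)
  qed
  ultimately show "\<exists>B::'a set set. countable B \<and> open = generate_topology B"
    using topological_basis_imp_subbasis by metis
qed


section \<open>Borel probabilities and the Kantorovich--Rubinstein distance\<close>

definition Delta :: "'a::topological_space measure set" where
  "Delta = {p. prob_space p \<and> sets p = sets borel}"

lemma Delta_eq_space_prob_algebra: "Delta = space (prob_algebra borel)"
  by (auto simp: Delta_def space_prob_algebra)

definition dKR :: "'a::metric_space measure \<Rightarrow> 'a measure \<Rightarrow> real" where
  "dKR p p' = (if p \<in> Delta \<and> p' \<in> Delta
     then SUP f\<in>{f. 1-lipschitz_on UNIV f}. \<bar>integral\<^sup>L p f - integral\<^sup>L p' f\<bar> else 0)"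

text \<open>On a compact space \<^term>\<open>dKR\<close> metrizes the weak-* topology. The value 0 outside
  \<^term>\<open>Delta\<close> is there because the library's locale of metric spaces asks for a nonnegative
  distance on the whole ambient type; see \<open>Metric_space_dKR\<close> below.\<close>

definition weak_star :: "'a::metric_space measure topology" where
  "weak_star = Metric_space.mtopology Delta dKR"

definition mix :: "real \<Rightarrow> 'a::topological_space measure \<Rightarrow> 'a measure \<Rightarrow> 'a measure" where
  "mix a p q = measure_of UNIV (sets borel) (\<lambda>A. ennreal a * emeasure p A + ennreal (1 - a) * emeasure q A)"

definition convex_probs :: "'a::topological_space measure set \<Rightarrow> bool" where
  "convex_probs K \<longleftrightarrow> (\<forall>p\<in>K. \<forall>q\<in>K. \<forall>a\<in>{0..1}. mix a p q \<in> K)"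

definition convex_prob_pairs ::
    "('a::topological_space measure \<times> 'b::topological_space measure) set \<Rightarrow> bool" where
  "convex_prob_pairs K \<longleftrightarrow>
     (\<forall>(p,p')\<in>K. \<forall>(q,q')\<in>K. \<forall>a\<in>{0..1}. (mix a p q, mix a p' q') \<in> K)"

lemma emeasure_mix:
  assumes "p \<in> Delta" "q \<in> Delta" "A \<in> sets borel"
  shows "emeasure (mix a p q) A = ennreal a * emeasure p A + ennreal (1 - a) * emeasure q A"
proof -
  let ?\<mu> = "\<lambda>A. ennreal a * emeasure p A + ennreal (1 - a) * emeasure q A"
  have *: "sets p = sets borel" "sets q = sets borel" using assms by (auto simp: Delta_def)
  have "countably_additive (sets borel) ?\<mu>"
  proof (rule countably_additiveI)
    fix F :: "nat \<Rightarrow> 'a set" assume F: "range F \<subseteq> sets borel" "disjoint_family F"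
    have "(\<Sum>i. emeasure p (F i)) = emeasure p (\<Union>i. F i)" "(\<Sum>i. emeasure q (F i)) = emeasure q (\<Union>i. F i)"
      using F * by (auto intro!: suminf_emeasure)
    then show "(\<Sum>i. ?\<mu> (F i)) = ?\<mu> (\<Union>i. F i)"
      by (simp add: suminf_add[symmetric] del: suminf_add)
  qed
  moreover have "positive (sets borel) ?\<mu>" by (simp add: positive_def)
  moreover have "sigma_algebra UNIV (sets borel :: 'a set set)"
    using sets.sigma_algebra_axioms[of "borel :: 'a measure"] by simp
  ultimately show ?thesis
    unfolding mix_def using assms(3) by (intro emeasure_measure_of_sigma) auto
qed

lemma mix_in_Delta:
  assumes "p \<in> Delta" "q \<in> Delta" "a \<in> {0..1}"
  shows "mix a p q \<in> Delta"
proof -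
  have s: "sets (mix a p q) = sets borel" "space (mix a p q) = UNIV"
    using sets.sigma_sets_eq[of "borel :: 'a measure"]
    by (auto simp: mix_def sets_measure_of_conv space_measure_of_conv)
  have "emeasure p UNIV = 1" "emeasure q UNIV = 1"
    using assms(1,2) prob_space.emeasure_space_1 sets_eq_imp_space_eq[of _ "borel :: 'a measure"]
    by (fastforce simp: Delta_def)+
  then have "emeasure (mix a p q) UNIV = 1"
    using assms by (simp add: emeasure_mix ennreal_plus[symmetric] del: ennreal_plus)
  then show ?thesis using s by (auto simp: Delta_def intro!: prob_spaceI)
qed

lemma integrable_lipschitz_Delta:
  fixes p :: "'a::compact_metric_space measure" and f :: "'a \<Rightarrow> real"
  assumes "p \<in> Delta" "C-lipschitz_on UNIV f"
  shows "integrable p f"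
proof -
  interpret prob_space p using assms(1) by (simp add: Delta_def)
  have c: "continuous_on UNIV f" using assms(2) by (rule lipschitz_on_continuous_on)
  then have "bounded (range f)"
    using compact_continuous_image[OF c compact_space_UNIV] compact_imp_bounded by blast
  then obtain B where "\<And>x. norm (f x) \<le> B" by (auto simp: bounded_iff)
  moreover have "f \<in> borel_measurable p"
    using assms(1) borel_measurable_continuous_onI[OF c]
    by (simp add: Delta_def cong: measurable_cong_sets)
  ultimately show ?thesis by (intro integrable_const_bound[of _ B]) auto
qed

lemma bdd_above_dKR:
  fixes p q :: "'a::compact_metric_space measure"
  assumes "p \<in> Delta" "q \<in> Delta"
  shows "bdd_above ((\<lambda>f. \<bar>integral\<^sup>L p f - integral\<^sup>L q f\<bar>) ` {f :: 'a \<Rightarrow> real. 1-lipschitz_on UNIV f})"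
proof -
  interpret p: prob_space p using assms(1) by (simp add: Delta_def)
  interpret q: prob_space q using assms(2) by (simp add: Delta_def)
  let ?D = "diameter (UNIV :: 'a set)"
  have D: "dist x y \<le> ?D" for x y :: 'a
    using diameter_bounded_bound[of "UNIV :: 'a set"] compact_imp_bounded[OF compact_space_UNIV] by auto
  obtain x0 :: 'a where True by simp
  have "\<bar>integral\<^sup>L p f - integral\<^sup>L q f\<bar> \<le> 2 * ?D" if f: "1-lipschitz_on UNIV f" for f :: "'a \<Rightarrow> real"
  proof -
    have b: "\<bar>f x - f x0\<bar> \<le> ?D" for x
      using lipschitz_onD[OF f, of x x0] D[of x x0] by (auto simp: dist_real_def)
    have i: "integrable p f" "integrable q f" using integrable_lipschitz_Delta assms f by auto
    have c: "f x0 - ?D \<le> f x" "f x \<le> f x0 + ?D" for x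
      using b[of x] by linarith+
    have "f x0 - ?D \<le> integral\<^sup>L p f" "integral\<^sup>L p f \<le> f x0 + ?D"
      using i c by (auto intro!: p.integral_ge_const p.integral_le_const)
    moreover have "f x0 - ?D \<le> integral\<^sup>L q f" "integral\<^sup>L q f \<le> f x0 + ?D"
      using i c by (auto intro!: q.integral_ge_const q.integral_le_const)
    ultimately show ?thesis by linarith
  qed
  then show ?thesis by (intro bdd_aboveI2[where M = "2 * ?D"]) simp
qed

lemma Delta_eqI:
  fixes p q :: "'a::compact_metric_space measure"
  assumes p: "p \<in> Delta" and q: "q \<in> Delta"
    and eq: "\<And>f :: 'a \<Rightarrow> real. 1-lipschitz_on UNIV f \<Longrightarrow> integral\<^sup>L p f = integral\<^sup>L q f"
  shows "p = q"
proof -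
  interpret p: prob_space p using p by (simp add: Delta_def)
  interpret q: prob_space q using q by (simp add: Delta_def)
  have s: "sets p = sets borel" "sets q = sets borel" using p q by (auto simp: Delta_def)
  have "measure p A = measure q A" if A: "closed A" "A \<noteq> {}" for A :: "'a set"
  proof -
    define f where "f n x = max 0 (1 - real n * infdist x A)" for n x
    have lip: "1-lipschitz_on UNIV (\<lambda>x. f n x / real n)" if "n > 0" for n
    proof (rule lipschitz_onI)
      fix x y :: 'a
      have "\<bar>infdist x A - infdist y A\<bar> \<le> dist x y"
        using infdist_triangle_abs by blast
      then have "real n * \<bar>infdist x A - infdist y A\<bar> \<le> real n * dist x y"
        by (intro mult_left_mono) auto
      then have "\<bar>real n * infdist x A - real n * infdist y A\<bar> \<le> real n * dist x y"
        by (simp add: abs_mult right_diff_distrib[symmetric])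
      then have "\<bar>f n x - f n y\<bar> \<le> real n * dist x y"
        unfolding f_def max_def by (auto split: if_splits)
      then show "dist (f n x / real n) (f n y / real n) \<le> 1 * dist x y"
        using that by (simp add: dist_real_def diff_divide_distrib[symmetric] divide_le_eq mult.commute)
    qed auto
    have fm: "f n \<in> borel_measurable borel" for n
      unfolding f_def by (intro borel_measurable_continuous_onI continuous_intros)
    have lim: "(\<lambda>n. f n x) \<longlonglongrightarrow> indicator A x" for x
    proof (cases "x \<in> A")
      case True
      then show ?thesis by (simp add: f_def)
    next
      case False
      then have pos: "infdist x A > 0"
        using A in_closed_iff_infdist_zero[of A x] infdist_nonneg[of x A] by fastforce
      obtain N :: nat where N: "1 / infdist x A < real N" using reals_Archimedean2 by blast
      have "f n x = 0" if "n \<ge> N" for n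
      proof -
        have "1 / infdist x A \<le> real n" using N that by linarith
        then have "1 \<le> real n * infdist x A" using pos by (simp add: divide_le_eq)
        then show ?thesis by (simp add: f_def)
      qed
      then have "\<forall>\<^sub>F n in sequentially. f n x = 0"
        by (auto simp: eventually_sequentially)
      then have "(\<lambda>n. f n x) \<longlonglongrightarrow> 0" by (rule tendsto_eventually)
      then show ?thesis using False by simp
    qed
    have bnd: "norm (f n x) \<le> 1" for n x by (simp add: f_def infdist_nonneg)
    have *: "(\<lambda>n. integral\<^sup>L r (f n)) \<longlonglongrightarrow> measure r A" if r: "r \<in> Delta" for r :: "'a measure"
    proof -
      interpret r: prob_space r using r by (simp add: Delta_def)
      have sr: "sets r = sets borel" using r by (simp add: Delta_def)
      have "(\<lambda>n. integral\<^sup>L r (f n)) \<longlonglongrightarrow> integral\<^sup>L r (indicator A)"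
      proof (rule integral_dominated_convergence[where w = "\<lambda>_. 1"])
        show "f n \<in> borel_measurable r" for n
          using fm sr by (simp cong: measurable_cong_sets)
        show "(indicator A :: 'a \<Rightarrow> real) \<in> borel_measurable r"
          using A sr by (simp cong: measurable_cong_sets)
      qed (use lim bnd in auto)
      moreover have "A \<in> sets r" using A sr by simp
      ultimately show ?thesis by simp
    qed
    have "integral\<^sup>L p (f n) = integral\<^sup>L q (f n)" for n
    proof (cases "n = 0")
      case True
      then have "f n = (\<lambda>_. 1)" by (simp add: f_def fun_eq_iff)
      then show ?thesis using p.prob_space q.prob_space by simp
    next
      case False
      then show ?thesis using eq[OF lip[of n]] by simp
    qed
    then show ?thesis using *[OF p] *[OF q] LIMSEQ_unique by simp
  qed
  then have eqc: "emeasure p A = emeasure q A" if "closed A" for A :: "'a set"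
    using that by (cases "A = {}") (auto simp: p.emeasure_eq_measure q.emeasure_eq_measure)
  show ?thesis
  proof (rule measure_eqI_generator_eq[where E = "Collect closed" and \<Omega> = UNIV and A = "\<lambda>_. UNIV"])
    show "sets p = sigma_sets UNIV (Collect closed)" "sets q = sigma_sets UNIV (Collect closed)"
      using s by (simp_all add: borel_eq_closed)
  qed (use eqc in \<open>auto simp: Int_stable_def\<close>)
qed

lemma Metric_space_dKR: "Metric_space (Delta :: 'a::compact_metric_space measure set) dKR"
proof
  let ?L = "{f :: 'a \<Rightarrow> real. 1-lipschitz_on UNIV f}"
  have L0: "(\<lambda>_. 0) \<in> ?L" by (simp add: lipschitz_on_def)
  have ub: "\<bar>integral\<^sup>L p f - integral\<^sup>L q f\<bar> \<le> dKR p q"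
    if "p \<in> Delta" "q \<in> Delta" "f \<in> ?L" for p q f
    using that cSUP_upper[OF that(3) bdd_above_dKR[OF that(1,2)]] by (simp add: dKR_def)
  show nonneg: "0 \<le> dKR p q" for p q :: "'a measure"
  proof (cases "p \<in> Delta \<and> q \<in> Delta")
    case True
    then show ?thesis using ub[OF _ _ L0, of p q] by simp
  qed (auto simp: dKR_def)
  show "dKR p q = dKR q p" for p q :: "'a measure"
    by (simp add: dKR_def abs_minus_commute conj_commute)
  show "dKR p r \<le> dKR p q + dKR q r" if "p \<in> Delta" "q \<in> Delta" "r \<in> Delta" for p q r :: "'a measure"
  proof -
    have "(SUP f\<in>?L. \<bar>integral\<^sup>L p f - integral\<^sup>L r f\<bar>) \<le> dKR p q + dKR q r"
    proof (rule cSUP_least)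
      fix f assume "f \<in> ?L"
      then show "\<bar>integral\<^sup>L p f - integral\<^sup>L r f\<bar> \<le> dKR p q + dKR q r"
        using ub[of p q f] ub[of q r f] that by linarith
    qed (use L0 in blast)
    then show ?thesis using that by (simp add: dKR_def)
  qed
  show "dKR p q = 0 \<longleftrightarrow> p = q" if "p \<in> Delta" "q \<in> Delta" for p q :: "'a measure"
  proof
    assume "dKR p q = 0"
    then show "p = q" using ub[OF that] by (intro Delta_eqI that) fastforce
  next
    assume "p = q"
    then show "dKR p q = 0" using that L0 by (auto simp: dKR_def intro: cSUP_const)
  qed
qed


section \<open>Gambling games\<close>

definition bounded_measurable :: "('a::topological_space \<Rightarrow> real) set" where
  "bounded_measurable = {f. f \<in> borel_measurable borel \<and> bounded (range f)}"

text \<open>The bilinear extension of a function of two states. A state \<open>x\<close> is identified with the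
  Dirac mass \<^term>\<open>return borel x\<close>.\<close>

definition mext :: "('a \<times> 'b \<Rightarrow> real) \<Rightarrow> 'a measure \<Rightarrow> 'b measure \<Rightarrow> real" where
  "mext v p q = (\<integral>y. (\<integral>x. v (x, y) \<partial>p) \<partial>q)"

definition leavable :: "('a::topological_space \<Rightarrow> 'a measure set) \<Rightarrow> bool" where
  "leavable \<Gamma> \<longleftrightarrow> (\<forall>x. return borel x \<in> \<Gamma> x)"

definition non_expansive :: "('a::metric_space \<Rightarrow> 'a measure set) \<Rightarrow> bool" where
  "non_expansive \<Gamma> \<longleftrightarrow> (\<forall>x x'. \<forall>p\<in>\<Gamma> x. \<exists>p'\<in>\<Gamma> x'. dKR p p' \<le> dist x x')"

definition gambling_house :: "('a::metric_space \<Rightarrow> 'a measure set) \<Rightarrow> bool" where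
  "gambling_house \<Gamma> \<longleftrightarrow>
     (\<forall>x. \<Gamma> x \<subseteq> Delta \<and> \<Gamma> x \<noteq> {} \<and> convex_probs (\<Gamma> x) \<and> compactin weak_star (\<Gamma> x)) \<and>
     leavable \<Gamma> \<and> non_expansive \<Gamma>"

definition standard_gambling_game ::
    "('a::compact_metric_space \<Rightarrow> 'a measure set) \<Rightarrow> ('b::compact_metric_space \<Rightarrow> 'b measure set) \<Rightarrow>
     ('a \<times> 'b \<Rightarrow> real) \<Rightarrow> bool" where
  "standard_gambling_game \<Gamma> \<Lambda> u \<longleftrightarrow>
     gambling_house \<Gamma> \<and> gambling_house \<Lambda> \<and> continuous_on UNIV u"

text \<open>The closed convex hull is the least closed convex set containing the given set.\<close>

definition lift_graph :: "('a::metric_space \<Rightarrow> 'a measure set) \<Rightarrow> ('a measure \<times> 'a measure) set" where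
  "lift_graph \<Gamma> = (\<lambda>C. closedin (prod_topology weak_star weak_star) C \<and> convex_prob_pairs C) hull
     {(return borel x, p) |x p. p \<in> \<Gamma> x}"

definition lift :: "('a::metric_space \<Rightarrow> 'a measure set) \<Rightarrow> 'a measure \<Rightarrow> 'a measure set" where
  "lift \<Gamma> p = {q. (p, q) \<in> lift_graph \<Gamma>}"

definition idempotent :: "('a::metric_space \<Rightarrow> 'a measure set) \<Rightarrow> bool" where
  "idempotent \<Gamma> \<longleftrightarrow> (\<forall>x. (\<Union>p\<in>\<Gamma> x. lift \<Gamma> p) = \<Gamma> x)"

definition vanishing_L1_variation :: "('a::metric_space \<Rightarrow> 'a measure set) \<Rightarrow> bool" where
  "vanishing_L1_variation \<Gamma> \<longleftrightarrow>
     (\<forall>\<epsilon>>0. \<exists>N. \<forall>n\<ge>N. \<forall>p :: nat \<Rightarrow> 'a measure.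
        (\<forall>t\<ge>1. p t \<in> Delta \<and> p (t + 1) \<in> lift \<Gamma> (p t)) \<longrightarrow>
        (1 / real n) * (\<Sum>t=1..n. dKR (p (t + 1)) (p t)) \<le> \<epsilon>)"

definition excessive :: "('a::metric_space \<Rightarrow> 'a measure set) \<Rightarrow> ('a \<times> 'b::metric_space \<Rightarrow> real) \<Rightarrow> bool" where
  "excessive \<Gamma> v \<longleftrightarrow> (\<forall>x y.
     (\<exists>p\<in>\<Gamma> x. v (x, y) = mext v p (return borel y)) \<and>
     (\<forall>p\<in>\<Gamma> x. mext v p (return borel y) \<le> v (x, y)))"

definition depressive :: "('b::metric_space \<Rightarrow> 'b measure set) \<Rightarrow> ('a::metric_space \<times> 'b \<Rightarrow> real) \<Rightarrow> bool" where
  "depressive \<Lambda> v \<longleftrightarrow> (\<forall>x y.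
     (\<exists>q\<in>\<Lambda> y. v (x, y) = mext v (return borel x) q) \<and>
     (\<forall>q\<in>\<Lambda> y. v (x, y) \<le> mext v (return borel x) q))"

definition Q1 :: "('a::metric_space \<Rightarrow> 'a measure set) \<Rightarrow> ('a \<times> 'b::metric_space \<Rightarrow> real) \<Rightarrow>
    ('a \<times> 'b \<Rightarrow> real) \<Rightarrow> bool" where
  "Q1 \<Gamma> u v \<longleftrightarrow> (\<forall>x y. \<exists>p\<in>\<Gamma> x.
     v (x, y) = mext v p (return borel y) \<and> mext v p (return borel y) \<le> mext u p (return borel y))"

definition Q2 :: "('b::metric_space \<Rightarrow> 'b measure set) \<Rightarrow> ('a::metric_space \<times> 'b \<Rightarrow> real) \<Rightarrow>
    ('a \<times> 'b \<Rightarrow> real) \<Rightarrow> bool" where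
  "Q2 \<Lambda> u v \<longleftrightarrow> (\<forall>x y. \<exists>q\<in>\<Lambda> y.
     v (x, y) = mext v (return borel x) q \<and> mext v (return borel x) q \<ge> mext u (return borel x) q)"


section \<open>Strategies and plays\<close>

text \<open>A play is \<open>\<omega> :: nat \<Rightarrow> 'a \<times> 'b\<close>, where \<open>\<omega> i\<close> is the pair of states at stage \<open>i + 1\<close>. Hence the
  history available at stage \<open>t \<ge> 1\<close> is a point \<open>h\<close> of \<open>hist t\<close>, indexed by \<open>{0..<t}\<close>, with current
  states \<open>h (t - 1)\<close>. Measurability into \<^term>\<open>prob_algebra borel\<close> is measurability for the
  Borel sets of the weak-* topology. The value of a strategy at \<open>t = 0\<close> is irrelevant.\<close>

definition hist :: "nat \<Rightarrow> (nat \<Rightarrow> 'a::metric_space \<times> 'b::metric_space) measure" where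
  "hist t = PiM {0..<t} (\<lambda>_. borel)"

type_synonym ('a, 'b, 'c) strategy = "nat \<Rightarrow> (nat \<Rightarrow> 'a \<times> 'b) \<Rightarrow> 'c measure"

definition strategy1 :: "('a::metric_space \<Rightarrow> 'a measure set) \<Rightarrow>
    ('a, 'b::metric_space, 'a) strategy \<Rightarrow> bool" where
  "strategy1 \<Gamma> \<sigma> \<longleftrightarrow> (\<forall>t\<ge>1. \<sigma> t \<in> hist t \<rightarrow>\<^sub>M prob_algebra borel \<and>
     (\<forall>h\<in>space (hist t). \<sigma> t h \<in> \<Gamma> (fst (h (t - 1)))))"

definition strategy2 :: "('b::metric_space \<Rightarrow> 'b measure set) \<Rightarrow>
    ('a::metric_space, 'b, 'b) strategy \<Rightarrow> bool" where
  "strategy2 \<Lambda> \<tau> \<longleftrightarrow> (\<forall>t\<ge>1. \<tau> t \<in> hist t \<rightarrow>\<^sub>M prob_algebra borel \<and>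
     (\<forall>h\<in>space (hist t). \<tau> t h \<in> \<Lambda> (snd (h (t - 1)))))"

definition step :: "('a::metric_space \<times> 'b::metric_space) \<Rightarrow> ('a, 'b, 'a) strategy \<Rightarrow> ('a, 'b, 'b) strategy \<Rightarrow>
    nat \<Rightarrow> (nat \<Rightarrow> 'a \<times> 'b) \<Rightarrow> ('a \<times> 'b) measure" where
  "step z \<sigma> \<tau> i h = (if i = 0 then return borel z else \<sigma> i h \<Otimes>\<^sub>M \<tau> i h)"

text \<open>The law of the play: the projective limit given by the Ionescu-Tulcea theorem for the
  kernels \<^term>\<open>step z \<sigma> \<tau>\<close>.\<close>

definition play :: "('a::metric_space \<times> 'b::metric_space) \<Rightarrow> ('a, 'b, 'a) strategy \<Rightarrow> ('a, 'b, 'b) strategy \<Rightarrow>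
    (nat \<Rightarrow> 'a \<times> 'b) measure" where
  "play z \<sigma> \<tau> = projective_family.lim UNIV (Ionescu_Tulcea.CI (step z \<sigma> \<tau>) (\<lambda>_. borel)) (\<lambda>_. borel)"

lemma Ionescu_Tulcea_step:
  fixes \<Gamma> :: "'a::compact_metric_space \<Rightarrow> 'a measure set"
    and \<Lambda> :: "'b::compact_metric_space \<Rightarrow> 'b measure set"
  assumes "strategy1 \<Gamma> \<sigma>" "strategy2 \<Lambda> \<tau>"
  shows "Ionescu_Tulcea (step z \<sigma> \<tau>) (\<lambda>_. borel)"
proof -
  have *: "step z \<sigma> \<tau> i \<in> PiM {0..<i} (\<lambda>_. borel) \<rightarrow>\<^sub>M prob_algebra borel" for i
  proof (cases "i = 0")
    case True
    have "return borel z \<in> space (prob_algebra borel)"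
      by (simp add: space_prob_algebra prob_space_return)
    then show ?thesis using True by (auto simp: step_def[abs_def])
  next
    case False
    then have [measurable]: "\<sigma> i \<in> PiM {0..<i} (\<lambda>_. borel) \<rightarrow>\<^sub>M prob_algebra borel"
        "\<tau> i \<in> PiM {0..<i} (\<lambda>_. borel) \<rightarrow>\<^sub>M prob_algebra borel"
      using assms by (auto simp: strategy1_def strategy2_def hist_def)
    have "(\<lambda>h. \<sigma> i h \<Otimes>\<^sub>M \<tau> i h) \<in> PiM {0..<i} (\<lambda>_. borel) \<rightarrow>\<^sub>M prob_algebra (borel \<Otimes>\<^sub>M borel)"
      by measurable
    then show ?thesis using False by (simp add: step_def[abs_def] borel_prod)
  qed
  show ?thesis
  proof (rule Ionescu_Tulcea.intro)
    show "step z \<sigma> \<tau> i \<in> PiM {0..<i} (\<lambda>_. borel) \<rightarrow>\<^sub>M subprob_algebra borel" for i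
      using * by (rule measurable_prob_algebraD)
    show "prob_space (step z \<sigma> \<tau> i h)" if "h \<in> space (PiM {0..<i} (\<lambda>_. borel))" for i h
      using measurable_space[OF * that] by (simp add: space_prob_algebra)
  qed
qed

definition mean_payoff :: "('a::metric_space \<times> 'b::metric_space \<Rightarrow> real) \<Rightarrow> nat \<Rightarrow> 'a \<times> 'b \<Rightarrow>
    ('a, 'b, 'a) strategy \<Rightarrow> ('a, 'b, 'b) strategy \<Rightarrow> real" where
  "mean_payoff u n z \<sigma> \<tau> = (\<integral>\<omega>. (1 / real n) * (\<Sum>t=1..n. u (\<omega> (t - 1))) \<partial>play z \<sigma> \<tau>)"

definition uniformly_guarantees1 :: "('b::metric_space \<Rightarrow> 'b measure set) \<Rightarrow>
    ('a::metric_space \<times> 'b \<Rightarrow> real) \<Rightarrow> ('a, 'b, 'a) strategy \<Rightarrow> ('a \<times> 'b \<Rightarrow> real) \<Rightarrow> bool" where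
  "uniformly_guarantees1 \<Lambda> u \<sigma> w \<longleftrightarrow> (\<forall>\<epsilon>>0. \<exists>N. \<forall>n\<ge>N. \<forall>z. \<forall>\<tau>. strategy2 \<Lambda> \<tau> \<longrightarrow>
     mean_payoff u n z \<sigma> \<tau> \<ge> w z - \<epsilon>)"

definition uniformly_guarantees2 :: "('a::metric_space \<Rightarrow> 'a measure set) \<Rightarrow>
    ('a \<times> 'b::metric_space \<Rightarrow> real) \<Rightarrow> ('a, 'b, 'b) strategy \<Rightarrow> ('a \<times> 'b \<Rightarrow> real) \<Rightarrow> bool" where
  "uniformly_guarantees2 \<Gamma> u \<tau> w \<longleftrightarrow> (\<forall>\<epsilon>>0. \<exists>N. \<forall>n\<ge>N. \<forall>z. \<forall>\<sigma>. strategy1 \<Gamma> \<sigma> \<longrightarrow>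
     mean_payoff u n z \<sigma> \<tau> \<le> w z + \<epsilon>)"

definition is_uniform_value :: "('a::metric_space \<Rightarrow> 'a measure set) \<Rightarrow>
    ('b::metric_space \<Rightarrow> 'b measure set) \<Rightarrow> ('a \<times> 'b \<Rightarrow> real) \<Rightarrow> ('a \<times> 'b \<Rightarrow> real) \<Rightarrow> bool" where
  "is_uniform_value \<Gamma> \<Lambda> u w \<longleftrightarrow> w \<in> bounded_measurable \<and>
     (\<exists>\<sigma>. strategy1 \<Gamma> \<sigma> \<and> uniformly_guarantees1 \<Lambda> u \<sigma> w) \<and>
     (\<exists>\<tau>. strategy2 \<Lambda> \<tau> \<and> uniformly_guarantees2 \<Gamma> u \<tau> w)"

text \<open>That the chosen probability lies in \<open>\<Gamma> x\<close> (resp. \<open>\<Lambda> y\<close>) is part of being a strategy.\<close>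

definition adapted1 :: "('a::metric_space \<times> 'b::metric_space \<Rightarrow> real) \<Rightarrow> ('a \<times> 'b \<Rightarrow> real) \<Rightarrow>
    ('a, 'b, 'a) strategy \<Rightarrow> bool" where
  "adapted1 u w \<sigma> \<longleftrightarrow> (\<forall>t\<ge>1. \<forall>h\<in>space (hist t). \<forall>x y. h (t - 1) = (x, y) \<longrightarrow>
     w (x, y) \<le> mext w (\<sigma> t h) (return borel y) \<and>
     mext w (\<sigma> t h) (return borel y) \<le> mext u (\<sigma> t h) (return borel y))"

definition adapted2 :: "('a::metric_space \<times> 'b::metric_space \<Rightarrow> real) \<Rightarrow> ('a \<times> 'b \<Rightarrow> real) \<Rightarrow>
    ('a, 'b, 'b) strategy \<Rightarrow> bool" where
  "adapted2 u w \<tau> \<longleftrightarrow> (\<forall>t\<ge>1. \<forall>h\<in>space (hist t). \<forall>x y. h (t - 1) = (x, y) \<longrightarrow>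
     w (x, y) \<ge> mext w (return borel x) (\<tau> t h) \<and>
     mext w (return borel x) (\<tau> t h) \<ge> mext u (return borel x) (\<tau> t h))"

end

theory Submission
  imports Defs
begin

text \<open>Let \<open>v\<close> be a uniform limit point of the discounted values. By idempotence, a first move
  followed by an optimal kernel is itself a single move, so every discounted value, hence \<open>v\<close>, is
  exactly excessive and depressive. Testing a discounted optimum against the answer \<open>\<delta>\<^sub>y\<close> cancels the
  continuation payoff, which gives (Q1), and (Q2) by symmetry.

  Against any strategy of player 2, a strategy adapted to \<open>v\<close> turns \<open>v (x\<^sub>t, y\<^sub>t)\<close> into a submartingale
  dominated by the expectation of \<open>u (x\<^sub>t\<^sub>+\<^sub>1, y\<^sub>t)\<close>. The mismatch of the two time indices vanishes on
  average because vanishing \<open>L\<^sub>1\<close>-variation of laws forces vanishing expected displacement along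
  paths: otherwise, moving the mass of one small cell of the state space at a time would yield a
  sequence of laws whose variation does not vanish.

  A merely measurable solution \<open>w\<close> of the functional equations is bounded above by the values of the
  finite games with stage payoff \<open>u (x\<^sub>t\<^sub>+\<^sub>1, y\<^sub>t)\<close>. These are continuous, player 1 can attain them by
  measurable strategies, and against a strategy of player 2 adapted to \<open>v\<close> they are at most about
  \<open>v\<close>; by symmetry \<open>w = v\<close>.\<close>

section \<open>Borel probabilities\<close>

text \<open>An adapted move controls a payoff that couples the next \<open>x\<close> with the
  present \<open>y\<close>. Closeness of successive laws of \<open>x\<close> alone says nothing
  about that coupling, whence the passage from \<open>dKR\<close> to expected displacement.

  \<open>idempotent\<close> and \<open>vanishing_L1_variation\<close> speak only of
  \<open>lift\<close>, a closed convex hull whose members have no explicit form. Kernels reach it as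
  barycenters (\<open>bind_mem_lift\<close>), approximated through finitely many Lipschitz test
  functions.

  A continuous \<open>u\<close> need not be Lipschitz, so regularity is carried by pairs
  \<open>(e, C)\<close> bounding oscillation by \<open>e + C * dist\<close>. By non-expansiveness
  the discounted operator preserves each such pair of \<open>u\<close>, whatever the discount
  factor; this makes the discounted values relatively compact.

  Player 2 is treated by exchanging the roles and changing the sign of the payoff. For sup-inf
  values that exchange rests on a minimax theorem, whose one application is \<open>Val_swap\<close>.
  Finite horizon values are never exchanged: their stage payoff at mixed times is not symmetric in
  the players.\<close>

lemma DeltaD:
  assumes "p \<in> Delta"
  shows "prob_space p" "sets p = sets borel" "space p = UNIV"
  using assms sets_eq_imp_space_eq[of p borel] by (auto simp: Delta_def)

lemma borel_measurable_Delta: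
  assumes "p \<in> Delta" "f \<in> borel_measurable borel"
  shows "f \<in> borel_measurable p"
  using assms(2) unfolding measurable_cong_sets[OF DeltaD(2)[OF assms(1)] refl] .

lemma integrable_Delta:
  fixes f :: "'a::topological_space \<Rightarrow> real"
  assumes "p \<in> Delta" "f \<in> borel_measurable borel" "\<And>x. \<bar>f x\<bar> \<le> B"
  shows "integrable p f"
proof -
  interpret prob_space p using assms(1) by (rule DeltaD)
  show ?thesis
    using assms(3) by (intro integrable_const_bound[of _ B] borel_measurable_Delta[OF assms(1,2)]) simp
qed

lemma return_in_Delta [simp]: "return borel x \<in> Delta"
  by (simp add: Delta_def prob_space_return)

lemma distr_in_Delta: "prob_space M \<Longrightarrow> f \<in> M \<rightarrow>\<^sub>M borel \<Longrightarrow> distr M borel f \<in> Delta"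
  by (simp add: Delta_def prob_space.prob_space_distr)

lemma integral_bounds_const:
  fixes f :: "'a \<Rightarrow> real"
  assumes "prob_space M" "f \<in> borel_measurable M" "\<And>x. x \<in> space M \<Longrightarrow> \<bar>f x\<bar> \<le> B"
  shows "integrable M f" "\<bar>integral\<^sup>L M f\<bar> \<le> B"
proof -
  interpret prob_space M by fact
  show i: "integrable M f" using assms by (intro integrable_const_bound[of _ B]) auto
  have "integral\<^sup>L M f \<le> B" 
    by (intro integral_le_const i AE_I2) (use assms(3) in fastforce)
  moreover have "- B \<le> integral\<^sup>L M f"
    by (intro integral_ge_const i AE_I2) (use assms(3) in fastforce)
  ultimately show "\<bar>integral\<^sup>L M f\<bar> \<le> B" by linarith
qed

lemma prob_algebra_borel_Delta:
  "S \<in> M \<rightarrow>\<^sub>M prob_algebra borel \<Longrightarrow> \<omega> \<in> space M \<Longrightarrow> S \<omega> \<in> Delta"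
  by (drule (1) measurable_space) (simp add: Delta_eq_space_prob_algebra)

lemma measurable_integral_kernel:
  fixes f :: "'a::topological_space \<Rightarrow> real"
  assumes "S \<in> M \<rightarrow>\<^sub>M prob_algebra borel" "f \<in> borel_measurable borel"
  shows "(\<lambda>\<omega>. integral\<^sup>L (S \<omega>) f) \<in> borel_measurable M"
  by (rule measurable_compose[OF measurable_prob_algebraD[OF assms(1)]
        integral_measurable_subprob_algebra[OF assms(2)]])

lemma bind_in_Delta:
  assumes "prob_space M" "S \<in> M \<rightarrow>\<^sub>M prob_algebra borel"
  shows "M \<bind> S \<in> Delta"
  using prob_space_bind'[of M M S borel] sets_bind'[of M M S borel] assms
  by (simp add: Delta_def space_prob_algebra)

lemma integral_bind_kernel:
  fixes f :: "'a::topological_space \<Rightarrow> real"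
  assumes M: "prob_space M" and S: "S \<in> M \<rightarrow>\<^sub>M prob_algebra borel"
    and f: "f \<in> borel_measurable borel" and B: "\<And>x. \<bar>f x\<bar> \<le> B"
  shows "integral\<^sup>L (M \<bind> S) f = (\<integral>\<omega>. integral\<^sup>L (S \<omega>) f \<partial>M)"
proof (rule integral_bind[where B=B and B'=1 and K=borel])
  interpret prob_space M by fact
  show "finite_measure M" by unfold_locales
  show "AE x in M. emeasure (S x) (space (S x)) \<le> ennreal 1"
    using prob_algebra_borel_Delta[OF S] by (intro AE_I2) (simp add: DeltaD(1) prob_space.emeasure_space_1)
qed (use assms measurable_prob_algebraD[OF S] in auto)

text \<open>Writing the mixture as the bind of a Bernoulli law with a two-valued kernel makes the
  formula an instance of \<open>integral_bind_kernel\<close>.\<close>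

lemma integral_mix:
  fixes f :: "'a::topological_space \<Rightarrow> real"
  assumes p: "p \<in> Delta" and q: "q \<in> Delta" and a: "a \<in> {0..1}"
    and f: "f \<in> borel_measurable borel" and B: "\<And>x. \<bar>f x\<bar> \<le> B"
  shows "integral\<^sup>L (mix a p q) f = a * integral\<^sup>L p f + (1 - a) * integral\<^sup>L q f"
proof -
  let ?S = "\<lambda>b. if b then p else q"
  let ?M = "measure_pmf (bernoulli_pmf a)"
  have S: "?S \<in> ?M \<rightarrow>\<^sub>M prob_algebra borel"
    using p q by (auto simp: Delta_eq_space_prob_algebra)
  have D: "?M \<bind> ?S \<in> Delta" by (rule bind_in_Delta[OF _ S]) (rule prob_space_measure_pmf)
  have "mix a p q = ?M \<bind> ?S"
  proof (rule measure_eqI)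
    show "sets (mix a p q) = sets (?M \<bind> ?S)"
      using mix_in_Delta[OF p q a] D by (simp add: DeltaD)
    fix A assume "A \<in> sets (mix a p q)"
    then have A: "A \<in> sets borel" using mix_in_Delta[OF p q a] by (simp add: DeltaD)
    have "emeasure (?M \<bind> ?S) A = (\<integral>\<^sup>+b. emeasure (?S b) A \<partial>?M)"
      using A by (intro emeasure_bind[where N=borel] measurable_prob_algebraD[OF S]) auto
    then show "emeasure (mix a p q) A = emeasure (?M \<bind> ?S) A"
      using a by (simp add: emeasure_mix[OF p q A] mult.commute)
  qed
  then have "integral\<^sup>L (mix a p q) f = (\<integral>b. integral\<^sup>L (?S b) f \<partial>?M)"
    using integral_bind_kernel[OF _ S f B] prob_space_measure_pmf by metis
  then show ?thesis using a by (simp add: mult.commute)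
qed

section \<open>The Kantorovich--Rubinstein distance\<close>

lemma abs_integral_diff_le_dKR:
  fixes f :: "'a::compact_metric_space \<Rightarrow> real"
  assumes "p \<in> Delta" "q \<in> Delta" "1-lipschitz_on UNIV f"
  shows "\<bar>integral\<^sup>L p f - integral\<^sup>L q f\<bar> \<le> dKR p q"
  using assms cSUP_upper[OF _ bdd_above_dKR[OF assms(1,2)], of f] by (simp add: dKR_def)

lemma dKR_leI:
  fixes p q :: "'a::compact_metric_space measure"
  assumes "p \<in> Delta" "q \<in> Delta"
    and "\<And>f :: 'a \<Rightarrow> real. 1-lipschitz_on UNIV f \<Longrightarrow> \<bar>integral\<^sup>L p f - integral\<^sup>L q f\<bar> \<le> e"
  shows "dKR p q \<le> e"
proof -
  have "1-lipschitz_on UNIV (\<lambda>_::'a. 0::real)" by (simp add: lipschitz_on_def)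
  then show ?thesis using assms by (auto simp: dKR_def intro!: cSUP_least)
qed

lemma dKR_nonneg: "0 \<le> dKR (p :: 'a::compact_metric_space measure) q"
  using Metric_space.nonneg[OF Metric_space_dKR] .

lemma dKR_commute: "dKR (p :: 'a::compact_metric_space measure) q = dKR q p"
  using Metric_space.commute[OF Metric_space_dKR] .

lemma dKR_triangle:
  "p \<in> Delta \<Longrightarrow> q \<in> Delta \<Longrightarrow> r \<in> Delta \<Longrightarrow> dKR (p :: 'a::compact_metric_space measure) r \<le> dKR p q + dKR q r"
  using Metric_space.triangle[OF Metric_space_dKR] .

lemma dKR_self [simp]: "dKR (p :: 'a::compact_metric_space measure) p = 0"
proof (cases "p \<in> Delta")
  case True
  then show ?thesis by (rule Metric_space.mdist_zero[OF Metric_space_dKR])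
qed (simp add: dKR_def)

text \<open>An affine modulus of continuity. For each \<open>e > 0\<close> a continuous function on
  a compact space has some slope \<open>C\<close>, although it may have no Lipschitz constant, which
  is the case \<open>e = 0\<close>.\<close>

definition osc_le :: "real \<Rightarrow> real \<Rightarrow> ('a::metric_space \<Rightarrow> real) \<Rightarrow> bool" where
  "osc_le e C f \<longleftrightarrow> (\<forall>x x'. \<bar>f x - f x'\<bar> \<le> e + C * dist x x')"

text \<open>The infimal convolution of \<open>f\<close> with \<open>C * dist\<close> is a \<open>C\<close>-Lipschitz function
  within \<open>e\<close> of \<open>f\<close>.\<close>

lemma integral_diff_le_osc:
  fixes f :: "'a::compact_metric_space \<Rightarrow> real"
  assumes p: "p \<in> Delta" and q: "q \<in> Delta" and f: "f \<in> borel_measurable borel" "\<And>x. \<bar>f x\<bar> \<le> B"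
    and osc: "osc_le e C f" and C: "C \<ge> 0"
  shows "\<bar>integral\<^sup>L p f - integral\<^sup>L q f\<bar> \<le> e + C * dKR p q"
proof -
  define g where "g x = (INF x'. f x' + C * dist x x')" for x
  have bdd: "bdd_below (range (\<lambda>x'. f x' + C * dist x x'))" for x
  proof (intro bdd_belowI2[where m="- B"])
    fix x' show "- B \<le> f x' + C * dist x x'"
      using f(2)[of x'] mult_nonneg_nonneg[OF C zero_le_dist[of x x']] by linarith
  qed
  have g_le: "g x \<le> f x' + C * dist x x'" for x x'
    unfolding g_def by (rule cINF_lower[OF bdd]) simp
  have g_ge: "f x - e \<le> g x" for x
    unfolding g_def
  proof (rule cINF_greatest)
    fix x' show "f x - e \<le> f x' + C * dist x x'"
      using osc[unfolded osc_le_def, rule_format, of x x'] by linarith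
  qed simp
  have lip: "g x \<le> g y + C * dist x y" for x y
  proof -
    have "g x - C * dist x y \<le> g y" unfolding g_def[of y]
    proof (rule cINF_greatest)
      fix x'
      have "C * dist x x' \<le> C * dist x y + C * dist y x'"
        using mult_left_mono[OF dist_triangle C, of x x' y] by (simp add: distrib_left)
      then show "g x - C * dist x y \<le> f x' + C * dist y x'" using g_le[of x x'] by linarith
    qed simp
    then show ?thesis by linarith
  qed
  have lipg: "C-lipschitz_on UNIV g"
  proof (rule lipschitz_onI[OF _ C])
    fix x y show "dist (g x) (g y) \<le> C * dist x y"
      using lip[of x y] lip[of y x] by (simp add: dist_real_def dist_commute)
  qed
  have gm: "g \<in> borel_measurable borel"
    by (intro borel_measurable_continuous_onI lipschitz_on_continuous_on[OF lipg])
  have gint: "\<bar>integral\<^sup>L p g - integral\<^sup>L q g\<bar> \<le> C * dKR p q"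
  \<comment> \<open>Rescaling \<open>g\<close> to a 1-Lipschitz function divides by
    \<open>C\<close>; for \<open>C = 0\<close> the function is constant and both integrals
    agree.\<close>
  proof (cases "C = 0")
    case True
    then have "g x = g y" for x y using lip[of x y] lip[of y x] by simp
    then obtain c where "g = (\<lambda>_. c)" by (metis ext)
    then show ?thesis using True prob_space.prob_space[OF DeltaD(1)[OF p]] prob_space.prob_space[OF DeltaD(1)[OF q]] by simp
  next
    case False
    then have "C > 0" using C by simp
    have "1-lipschitz_on UNIV (\<lambda>x. g x / C)"
    proof (rule lipschitz_onI)
      fix x y show "dist (g x / C) (g y / C) \<le> 1 * dist x y"
        using lipschitz_onD[OF lipg, of x y] \<open>C > 0\<close>
        by (simp add: dist_real_def diff_divide_distrib[symmetric] divide_le_eq mult.commute)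
    qed simp
    from abs_integral_diff_le_dKR[OF p q this] \<open>C > 0\<close> show ?thesis
      by (simp add: diff_divide_distrib[symmetric] divide_le_eq mult.commute)
  qed
  have ig: "integrable r g" "integrable r f" if "r \<in> Delta" for r
    using that lipg f by (auto intro: integrable_lipschitz_Delta integrable_Delta)
  \<comment> \<open>Since \<open>g\<close> lies below \<open>f\<close> by at most \<open>e\<close>,
    both approximation errors have the same sign, and their difference costs \<open>e\<close> rather
    than \<open>2 * e\<close>.\<close>
  have close: "integral\<^sup>L r g \<le> integral\<^sup>L r f" "integral\<^sup>L r f \<le> integral\<^sup>L r g + e" if r: "r \<in> Delta" for r
  proof -
    interpret prob_space r using r by (simp add: DeltaD)
    show "integral\<^sup>L r g \<le> integral\<^sup>L r f"
      using g_le[of x x for x] ig[OF r] by (intro integral_mono) auto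
    have "integral\<^sup>L r f \<le> (\<integral>x. g x + e \<partial>r)"
      using g_ge ig[OF r] by (intro integral_mono) (auto simp: diff_le_eq)
    then show "integral\<^sup>L r f \<le> integral\<^sup>L r g + e" using ig[OF r] by (simp add: prob_space)
  qed
  show ?thesis using gint close[OF p] close[OF q] by linarith
qed

section \<open>Finite nets\<close>

text \<open>A quantitative Arzela-Ascoli argument. Values on a finite \<open>d\<close>-net, rounded
  down to multiples of \<open>r\<close>, take finitely many codes. Two functions with the same code
  differ by less than \<open>r\<close> on the net and so by less than \<open>3 * r\<close>
  everywhere; one representative per code is enough.\<close>

lemma finite_net_equicontinuous:
  fixes F :: "('z::metric_space \<Rightarrow> real) set"
  assumes K: "compact (UNIV :: 'z set)"
    and B: "\<And>f z. f \<in> F \<Longrightarrow> \<bar>f z\<bar> \<le> B"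
    and equi: "\<And>e. e > 0 \<Longrightarrow> \<exists>d>0. \<forall>f\<in>F. \<forall>z z'. dist z z' < d \<longrightarrow> \<bar>f z - f z'\<bar> < e"
    and e: "e > 0"
  shows "\<exists>G. finite G \<and> G \<subseteq> F \<and> (\<forall>f\<in>F. \<exists>g\<in>G. \<forall>z. \<bar>f z - g z\<bar> < e)"
proof -
  define r where "r = e / 3"
  have r: "r > 0" "e = 3 * r" using e by (simp_all add: r_def)
  obtain d where d: "d > 0" "\<And>f z z'. f \<in> F \<Longrightarrow> dist z z' < d \<Longrightarrow> \<bar>f z - f z'\<bar> < r"
    using equi[OF r(1)] by blast
  have "\<exists>N. finite N \<and> (UNIV :: 'z set) \<subseteq> (\<Union>x\<in>N. ball x d)"
    using K d(1) by (simp only: compact_eq_totally_bounded)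
  then obtain N :: "'z set" where N: "finite N" "UNIV \<subseteq> (\<Union>x\<in>N. ball x d)" by (elim exE conjE)
  define code where "code f = restrict (\<lambda>z. \<lfloor>f z / r\<rfloor>) N" for f :: "'z \<Rightarrow> real"
  have "code ` F \<subseteq> N \<rightarrow>\<^sub>E {\<lfloor>- B / r\<rfloor>..\<lfloor>B / r\<rfloor>}"
  proof
    fix c assume "c \<in> code ` F"
    then obtain f where f: "f \<in> F" "c = code f" by blast
    have "\<lfloor>- B / r\<rfloor> \<le> \<lfloor>f x / r\<rfloor>" "\<lfloor>f x / r\<rfloor> \<le> \<lfloor>B / r\<rfloor>" for x
      using B[OF f(1), of x] r by (intro floor_mono divide_right_mono; linarith)+
    then show "c \<in> N \<rightarrow>\<^sub>E {\<lfloor>- B / r\<rfloor>..\<lfloor>B / r\<rfloor>}"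
      unfolding f(2) code_def restrict_PiE_iff by (metis atLeastAtMost_iff)
  qed
  then have fin: "finite (code ` F)"
    by (rule finite_subset) (auto intro: finite_PiE N(1))
  define G where "G = inv_into F code ` (code ` F)"
  have "\<exists>g\<in>G. \<forall>z. \<bar>f z - g z\<bar> < e" if f: "f \<in> F" for f
  proof -
    define g where "g = inv_into F code (code f)"
    have g: "g \<in> F" "code g = code f" using f unfolding g_def by (simp_all add: inv_into_into f_inv_into_f)
    have "\<bar>f z - g z\<bar> < e" for z
    proof -
      have "z \<in> (\<Union>x\<in>N. ball x d)" using N(2) by (rule subsetD) simp
      then obtain x where x: "x \<in> N" "dist z x < d" by (auto simp: dist_commute)
      have "\<lfloor>f x / r\<rfloor> = \<lfloor>g x / r\<rfloor>" using fun_cong[OF g(2), of x] x(1) by (simp add: code_def)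
      then have "\<bar>f x / r - g x / r\<bar> < 1" by linarith
      then have "\<bar>f x - g x\<bar> / r < 1"
        using r(1) by (simp add: diff_divide_distrib[symmetric])
      then have "\<bar>f x - g x\<bar> < r" using r(1) by (simp add: divide_less_eq)
      then show ?thesis using d(2)[OF f x(2)] d(2)[OF g(1) x(2)] r(2) by linarith
    qed
    moreover have "g \<in> G" using f unfolding G_def g_def by blast
    ultimately show ?thesis by blast
  qed
  moreover have "finite G" using fin unfolding G_def by (rule finite_imageI)
  moreover have "G \<subseteq> F" unfolding G_def by (auto intro: inv_into_into)
  ultimately show ?thesis by blast
qed

text \<open>Subtracting the value at \<open>x0\<close> changes no difference of integrals between
  two probabilities, and the functions so normalized are uniformly bounded and equicontinuous. Thus
  finitely many test functions determine \<open>dKR\<close> up to \<open>e\<close>.\<close>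

lemma finite_net_lipschitz:
  assumes e: "e > 0"
  shows "\<exists>G :: ('a::compact_metric_space \<Rightarrow> real) set. finite G \<and> (\<forall>g\<in>G. 1-lipschitz_on UNIV g) \<and>
    (\<forall>p\<in>Delta. \<forall>q\<in>Delta. \<forall>c. (\<forall>g\<in>G. \<bar>integral\<^sup>L p g - integral\<^sup>L q g\<bar> \<le> c) \<longrightarrow> dKR p q \<le> c + e)"
proof -
  obtain x0 :: 'a where True by simp
  let ?D = "diameter (UNIV :: 'a set)"
  have D: "dist x y \<le> ?D" for x y :: 'a
    using diameter_bounded_bound[of "UNIV :: 'a set"] compact_imp_bounded[OF compact_space_UNIV] by auto
  define F where "F = {f :: 'a \<Rightarrow> real. 1-lipschitz_on UNIV f \<and> f x0 = 0}"
  have lip: "\<bar>f x - f y\<bar> \<le> dist x y" if "f \<in> F" for f x y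
    using that lipschitz_onD[of 1 UNIV f x y] by (simp add: F_def dist_real_def)
  have "\<exists>G. finite G \<and> G \<subseteq> F \<and> (\<forall>f\<in>F. \<exists>g\<in>G. \<forall>z. \<bar>f z - g z\<bar> < e / 2)"
  proof (rule finite_net_equicontinuous[OF compact_space_UNIV])
    show "\<bar>f z\<bar> \<le> ?D" if "f \<in> F" for f z
      using lip[OF that, of z x0] D[of z x0] that by (simp add: F_def)
    show "\<exists>d>0. \<forall>f\<in>F. \<forall>z z'. dist z z' < d \<longrightarrow> \<bar>f z - f z'\<bar> < e'" if "e' > 0" for e'
      using that lip by (intro exI[of _ e']) (auto intro: le_less_trans)
  qed (use e in simp)
  then obtain G where G: "finite G" "G \<subseteq> F" "\<And>f. f \<in> F \<Longrightarrow> \<exists>g\<in>G. \<forall>z. \<bar>f z - g z\<bar> < e / 2" by blast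
  have "dKR p q \<le> c + e" if p: "p \<in> Delta" and q: "q \<in> Delta"
    and c: "\<And>g. g \<in> G \<Longrightarrow> \<bar>integral\<^sup>L p g - integral\<^sup>L q g\<bar> \<le> c" for p q c
  proof (rule dKR_leI[OF p q])
    fix f :: "'a \<Rightarrow> real" assume f: "1-lipschitz_on UNIV f"
    have "(\<lambda>x. f x - f x0) \<in> F" using f by (auto simp: F_def lipschitz_on_def dist_real_def)
    from G(3)[OF this] obtain g where g: "g \<in> G" "\<And>z. \<bar>f z - f x0 - g z\<bar> < e / 2" by auto
    have gl: "1-lipschitz_on UNIV g" using g(1) G(2) by (auto simp: F_def)
    have *: "\<bar>integral\<^sup>L r f - f x0 - integral\<^sup>L r g\<bar> \<le> e / 2" if r: "r \<in> Delta" for r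
    proof -
      interpret prob_space r using r by (simp add: DeltaD)
      have i: "integrable r f" "integrable r g" using r f gl by (auto intro: integrable_lipschitz_Delta)
      have "integral\<^sup>L r f - f x0 - integral\<^sup>L r g = (\<integral>z. f z - f x0 - g z \<partial>r)"
        using i by (simp add: prob_space)
      also have "\<bar>\<dots>\<bar> \<le> e / 2"
        using i g(2) by (intro integral_bounds_const) (auto intro: less_imp_le prob_space_axioms)
      finally show ?thesis .
    qed
    show "\<bar>integral\<^sup>L p f - integral\<^sup>L q f\<bar> \<le> c + e"
      using *[OF p] *[OF q] c[OF g(1)] by linarith
  qed
  then show ?thesis using G(1,2) by (intro exI[of _ G]) (auto simp: F_def)
qed

section \<open>Barycenters in closed convex sets\<close>

text \<open>A point outside \<open>C\<close> has a basic product neighbourhood missing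
  \<open>C\<close>, which contains a product of two \<open>dKR\<close>-balls; this turns topological
  closedness into an approximation criterion.\<close>

lemma mem_closed_prod_weak_star:
  fixes C :: "('a::compact_metric_space measure \<times> 'b::compact_metric_space measure) set"
  assumes C: "closedin (prod_topology weak_star weak_star) C" and p: "p \<in> Delta" and q: "q \<in> Delta"
    and near: "\<And>e. e > 0 \<Longrightarrow> \<exists>a b. (a, b) \<in> C \<and> dKR p a < e \<and> dKR q b < e"
  shows "(p, q) \<in> C"
proof (rule ccontr)
  interpret P: Metric_space "Delta :: 'a measure set" dKR by (rule Metric_space_dKR)
  interpret Q: Metric_space "Delta :: 'b measure set" dKR by (rule Metric_space_dKR)
  have top: "topspace (prod_topology weak_star weak_star) = (Delta :: 'a measure set) \<times> (Delta :: 'b measure set)"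
    by (simp add: weak_star_def)
  assume "(p, q) \<notin> C"
  moreover have "openin (prod_topology weak_star weak_star) (Delta \<times> Delta - C)"
    using C top by (metis closedin_def)
  ultimately obtain U V where UV: "openin weak_star U" "openin weak_star V" "p \<in> U" "q \<in> V"
      "U \<times> V \<subseteq> Delta \<times> Delta - C"
    using p q unfolding openin_prod_topology_alt by (metis DiffI SigmaI)
  obtain r s where rs: "r > 0" "P.mball p r \<subseteq> U" "s > 0" "Q.mball q s \<subseteq> V"
    using UV(1-4) unfolding weak_star_def P.openin_mtopology Q.openin_mtopology by metis
  obtain a b where ab: "(a, b) \<in> C" "dKR p a < min r s" "dKR q b < min r s"
    using near[of "min r s"] rs by auto
  have "a \<in> Delta" "b \<in> Delta" using closedin_subset[OF C] ab(1) top by auto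
  then have "a \<in> U" "b \<in> V" using rs ab p q by (auto simp: P.in_mball Q.in_mball)
  then show False using UV(5) ab(1) by auto
qed

text \<open>Convexity supplies binary mixtures only, so induction splits off one index and
  renormalizes the other weights by their sum \<open>s\<close>; a zero sum is treated apart. Both
  coordinates are mixed with the same weights, which keeps the pair inside \<open>C\<close>. Only
  integrals are recorded, since they are all that \<open>dKR\<close> sees.\<close>

lemma finite_mixture:
  fixes C :: "('a::topological_space measure \<times> 'b::topological_space measure) set"
  assumes "finite I" "I \<noteq> {}" and C: "convex_prob_pairs C" "C \<subseteq> Delta \<times> Delta"
    and "\<And>i. i \<in> I \<Longrightarrow> (S i, T i) \<in> C" "\<And>i. i \<in> I \<Longrightarrow> 0 \<le> w i" "sum w I = (1::real)"
  shows "\<exists>a b. (a, b) \<in> C \<and>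
    (\<forall>f B. f \<in> borel_measurable borel \<longrightarrow> (\<forall>x. \<bar>f x\<bar> \<le> B) \<longrightarrow>
      integral\<^sup>L a f = (\<Sum>i\<in>I. w i * integral\<^sup>L (S i) f)) \<and>
    (\<forall>f B. f \<in> borel_measurable borel \<longrightarrow> (\<forall>x. \<bar>f x\<bar> \<le> B) \<longrightarrow>
      integral\<^sup>L b f = (\<Sum>i\<in>I. w i * integral\<^sup>L (T i) f))"
  using assms(1,2,5-)
proof (induction I arbitrary: w rule: finite_ne_induct)
  case (singleton i)
  then show ?case by (intro exI[of _ "S i"] exI[of _ "T i"]) auto
next
  case (insert i I)
  have sum: "w i + sum w I = 1" using insert by simp
  have nn: "sum w I \<ge> 0" "w i \<ge> 0" using insert by (auto intro: sum_nonneg)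
  show ?case
  proof (cases "sum w I = 0")
    case True
    then have "w j = 0" if "j \<in> I" for j
      using sum_nonneg_eq_0_iff[of I w] insert that by auto
    then show ?thesis using insert sum True by (intro exI[of _ "S i"] exI[of _ "T i"]) auto
  next
    case False
    define s where "s = sum w I"
    have s: "s > 0" "1 - w i = s" using False nn sum by (auto simp: s_def)
    have "\<exists>a b. (a, b) \<in> C \<and>
      (\<forall>f B. f \<in> borel_measurable borel \<longrightarrow> (\<forall>x. \<bar>f x\<bar> \<le> B) \<longrightarrow>
        integral\<^sup>L a f = (\<Sum>i\<in>I. w i / s * integral\<^sup>L (S i) f)) \<and>
      (\<forall>f B. f \<in> borel_measurable borel \<longrightarrow> (\<forall>x. \<bar>f x\<bar> \<le> B) \<longrightarrow>
        integral\<^sup>L b f = (\<Sum>i\<in>I. w i / s * integral\<^sup>L (T i) f))"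
      using insert.prems s by (intro insert.IH) (auto simp: sum_divide_distrib[symmetric] s_def)
    then obtain a b where ab: "(a, b) \<in> C"
      "\<And>f B. f \<in> borel_measurable borel \<Longrightarrow> (\<And>x. \<bar>f x\<bar> \<le> B) \<Longrightarrow>
        integral\<^sup>L a f = (\<Sum>i\<in>I. w i / s * integral\<^sup>L (S i) f)"
      "\<And>f B. f \<in> borel_measurable borel \<Longrightarrow> (\<And>x. \<bar>f x\<bar> \<le> B) \<Longrightarrow>
        integral\<^sup>L b f = (\<Sum>i\<in>I. w i / s * integral\<^sup>L (T i) f)"
      by blast
    have i: "(S i, T i) \<in> C" "w i \<in> {0..1}" using insert sum nn by auto
    have D: "S i \<in> Delta" "T i \<in> Delta" "a \<in> Delta" "b \<in> Delta" using i(1) ab(1) C(2) by auto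
    have "(mix (w i) (S i) a, mix (w i) (T i) b) \<in> C"
      using C(1) i ab(1) unfolding convex_prob_pairs_def by fastforce
    moreover have "integral\<^sup>L (mix (w i) (S i) a) f = (\<Sum>j\<in>insert i I. w j * integral\<^sup>L (S j) f)"
      if "f \<in> borel_measurable borel" "\<And>x. \<bar>f x\<bar> \<le> B" for f B
      using insert.hyps s by (simp add: integral_mix[OF D(1,3) i(2) that] ab(2)[OF that] sum_distrib_left)
    moreover have "integral\<^sup>L (mix (w i) (T i) b) f = (\<Sum>j\<in>insert i I. w j * integral\<^sup>L (T j) f)"
      if "f \<in> borel_measurable borel" "\<And>x. \<bar>f x\<bar> \<le> B" for f B
      using insert.hyps s by (simp add: integral_mix[OF D(2,4) i(2) that] ab(3)[OF that] sum_distrib_left)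
    ultimately show ?thesis by blast
  qed
qed

lemma (in prob_space) integral_finite_valued:
  fixes h :: "'c \<Rightarrow> real"
  assumes "finite (k ` space M)" "\<And>c. c \<in> k ` space M \<Longrightarrow> {\<omega>\<in>space M. k \<omega> = c} \<in> sets M"
  shows "integrable M (\<lambda>\<omega>. h (k \<omega>))"
    and "(\<integral>\<omega>. h (k \<omega>) \<partial>M) = (\<Sum>c\<in>k ` space M. measure M {\<omega>\<in>space M. k \<omega> = c} * h c)"
proof -
  let ?A = "\<lambda>c. {\<omega>\<in>space M. k \<omega> = c}"
  have eq: "h (k \<omega>) = (\<Sum>c\<in>k ` space M. h c * indicator (?A c) \<omega>)" if "\<omega> \<in> space M" for \<omega>
    using assms(1) that by (simp add: indicator_def if_distrib cong: if_cong)
  have i: "integrable M (\<lambda>\<omega>. \<Sum>c\<in>k ` space M. h c * indicator (?A c) \<omega>)"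
    using assms(2) by (intro Bochner_Integration.integrable_sum integrable_mult_right)
      (auto simp: less_top[symmetric] emeasure_eq_measure)
  then show "integrable M (\<lambda>\<omega>. h (k \<omega>))"
    by (subst Bochner_Integration.integrable_cong[OF refl eq])
  have "(\<integral>\<omega>. h (k \<omega>) \<partial>M) = (\<integral>\<omega>. (\<Sum>c\<in>k ` space M. h c * indicator (?A c) \<omega>) \<partial>M)"
    by (rule Bochner_Integration.integral_cong[OF refl eq])
  also have "\<dots> = (\<Sum>c\<in>k ` space M. \<integral>\<omega>. h c * indicator (?A c) \<omega> \<partial>M)"
    using assms(2) by (intro Bochner_Integration.integral_sum integrable_mult_right)
      (auto simp: less_top[symmetric] emeasure_eq_measure)
  also have "\<dots> = (\<Sum>c\<in>k ` space M. measure M (?A c) * h c)"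
    using assms(2) by (intro sum.cong refl) (auto simp: Int_absorb1)
  finally show "(\<integral>\<omega>. h (k \<omega>) \<partial>M) = \<dots>" .
qed

lemma lipschitz_bounded:
  fixes g :: "'a::compact_metric_space \<Rightarrow> real"
  assumes "1-lipschitz_on UNIV g"
  shows "\<exists>B. \<forall>x. \<bar>g x\<bar> \<le> B"
proof -
  have "bounded (range g)"
    using compact_continuous_image[OF lipschitz_on_continuous_on[OF assms] compact_space_UNIV]
    by (rule compact_imp_bounded)
  then show ?thesis by (auto simp: bounded_iff)
qed

lemma borel_measurable_lipschitz: "L-lipschitz_on UNIV (g :: 'a::metric_space \<Rightarrow> real) \<Longrightarrow> g \<in> borel_measurable borel"
  by (intro borel_measurable_continuous_onI lipschitz_on_continuous_on)

text \<open>Finitely many Lipschitz integrals, rounded to multiples of \<open>e\<close>, cut the probability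
  space into finitely many cells on which both kernels are almost constant.\<close>

lemma barycenter_mem_closed_convex:
  fixes C :: "('a::compact_metric_space measure \<times> 'b::compact_metric_space measure) set"
  assumes C: "closedin (prod_topology weak_star weak_star) C" "convex_prob_pairs C"
    and M: "prob_space M" and S: "S \<in> M \<rightarrow>\<^sub>M prob_algebra borel" and T: "T \<in> M \<rightarrow>\<^sub>M prob_algebra borel"
    and mem: "\<And>\<omega>. \<omega> \<in> space M \<Longrightarrow> (S \<omega>, T \<omega>) \<in> C"
  shows "(M \<bind> S, M \<bind> T) \<in> C"
proof (rule mem_closed_prod_weak_star[OF C(1) bind_in_Delta[OF M S] bind_in_Delta[OF M T]])
  interpret prob_space M by fact
  have CD: "C \<subseteq> Delta \<times> Delta"
    using closedin_subset[OF C(1)] by (simp add: weak_star_def Metric_space.topspace_mtopology[OF Metric_space_dKR])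
  fix e :: real assume "e > 0"
  \<comment> \<open>Rounding inside a cell costs \<open>r\<close> and the finite family of test
    functions another \<open>r\<close>; the total \<open>2 * r\<close> stays strictly below
    \<open>e\<close>.\<close>
  define r where "r = e / 3"
  have r: "r > 0" "e = 3 * r" using \<open>e > 0\<close> by (simp_all add: r_def)
  from finite_net_lipschitz[OF r(1), where 'a='a] obtain G :: "('a \<Rightarrow> real) set" where
    G: "finite G" "\<forall>g\<in>G. 1-lipschitz_on UNIV g"
    and G3: "\<forall>p\<in>Delta. \<forall>q\<in>Delta. \<forall>c. (\<forall>g\<in>G. \<bar>integral\<^sup>L p g - integral\<^sup>L q g\<bar> \<le> c) \<longrightarrow> dKR p q \<le> c + r"
    by (elim exE conjE)
  from finite_net_lipschitz[OF r(1), where 'a='b] obtain H :: "('b \<Rightarrow> real) set" where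
    H: "finite H" "\<forall>g\<in>H. 1-lipschitz_on UNIV g"
    and H3: "\<forall>p\<in>Delta. \<forall>q\<in>Delta. \<forall>c. (\<forall>g\<in>H. \<bar>integral\<^sup>L p g - integral\<^sup>L q g\<bar> \<le> c) \<longrightarrow> dKR p q \<le> c + r"
    by (elim exE conjE)
  define k where "k \<omega> = (restrict (\<lambda>g. \<lfloor>integral\<^sup>L (S \<omega>) g / r\<rfloor>) G, restrict (\<lambda>g. \<lfloor>integral\<^sup>L (T \<omega>) g / r\<rfloor>) H)" for \<omega>
  have mS: "(\<lambda>\<omega>. integral\<^sup>L (S \<omega>) g) \<in> borel_measurable M" if "g \<in> G" for g
    using measurable_integral_kernel[OF S] borel_measurable_lipschitz[OF G(2)[rule_format, OF that]] by blast
  have mT: "(\<lambda>\<omega>. integral\<^sup>L (T \<omega>) g) \<in> borel_measurable M" if "g \<in> H" for g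
    using measurable_integral_kernel[OF T] borel_measurable_lipschitz[OF H(2)[rule_format, OF that]] by blast
  have rangeI: "\<exists>K. finite K \<and> (\<forall>\<omega>\<in>space M. restrict (\<lambda>g. \<lfloor>integral\<^sup>L (U \<omega>) g / r\<rfloor>) L \<in> L \<rightarrow>\<^sub>E K)"
    if L: "finite L" "\<forall>g\<in>L. 1-lipschitz_on UNIV g" and U: "U \<in> M \<rightarrow>\<^sub>M prob_algebra borel"
    for L and U :: "_ \<Rightarrow> 'd::compact_metric_space measure"
  proof -
    obtain B where B: "\<And>g x. g \<in> L \<Longrightarrow> \<bar>g x\<bar> \<le> B g" using lipschitz_bounded L(2) by metis
    have "\<lfloor>- B g / r\<rfloor> \<le> \<lfloor>integral\<^sup>L (U \<omega>) g / r\<rfloor> \<and> \<lfloor>integral\<^sup>L (U \<omega>) g / r\<rfloor> \<le> \<lfloor>B g / r\<rfloor>"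
      if "\<omega> \<in> space M" "g \<in> L" for \<omega> g
    proof -
      have D: "U \<omega> \<in> Delta" using prob_algebra_borel_Delta[OF U that(1)] .
      have "\<bar>integral\<^sup>L (U \<omega>) g\<bar> \<le> B g"
        using borel_measurable_Delta[OF D borel_measurable_lipschitz[OF L(2)[rule_format, OF that(2)]]] B[OF that(2)]
        by (intro integral_bounds_const(2)[OF DeltaD(1)[OF D]]) auto
      then show ?thesis using r(1) by (intro conjI floor_mono divide_right_mono) auto
    qed
    then show ?thesis using L(1)
      by (intro exI[of _ "\<Union>g\<in>L. {\<lfloor>- B g / r\<rfloor>..\<lfloor>B g / r\<rfloor>}"]) (auto simp: restrict_PiE_iff)
  qed
  obtain K1 where K1: "finite K1" "\<forall>\<omega>\<in>space M. restrict (\<lambda>g. \<lfloor>integral\<^sup>L (S \<omega>) g / r\<rfloor>) G \<in> G \<rightarrow>\<^sub>E K1"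
    using rangeI[OF G(1,2) S] by (elim exE conjE)
  obtain K2 where K2: "finite K2" "\<forall>\<omega>\<in>space M. restrict (\<lambda>g. \<lfloor>integral\<^sup>L (T \<omega>) g / r\<rfloor>) H \<in> H \<rightarrow>\<^sub>E K2"
    using rangeI[OF H(1,2) T] by (elim exE conjE)
  have "k ` space M \<subseteq> (G \<rightarrow>\<^sub>E K1) \<times> (H \<rightarrow>\<^sub>E K2)"
    using K1(2) K2(2) unfolding k_def by blast
  moreover have "finite ((G \<rightarrow>\<^sub>E K1) \<times> (H \<rightarrow>\<^sub>E K2))"
    using G(1) H(1) K1(1) K2(1) by (intro finite_cartesian_product finite_PiE)
  ultimately have fin: "finite (k ` space M)" by (rule finite_subset)
  have sets: "{\<omega>\<in>space M. k \<omega> = c} \<in> sets M" if c_in: "c \<in> k ` space M" for c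
  proof -
    obtain \<omega>0 where c: "c = k \<omega>0" using c_in by blast
    have "{\<omega>\<in>space M. k \<omega> = c} = {\<omega>\<in>space M. (\<forall>g\<in>G. \<lfloor>integral\<^sup>L (S \<omega>) g / r\<rfloor> = \<lfloor>integral\<^sup>L (S \<omega>0) g / r\<rfloor>)
        \<and> (\<forall>g\<in>H. \<lfloor>integral\<^sup>L (T \<omega>) g / r\<rfloor> = \<lfloor>integral\<^sup>L (T \<omega>0) g / r\<rfloor>)}"
      unfolding c k_def by (auto simp: restrict_def fun_eq_iff)
    also have "\<dots> \<in> sets M"
    proof (intro sets.sets_Collect_conj sets.sets_Collect_finite_All G(1) H(1))
      show "{\<omega> \<in> space M. \<lfloor>integral\<^sup>L (S \<omega>) g / r\<rfloor> = \<lfloor>integral\<^sup>L (S \<omega>0) g / r\<rfloor>} \<in> sets M" if "g \<in> G" for g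
        using mS[OF that] by measurable
      show "{\<omega> \<in> space M. \<lfloor>integral\<^sup>L (T \<omega>) g / r\<rfloor> = \<lfloor>integral\<^sup>L (T \<omega>0) g / r\<rfloor>} \<in> sets M" if "g \<in> H" for g
        using mT[OF that] by measurable
    qed
    finally show ?thesis .
  qed
  \<comment> \<open>Freezing both kernels at one representative per cell replaces the barycenter by
    a finite mixture of pairs already in \<open>C\<close>, weighted by the probabilities of the
    cells.\<close>
  define \<rho> where "\<rho> = inv_into (space M) k"
  have \<rho>: "\<rho> c \<in> space M" "k (\<rho> c) = c" if "c \<in> k ` space M" for c
    using that by (auto simp: \<rho>_def intro: inv_into_into f_inv_into_f)
  define w where "w c = measure M {\<omega>\<in>space M. k \<omega> = c}" for c
  have sumw: "sum w (k ` space M) = 1"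
    using integral_finite_valued(2)[OF fin sets, of "\<lambda>_. 1"] by (simp add: w_def prob_space)
  have ne: "k ` space M \<noteq> {}" using not_empty by simp
  have "\<exists>a b. (a, b) \<in> C \<and>
    (\<forall>f B. f \<in> borel_measurable borel \<longrightarrow> (\<forall>x. \<bar>f x\<bar> \<le> B) \<longrightarrow>
      integral\<^sup>L a f = (\<Sum>c\<in>k ` space M. w c * integral\<^sup>L (S (\<rho> c)) f)) \<and>
    (\<forall>f B. f \<in> borel_measurable borel \<longrightarrow> (\<forall>x. \<bar>f x\<bar> \<le> B) \<longrightarrow>
      integral\<^sup>L b f = (\<Sum>c\<in>k ` space M. w c * integral\<^sup>L (T (\<rho> c)) f))"
  proof (rule finite_mixture[OF fin ne C(2) CD _ _ sumw])
    show "(S (\<rho> c), T (\<rho> c)) \<in> C" if "c \<in> k ` space M" for c by (rule mem[OF \<rho>(1)[OF that]])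
  qed (simp add: w_def)
  then obtain a b where ab: "(a, b) \<in> C"
    "\<forall>f B. f \<in> borel_measurable borel \<longrightarrow> (\<forall>x. \<bar>f x\<bar> \<le> B) \<longrightarrow>
      integral\<^sup>L a f = (\<Sum>c\<in>k ` space M. w c * integral\<^sup>L (S (\<rho> c)) f)"
    "\<forall>f B. f \<in> borel_measurable borel \<longrightarrow> (\<forall>x. \<bar>f x\<bar> \<le> B) \<longrightarrow>
      integral\<^sup>L b f = (\<Sum>c\<in>k ` space M. w c * integral\<^sup>L (T (\<rho> c)) f)"
    by (elim exE conjE)
  have close: "\<bar>integral\<^sup>L (M \<bind> U) g - integral\<^sup>L d g\<bar> \<le> r"
    if U: "U \<in> M \<rightarrow>\<^sub>M prob_algebra borel" and g: "1-lipschitz_on UNIV g"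
      and code: "\<And>\<omega> \<omega>'. k \<omega> = k \<omega>' \<Longrightarrow> \<lfloor>integral\<^sup>L (U \<omega>) g / r\<rfloor> = \<lfloor>integral\<^sup>L (U \<omega>') g / r\<rfloor>"
      and d: "\<forall>f B. f \<in> borel_measurable borel \<longrightarrow> (\<forall>x. \<bar>f x\<bar> \<le> B) \<longrightarrow>
        integral\<^sup>L d f = (\<Sum>c\<in>k ` space M. w c * integral\<^sup>L (U (\<rho> c)) f)"
    for U :: "_ \<Rightarrow> 'd::compact_metric_space measure" and g d
  proof -
    obtain B where B: "\<And>x. \<bar>g x\<bar> \<le> B" using lipschitz_bounded[OF g] by blast
    have gm: "g \<in> borel_measurable borel" using g by (rule borel_measurable_lipschitz)
    have le: "\<bar>integral\<^sup>L (U \<omega>) g\<bar> \<le> B" if "\<omega> \<in> space M" for \<omega>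
      using B by (intro integral_bounds_const(2) DeltaD(1) borel_measurable_Delta[OF _ gm]
          prob_algebra_borel_Delta[OF U that])
    have mU: "(\<lambda>\<omega>. integral\<^sup>L (U \<omega>) g) \<in> borel_measurable M"
      by (rule measurable_integral_kernel[OF U gm])
    have i1: "integrable M (\<lambda>\<omega>. integral\<^sup>L (U \<omega>) g)"
      using le by (intro integral_bounds_const(1)[OF M mU])
    note fv = integral_finite_valued[OF fin sets, of "\<lambda>c. integral\<^sup>L (U (\<rho> c)) g"]
    have "integral\<^sup>L (M \<bind> U) g - integral\<^sup>L d g =
        (\<integral>\<omega>. integral\<^sup>L (U \<omega>) g - integral\<^sup>L (U (\<rho> (k \<omega>))) g \<partial>M)"
      using i1 fv by (simp add: integral_bind_kernel[OF M U gm B] d[rule_format, OF gm B] w_def)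
    also have "\<bar>\<dots>\<bar> \<le> r"
    proof (rule integral_bounds_const(2)[OF M])
      show "(\<lambda>\<omega>. integral\<^sup>L (U \<omega>) g - integral\<^sup>L (U (\<rho> (k \<omega>))) g) \<in> borel_measurable M"
        using mU fv(1) by (intro borel_measurable_diff) auto
      fix \<omega> assume "\<omega> \<in> space M"
      then have "\<lfloor>integral\<^sup>L (U \<omega>) g / r\<rfloor> = \<lfloor>integral\<^sup>L (U (\<rho> (k \<omega>))) g / r\<rfloor>"
        using \<rho> by (intro code) simp
      then have "\<bar>integral\<^sup>L (U \<omega>) g / r - integral\<^sup>L (U (\<rho> (k \<omega>))) g / r\<bar> < 1" by linarith
      then have "\<bar>integral\<^sup>L (U \<omega>) g - integral\<^sup>L (U (\<rho> (k \<omega>))) g\<bar> / r < 1"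
        using r(1) by (simp add: diff_divide_distrib[symmetric])
      then show "\<bar>integral\<^sup>L (U \<omega>) g - integral\<^sup>L (U (\<rho> (k \<omega>))) g\<bar> \<le> r"
        using r(1) by (simp add: divide_less_eq)
    qed
    finally show ?thesis .
  qed
  have D: "a \<in> Delta" "b \<in> Delta" using ab(1) CD by auto
  have "dKR (M \<bind> S) a \<le> r + r"
  proof (rule G3[rule_format, OF bind_in_Delta[OF M S] D(1)])
    fix g assume g: "g \<in> G"
    have "\<lfloor>integral\<^sup>L (S \<omega>) g / r\<rfloor> = \<lfloor>integral\<^sup>L (S \<omega>') g / r\<rfloor>" if "k \<omega> = k \<omega>'" for \<omega> \<omega>'
      using fun_cong[of _ _ g, OF arg_cong[of _ _ fst, OF that]] g by (simp add: k_def)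
    then show "\<bar>integral\<^sup>L (M \<bind> S) g - integral\<^sup>L a g\<bar> \<le> r"
      using close[OF S G(2)[rule_format, OF g] _ ab(2)] by blast
  qed
  moreover have "dKR (M \<bind> T) b \<le> r + r"
  proof (rule H3[rule_format, OF bind_in_Delta[OF M T] D(2)])
    fix g assume g: "g \<in> H"
    have "\<lfloor>integral\<^sup>L (T \<omega>) g / r\<rfloor> = \<lfloor>integral\<^sup>L (T \<omega>') g / r\<rfloor>" if "k \<omega> = k \<omega>'" for \<omega> \<omega>'
      using fun_cong[of _ _ g, OF arg_cong[of _ _ snd, OF that]] g by (simp add: k_def)
    then show "\<bar>integral\<^sup>L (M \<bind> T) g - integral\<^sup>L b g\<bar> \<le> r"
      using close[OF T H(2)[rule_format, OF g] _ ab(3)] by blast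
  qed
  ultimately show "\<exists>a b. (a, b) \<in> C \<and> dKR (M \<bind> S) a < e \<and> dKR (M \<bind> T) b < e"
    using ab(1) r by (intro exI[of _ a] exI[of _ b]) auto
qed

text \<open>The pairs formed by the Dirac mass at \<open>Y \<omega>\<close> and
  \<open>S \<omega>\<close> are generators of the hull, so their barycenter belongs to every closed
  convex set containing the generators. Both hypotheses phrased with \<open>lift\<close> are applied
  to kernels through this lemma.\<close>

lemma bind_mem_lift:
  fixes \<Gamma> :: "'a::compact_metric_space \<Rightarrow> 'a measure set"
  assumes M: "prob_space M" and Y: "Y \<in> M \<rightarrow>\<^sub>M borel" and S: "S \<in> M \<rightarrow>\<^sub>M prob_algebra borel"
    and mem: "\<And>\<omega>. \<omega> \<in> space M \<Longrightarrow> S \<omega> \<in> \<Gamma> (Y \<omega>)"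
  shows "M \<bind> S \<in> lift \<Gamma> (distr M borel Y)"
proof -
  interpret prob_space M by fact
  have R: "(\<lambda>\<omega>. return borel (Y \<omega>)) \<in> M \<rightarrow>\<^sub>M prob_algebra borel"
    using Y by (rule measurable_compose) (rule measurable_return_prob_space)
  have eq: "distr M borel Y = M \<bind> (\<lambda>\<omega>. return borel (Y \<omega>))"
    using bind_return_distr[OF not_empty Y] by (simp add: comp_def)
  have "(M \<bind> (\<lambda>\<omega>. return borel (Y \<omega>)), M \<bind> S) \<in> C"
    if "closedin (prod_topology weak_star weak_star) C" "convex_prob_pairs C"
      "{(return borel x, p) |x p. p \<in> \<Gamma> x} \<subseteq> C" for C
    using that mem by (intro barycenter_mem_closed_convex[OF that(1,2) M R S]) auto
  then show ?thesis by (simp add: eq lift_def lift_graph_def hull_def)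
qed

section \<open>Gambling houses\<close>

lemma houseD:
  assumes "gambling_house \<Gamma>"
  shows "p \<in> \<Gamma> x \<Longrightarrow> p \<in> Delta" "convex_probs (\<Gamma> x)" "compactin weak_star (\<Gamma> x)" "return borel x \<in> \<Gamma> x"
    "p \<in> \<Gamma> x \<Longrightarrow> \<exists>p'\<in>\<Gamma> x'. dKR p p' \<le> dist x x'"
  using assms by (auto simp: gambling_house_def leavable_def non_expansive_def)

lemma house_seq_compact:
  fixes \<Gamma> :: "'a::compact_metric_space \<Rightarrow> 'a measure set" and p :: "nat \<Rightarrow> 'a measure"
  assumes "gambling_house \<Gamma>" "\<And>n. p n \<in> \<Gamma> x"
  shows "\<exists>q r. q \<in> \<Gamma> x \<and> strict_mono r \<and> (\<lambda>n. dKR (p (r n)) q) \<longlonglongrightarrow> 0"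
proof -
  interpret P: Metric_space "Delta :: 'a measure set" dKR by (rule Metric_space_dKR)
  have "compactin P.mtopology (\<Gamma> x)" using houseD(3)[OF assms(1)] by (simp add: weak_star_def)
  then obtain q r where q: "q \<in> \<Gamma> x" "strict_mono (r :: nat \<Rightarrow> nat)" "limitin P.mtopology (p \<circ> r) q sequentially"
    using assms(2) unfolding P.compactin_sequentially by (metis image_subset_iff)
  have "(\<lambda>n. dKR (p (r n)) q) \<longlonglongrightarrow> 0"
    using q(3) unfolding P.limit_metric_sequentially LIMSEQ_def by (simp add: dist_real_def dKR_nonneg) meson
  then show ?thesis using q by blast
qed

text \<open>Non-expansiveness transports each \<open>p n\<close> into the single compact set
  \<open>\<Gamma> x'\<close> at a cost \<open>dist (x n) x'\<close> that tends to 0; a convergent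
  subsequence of the transported laws is also approached by the original ones.\<close>

lemma house_upper_hemicontinuous:
  fixes \<Gamma> :: "'a::compact_metric_space \<Rightarrow> 'a measure set"
  assumes h: "gambling_house \<Gamma>" and x: "x \<longlonglongrightarrow> x'" and p: "\<And>n. p n \<in> \<Gamma> (x n)"
  shows "\<exists>q r. q \<in> \<Gamma> x' \<and> strict_mono r \<and> (\<lambda>n. dKR (p (r n)) q) \<longlonglongrightarrow> 0"
proof -
  have "\<exists>p'. p' \<in> \<Gamma> x' \<and> dKR (p n) p' \<le> dist (x n) x'" for n
    using houseD(5)[OF h p[of n]] by blast
  then obtain p' :: "nat \<Rightarrow> 'a measure" where
    p': "\<And>n. p' n \<in> \<Gamma> x'" "\<And>n. dKR (p n) (p' n) \<le> dist (x n) x'" by metis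
  obtain q r where q: "q \<in> \<Gamma> x'" "strict_mono r" "(\<lambda>n. dKR (p' (r n)) q) \<longlonglongrightarrow> 0"
    using house_seq_compact[of \<Gamma> p', OF h p'(1)] by (elim exE conjE)
  have "(\<lambda>n. dist (x (r n)) x') \<longlonglongrightarrow> 0"
    using iffD1[OF tendsto_dist_iff LIMSEQ_subseq_LIMSEQ[OF x q(2)]] by (simp add: comp_def)
  from tendsto_add[OF this q(3)] have lim: "(\<lambda>n. dist (x (r n)) x' + dKR (p' (r n)) q) \<longlonglongrightarrow> 0"
    by simp
  have "dKR (p (r n)) q \<le> dist (x (r n)) x' + dKR (p' (r n)) q" for n
    using dKR_triangle[OF houseD(1)[OF h p] houseD(1)[OF h p'(1)] houseD(1)[OF h q(1)], of "r n" "r n"]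
      p'(2)[of "r n"] by linarith
  then have "(\<lambda>n. dKR (p (r n)) q) \<longlonglongrightarrow> 0"
    by (intro tendsto_sandwich[OF _ _ tendsto_const lim]) (auto simp: dKR_nonneg)
  then show ?thesis using q by blast
qed

lemma house_finite_net:
  fixes \<Gamma> :: "'a::compact_metric_space \<Rightarrow> 'a measure set"
  assumes "gambling_house \<Gamma>" "e > 0"
  shows "\<exists>K. finite K \<and> K \<subseteq> \<Gamma> x \<and> (\<forall>p\<in>\<Gamma> x. \<exists>k\<in>K. dKR k p < e)"
proof -
  interpret P: Metric_space "Delta :: 'a measure set" dKR by (rule Metric_space_dKR)
  have "compactin P.mtopology (\<Gamma> x)" using houseD(3)[OF assms(1)] by (simp add: weak_star_def)
  from P.compactin_imp_mtotally_bounded[OF this] assms(2) show ?thesis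
    unfolding P.mtotally_bounded_def by (fastforce simp: P.in_mball)
qed

section \<open>Vanishing variation along paths\<close>

text \<open>The last clause makes \<open>S i\<close> a conditional law of \<open>X (Suc i)\<close>
  on events of \<open>X i\<close>. No Markov property is implied: \<open>S i\<close> may depend on
  the whole past and on the other player.\<close>

definition house_process :: "('a::metric_space \<Rightarrow> 'a measure set) \<Rightarrow> 'm measure \<Rightarrow> (nat \<Rightarrow> 'm \<Rightarrow> 'a) \<Rightarrow>
    (nat \<Rightarrow> 'm \<Rightarrow> 'a measure) \<Rightarrow> bool" where
  "house_process \<Gamma> M X S \<longleftrightarrow> prob_space M \<and>
     (\<forall>i. X i \<in> M \<rightarrow>\<^sub>M borel \<and> S i \<in> M \<rightarrow>\<^sub>M prob_algebra borel \<and> (\<forall>\<omega>\<in>space M. S i \<omega> \<in> \<Gamma> (X i \<omega>)) \<and>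
       (\<forall>A\<in>sets borel. \<forall>B\<in>sets borel. emeasure M {\<omega>\<in>space M. X i \<omega> \<in> A \<and> X (Suc i) \<omega> \<in> B} =
         (\<integral>\<^sup>+\<omega>. indicator A (X i \<omega>) * emeasure (S i \<omega>) B \<partial>M)))"

lemma lipschitz_dist: "1-lipschitz_on UNIV (\<lambda>x. dist x (c::'a::metric_space))"
proof (rule lipschitz_onI)
  show "dist (dist x c) (dist y c) \<le> 1 * dist x y" for x y
    using dist_triangle[of x c y] dist_triangle[of y c x] by (simp add: dist_real_def dist_commute abs_le_iff)
qed simp

text \<open>From the state in which only the mass of \<open>U\<close> has moved, move the mass of
  \<open>V - U\<close> by \<open>S i\<close> and let the rest wait, which leavability permits. On
  \<open>V - U\<close> nothing has happened yet, so the current state is still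
  \<open>X i \<omega>\<close> and \<open>S i \<omega>\<close> is a legal move.\<close>

lemma house_process_partial_step:
  fixes \<Gamma> :: "'a::compact_metric_space \<Rightarrow> 'a measure set"
  assumes "leavable \<Gamma>" and P: "house_process \<Gamma> M X S" and UV: "U \<in> sets borel" "V \<in> sets borel" "U \<subseteq> V"
  shows "distr M borel (\<lambda>\<omega>. if X i \<omega> \<in> V then X (Suc i) \<omega> else X i \<omega>) \<in>
    lift \<Gamma> (distr M borel (\<lambda>\<omega>. if X i \<omega> \<in> U then X (Suc i) \<omega> else X i \<omega>))"
proof -
  let ?Z = "\<lambda>U \<omega>. if X i \<omega> \<in> U then X (Suc i) \<omega> else X i \<omega>"
  have M: "prob_space M" and X[measurable]: "X i \<in> M \<rightarrow>\<^sub>M borel" "X (Suc i) \<in> M \<rightarrow>\<^sub>M borel"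
    and S[measurable]: "S i \<in> M \<rightarrow>\<^sub>M prob_algebra borel"
    and step: "\<forall>A\<in>sets borel. \<forall>B\<in>sets borel. emeasure M {\<omega>\<in>space M. X i \<omega> \<in> A \<and> X (Suc i) \<omega> \<in> B} =
         (\<integral>\<^sup>+\<omega>. indicator A (X i \<omega>) * emeasure (S i \<omega>) B \<partial>M)"
    using P by (simp_all add: house_process_def)
  note UV(1,2)[measurable]
  have Z[measurable]: "?Z W \<in> M \<rightarrow>\<^sub>M borel" if [measurable]: "W \<in> sets borel" for W by measurable
  define T where "T \<omega> = (if X i \<omega> \<in> V - U then S i \<omega> else return borel (?Z U \<omega>))" for \<omega>
  have R: "(\<lambda>\<omega>. return borel (?Z U \<omega>)) \<in> M \<rightarrow>\<^sub>M prob_algebra borel"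
    by (rule measurable_compose[OF Z[OF UV(1)] measurable_return_prob_space])
  have T: "T \<in> M \<rightarrow>\<^sub>M prob_algebra borel"
    unfolding T_def[abs_def] by (rule measurable_If[OF S R]) measurable
  have "M \<bind> T \<in> lift \<Gamma> (distr M borel (?Z U))"
  proof (rule bind_mem_lift[OF M Z[OF UV(1)] T])
    fix \<omega> assume "\<omega> \<in> space M"
    then show "T \<omega> \<in> \<Gamma> (?Z U \<omega>)"
      using assms(1) P by (auto simp: T_def leavable_def house_process_def)
  qed
  moreover have "M \<bind> T = distr M borel (?Z V)"
  proof (rule measure_eqI)
    show "sets (M \<bind> T) = sets (distr M borel (?Z V))"
      using DeltaD(2)[OF bind_in_Delta[OF M T]] by simp
    fix B assume "B \<in> sets (M \<bind> T)"
    then have B[measurable]: "B \<in> sets borel" using DeltaD(2)[OF bind_in_Delta[OF M T]] by simp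
    let ?A = "{\<omega>\<in>space M. X i \<omega> \<in> V - U \<and> X (Suc i) \<omega> \<in> B}"
    let ?A' = "{\<omega>\<in>space M. X i \<omega> \<notin> V - U \<and> ?Z U \<omega> \<in> B}"
    have [measurable]: "(\<lambda>\<omega>. emeasure (S i \<omega>) B) \<in> borel_measurable M"
      using B by (intro measurable_compose[OF measurable_prob_algebraD[OF S] measurable_emeasure_subprob_algebra])
    have "emeasure (M \<bind> T) B = (\<integral>\<^sup>+\<omega>. emeasure (T \<omega>) B \<partial>M)"
      by (rule emeasure_bind[OF prob_space.not_empty[OF M] measurable_prob_algebraD[OF T] B])
    \<comment> \<open>Off \<open>V - U\<close> the states \<open>?Z U\<close> and
      \<open>?Z V\<close> coincide, so waiting is correct there; on \<open>V - U\<close> the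
      conditional-law clause with \<open>A = V - U\<close> accounts for the moved mass.\<close>
    also have "\<dots> = (\<integral>\<^sup>+\<omega>. indicator (V - U) (X i \<omega>) * emeasure (S i \<omega>) B + indicator ?A' \<omega> \<partial>M)"
      by (intro nn_integral_cong) (auto simp: T_def indicator_def)
    also have "\<dots> = (\<integral>\<^sup>+\<omega>. indicator (V - U) (X i \<omega>) * emeasure (S i \<omega>) B \<partial>M) + (\<integral>\<^sup>+\<omega>. indicator ?A' \<omega> \<partial>M)"
      by (rule nn_integral_add) measurable
    also have "(\<integral>\<^sup>+\<omega>. indicator (V - U) (X i \<omega>) * emeasure (S i \<omega>) B \<partial>M) = emeasure M ?A"
      by (rule step[rule_format, OF sets.Diff[OF UV(2,1)] B, symmetric])
    also have "(\<integral>\<^sup>+\<omega>. indicator ?A' \<omega> \<partial>M) = emeasure M ?A'"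
      by (rule nn_integral_indicator) measurable
    also have "emeasure M ?A + emeasure M ?A' = emeasure M (?A \<union> ?A')"
      by (rule plus_emeasure) (measurable, auto)
    also have "?A \<union> ?A' = ?Z V -` B \<inter> space M" using UV(3) by (auto split: if_splits)
    also have "emeasure M \<dots> = emeasure (distr M borel (?Z V)) B"
      using Z[OF UV(2)] B by (simp add: emeasure_distr)
    finally show "emeasure (M \<bind> T) B = emeasure (distr M borel (?Z V)) B" .
  qed
  ultimately show ?thesis by simp
qed

text \<open>Each stage is split into finitely many substages, substage \<open>j\<close> moving only the mass lying
  in a small cell \<open>U (Suc j) - U j\<close> around \<open>c j\<close>. The law of the state then varies in the course of
  a stage by at least the expected displacement up to \<open>2 * r\<close>, because mass that starts near
  \<open>c j\<close> and moves far changes the mean distance to \<open>c j\<close>.\<close>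

lemma vanishing_variation_paths:
  fixes \<Gamma> :: "'a::compact_metric_space \<Rightarrow> 'a measure set"
  assumes \<Gamma>: "leavable \<Gamma>" "vanishing_L1_variation \<Gamma>" and e: "e > 0"
  shows "\<exists>N\<ge>1. \<forall>n\<ge>N. \<forall>(M :: 'm measure) X S. house_process \<Gamma> M X S \<longrightarrow>
    (\<Sum>i<n. \<integral>\<omega>. dist (X i \<omega>) (X (Suc i) \<omega>) \<partial>M) \<le> e * real n"
proof -
  \<comment> \<open>Per stage, \<open>2 * r\<close> is lost to the size of the cells and
    \<open>r\<close> on average to the variation of the laws.\<close>
  define r where "r = e / 3"
  have r: "r > 0" "e = 3 * r" using e by (simp_all add: r_def)
  have "\<exists>K. finite K \<and> (UNIV :: 'a set) \<subseteq> (\<Union>x\<in>K. ball x r)"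
    using compact_space_UNIV[where 'a='a] r(1) by (simp only: compact_eq_totally_bounded)
  then obtain K :: "'a set" where K: "finite K" "UNIV \<subseteq> (\<Union>x\<in>K. ball x r)" by (elim exE conjE)
  obtain cs where cs: "set cs = K" using finite_list[OF K(1)] by blast
  define c where "c j = cs ! j" for j
  define k where "k = length cs"
  define U where "U j = (\<Union>l<j. ball (c l) r)" for j
  have U: "open (U j)" "U j \<subseteq> U (Suc j)" "U j \<in> sets borel" for j
    by (auto simp: U_def less_Suc_eq intro!: borel_open)
  have U0: "U 0 = {}" by (simp add: U_def)
  have Uk: "U k = UNIV"
  proof -
    have "x \<in> U k" for x
    proof -
      obtain y where "y \<in> K" "x \<in> ball y r" using K(2) by blast
      then show ?thesis unfolding cs[symmetric] in_set_conv_nth U_def k_def c_def by blast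
    qed
    then show ?thesis by blast
  qed
  have k: "k > 0" using Uk U0 by (cases k) auto
  \<comment> \<open>Each stage is spread over \<open>k\<close> substages, so \<open>n\<close> stages
    give \<open>n * k\<close> laws; mean variation at most \<open>r / k\<close> bounds the total by
    \<open>r * n\<close>.\<close>
  have "r / k > 0" using r(1) k by simp
  then have "\<exists>N. \<forall>n\<ge>N. \<forall>p. (\<forall>t\<ge>1. p t \<in> Delta \<and> p (t + 1) \<in> lift \<Gamma> (p t)) \<longrightarrow>
        (1 / real n) * (\<Sum>t=1..n. dKR (p (t + 1)) (p t)) \<le> r / k"
    using \<Gamma>(2) by (simp only: vanishing_L1_variation_def)
  then obtain N where N: "\<forall>n\<ge>N. \<forall>p. (\<forall>t\<ge>1. p t \<in> Delta \<and> p (t + 1) \<in> lift \<Gamma> (p t)) \<longrightarrow>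
        (1 / real n) * (\<Sum>t=1..n. dKR (p (t + 1)) (p t)) \<le> r / k"
    by (elim exE)
  have "(\<Sum>i<n. \<integral>\<omega>. dist (X i \<omega>) (X (Suc i) \<omega>) \<partial>M) \<le> e * real n"
    if n: "n \<ge> max N 1" and P: "house_process \<Gamma> M X S" for n and M :: "'m measure" and X S
  proof -
    interpret prob_space M using P by (simp add: house_process_def)
    have X[measurable]: "X i \<in> M \<rightarrow>\<^sub>M borel" for i using P by (simp add: house_process_def)
    define Z where "Z i j \<omega> = (if X i \<omega> \<in> U j then X (Suc i) \<omega> else X i \<omega>)" for i j \<omega>
    have Z: "Z i j \<in> M \<rightarrow>\<^sub>M borel" for i j
      unfolding Z_def using U(3)[of j] by measurable
    define P where "P i j = distr M borel (Z i j)" for i j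
    have P_Delta: "P i j \<in> Delta" for i j
      unfolding P_def by (intro distr_in_Delta Z prob_space_axioms)
    have P_lift: "P i (Suc j) \<in> lift \<Gamma> (P i j)" for i j
      unfolding P_def Z_def by (rule house_process_partial_step[OF \<Gamma>(1) P U(3) U(3) U(2)])
    \<comment> \<open>After its last substage a stage has moved all the mass; this law of
      \<open>X (Suc i)\<close> is where the next stage starts, so the substages form one
      chain.\<close>
    have Pk: "P (Suc i) 0 = P i k" for i by (simp add: P_def Z_def[abs_def] U0 Uk)
    \<comment> \<open>The chains in \<open>vanishing_L1_variation\<close> start at index 1, hence
      the shift; quotient and remainder by \<open>k\<close> give the stage and the substage.\<close>
    define p where "p s = P ((s - 1) div k) ((s - 1) mod k)" for s
    have p_Suc: "p (Suc s + 1) = P (s div k) (Suc (s mod k))" for s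
    proof (cases "Suc (s mod k) = k")
      case True
      then have "Suc s div k = Suc (s div k)" "Suc s mod k = 0"
        by (simp_all add: div_Suc mod_Suc)
      then show ?thesis using True Pk by (simp add: p_def)
    next
      case False
      then have "Suc s div k = s div k" "Suc s mod k = Suc (s mod k)"
        by (simp_all add: div_Suc mod_Suc)
      then show ?thesis by (simp add: p_def)
    qed
    have chain: "\<forall>t\<ge>1. p t \<in> Delta \<and> p (t + 1) \<in> lift \<Gamma> (p t)"
    proof (intro allI impI)
      fix t :: nat assume "t \<ge> 1"
      then obtain s where "t = Suc s" by (cases t) auto
      then show "p t \<in> Delta \<and> p (t + 1) \<in> lift \<Gamma> (p t)"
        using p_Suc[of s] P_lift P_Delta by (simp add: p_def)
    qed
    have nk: "n * k \<ge> N" "n * k > 0" using n k by (auto intro: order_trans[of N n "n * k"])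
    have "(\<Sum>i<n. \<Sum>j<k. dKR (P i (Suc j)) (P i j)) = (\<Sum>i<n. \<Sum>s\<in>{i * k..<i * k + k}. dKR (p (Suc s + 1)) (p (Suc s)))"
    proof (rule sum.cong[OF refl])
      fix i
      have "(\<Sum>s\<in>{i * k..<i * k + k}. dKR (p (Suc s + 1)) (p (Suc s))) =
          (\<Sum>j<k. dKR (p (Suc (i * k + j) + 1)) (p (Suc (i * k + j))))"
        by (rule sum.reindex_bij_witness[of _ "\<lambda>j. i * k + j" "\<lambda>s. s - i * k"]) auto
      also have "\<dots> = (\<Sum>j<k. dKR (P i (Suc j)) (P i j))"
        unfolding p_Suc by (intro sum.cong refl) (simp add: p_def)
      finally show "(\<Sum>j<k. dKR (P i (Suc j)) (P i j)) =
          (\<Sum>s\<in>{i * k..<i * k + k}. dKR (p (Suc s + 1)) (p (Suc s)))" by simp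
    qed
    also have "\<dots> = (\<Sum>s<n * k. dKR (p (Suc s + 1)) (p (Suc s)))" by (rule sum.nat_group)
    also have "\<dots> = (\<Sum>t=1..n * k. dKR (p (t + 1)) (p t))"
      by (rule sum.reindex_bij_witness[of _ "\<lambda>t. t - 1" Suc]) auto
    also have "\<dots> \<le> r * real n"
      using mp[OF spec[OF mp[OF spec[OF N] nk(1)]] chain] nk(2) k by (simp add: field_simps)
    finally have upper: "(\<Sum>i<n. \<Sum>j<k. dKR (P i (Suc j)) (P i j)) \<le> r * real n" .
    obtain D where D: "\<And>x y :: 'a. dist x y \<le> D"
      using diameter_bounded_bound[OF compact_imp_bounded[OF compact_space_UNIV]] by blast
    have int: "integrable M (\<lambda>\<omega>. dist (V \<omega>) (W \<omega>))" if [measurable]: "V \<in> M \<rightarrow>\<^sub>M borel" "W \<in> M \<rightarrow>\<^sub>M borel"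
      for V W :: "'m \<Rightarrow> 'a"
      using D by (intro integrable_const_bound[of _ D]) auto
    \<comment> \<open>The constant \<open>2 * r\<close> comes from the triangle inequality through
      the centre \<open>c j\<close>, which uses \<open>dist (X i \<omega>) (c j) < r\<close>
      twice.\<close>
    have lower: "(\<integral>\<omega>. dist (X i \<omega>) (X (Suc i) \<omega>) \<partial>M) - 2 * r \<le> (\<Sum>j<k. dKR (P i (Suc j)) (P i j))" for i
    proof -
      have "dist (X i \<omega>) (X (Suc i) \<omega>) - 2 * r \<le> (\<Sum>j<k. dist (Z i (Suc j) \<omega>) (c j) - dist (Z i j \<omega>) (c j))" for \<omega>
      proof -
        \<comment> \<open>A path moves in exactly one substage, that of the first ball containing
          \<open>X i \<omega>\<close>, so the sum over substages has a single nonzero term. Since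
          \<open>U 0\<close> is empty, \<open>m\<close> is the successor of the index of that
          ball.\<close>
        define m where "m = (LEAST j. X i \<omega> \<in> U j)"
        have Um: "X i \<omega> \<in> U m" unfolding m_def by (rule LeastI[of _ k]) (simp add: Uk)
        have mk: "m \<le> k" unfolding m_def by (rule Least_le) (simp add: Uk)
        have m0: "m \<noteq> 0" using Um U0 by (metis empty_iff)
        then obtain j where j: "m = Suc j" by (cases m) auto
        have less: "X i \<omega> \<notin> U l" if "l < m" for l using not_less_Least[of l] that by (simp add: m_def)
        have ge: "X i \<omega> \<in> U l" if "l \<ge> m" for l
          using lift_Suc_mono_le[of U, OF U(2) that] Um by blast
        have "Z i (Suc l) \<omega> = Z i l \<omega>" if "l \<noteq> j" for l
        proof (cases "l < j")
          case True
          then show ?thesis using less[of l] less[of "Suc l"] j by (simp add: Z_def)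
        next
          case False
          then show ?thesis using ge[of l] ge[of "Suc l"] j that by (simp add: Z_def)
        qed
        then have "(\<Sum>l<k. dist (Z i (Suc l) \<omega>) (c l) - dist (Z i l \<omega>) (c l)) =
            (\<Sum>l\<in>{j}. dist (Z i (Suc l) \<omega>) (c l) - dist (Z i l \<omega>) (c l))"
          using j mk by (intro sum.mono_neutral_right) auto
        also have "\<dots> = dist (X (Suc i) \<omega>) (c j) - dist (X i \<omega>) (c j)"
          using less[of j] Um j by (simp add: Z_def)
        moreover have "dist (X i \<omega>) (c j) < r"
          using Um less[of j] j by (auto simp: U_def less_Suc_eq dist_commute)
        moreover have "dist (X i \<omega>) (X (Suc i) \<omega>) \<le> dist (X i \<omega>) (c j) + dist (X (Suc i) \<omega>) (c j)"
          by (rule dist_triangle2)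
        ultimately show ?thesis by linarith
      qed
      then have "(\<integral>\<omega>. dist (X i \<omega>) (X (Suc i) \<omega>) - 2 * r \<partial>M) \<le>
          (\<integral>\<omega>. (\<Sum>j<k. dist (Z i (Suc j) \<omega>) (c j) - dist (Z i j \<omega>) (c j)) \<partial>M)"
        by (intro integral_mono Bochner_Integration.integrable_sum Bochner_Integration.integrable_diff int X Z) auto
      also have "\<dots> = (\<Sum>j<k. (\<integral>\<omega>. dist (Z i (Suc j) \<omega>) (c j) \<partial>M) - (\<integral>\<omega>. dist (Z i j \<omega>) (c j) \<partial>M))"
        by (simp add: Bochner_Integration.integral_sum Bochner_Integration.integral_diff int Z)
      also have "\<dots> \<le> (\<Sum>j<k. dKR (P i (Suc j)) (P i j))"
      proof (rule sum_mono)
        fix j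
        have *: "integral\<^sup>L (P i l) (\<lambda>x. dist x (c j)) = (\<integral>\<omega>. dist (Z i l \<omega>) (c j) \<partial>M)" for l
          unfolding P_def by (rule integral_distr[OF Z]) measurable
        show "(\<integral>\<omega>. dist (Z i (Suc j) \<omega>) (c j) \<partial>M) - (\<integral>\<omega>. dist (Z i j \<omega>) (c j) \<partial>M) \<le> dKR (P i (Suc j)) (P i j)"
          using abs_integral_diff_le_dKR[OF P_Delta P_Delta lipschitz_dist[of "c j"], of i "Suc j" i j] unfolding * by linarith
      qed
      finally show ?thesis using int[OF X X] by (simp add: prob_space)
    qed
    have "(\<Sum>i<n. (\<integral>\<omega>. dist (X i \<omega>) (X (Suc i) \<omega>) \<partial>M) - 2 * r) \<le> (\<Sum>i<n. \<Sum>j<k. dKR (P i (Suc j)) (P i j))"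
      by (rule sum_mono) (rule lower)
    also note upper
    finally have "(\<Sum>i<n. (\<integral>\<omega>. dist (X i \<omega>) (X (Suc i) \<omega>) \<partial>M) - 2 * r) \<le> r * real n" .
    then show ?thesis using r by (simp add: sum_subtractf algebra_simps)
  qed
  then show ?thesis by (intro exI[of _ "max N 1"]) auto
qed

section \<open>Measurable selection\<close>

lemma integral_lipschitz_tendsto:
  fixes p :: "nat \<Rightarrow> 'a::compact_metric_space measure"
  assumes g: "L-lipschitz_on UNIV (g :: 'a \<Rightarrow> real)" and p: "\<And>n. p n \<in> Delta" and q: "q \<in> Delta"
    and lim: "(\<lambda>n. dKR (p n) q) \<longlonglongrightarrow> 0"
  shows "(\<lambda>n. integral\<^sup>L (p n) g) \<longlonglongrightarrow> integral\<^sup>L q g"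
proof -
  have "bounded (range g)"
    using compact_continuous_image[OF lipschitz_on_continuous_on[OF g] compact_space_UNIV]
    by (rule compact_imp_bounded)
  then obtain B where B: "\<And>x. \<bar>g x\<bar> \<le> B" by (auto simp: bounded_iff)
  have L: "L \<ge> 0" using g by (rule lipschitz_on_nonneg)
  have osc: "osc_le 0 L g"
    unfolding osc_le_def
  proof (intro allI)
    show "\<bar>g x - g x'\<bar> \<le> 0 + L * dist x x'" for x x'
      using lipschitz_onD[OF g, of x x'] by (simp add: dist_real_def)
  qed
  have "norm (integral\<^sup>L (p n) g - integral\<^sup>L q g) \<le> L * dKR (p n) q" for n
    using integral_diff_le_osc[OF p q borel_measurable_lipschitz[OF g] B osc L, of n] by simp
  then have "\<forall>\<^sub>F n in sequentially. norm (integral\<^sup>L (p n) g - integral\<^sup>L q g) \<le> L * dKR (p n) q"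
    by simp
  from Lim_null_comparison[OF this tendsto_mult_right_zero[OF lim]]
  have "(\<lambda>n. integral\<^sup>L (p n) g - integral\<^sup>L q g) \<longlonglongrightarrow> 0" .
  then show ?thesis by (rule LIM_zero_cancel)
qed

text \<open>Measurability of a kernel need only be tested on a countable intersection-stable
  generator, here the finite intersections of basic open sets. The mass of an open set is the limit
  of the integrals of Lipschitz functions converging to its indicator.\<close>

lemma countable_lipschitz_generators:
  "\<exists>g :: nat \<Rightarrow> 'a::compact_metric_space \<Rightarrow> real. (\<forall>n. \<exists>L. L-lipschitz_on UNIV (g n)) \<and>
     (\<forall>(M :: 'm measure) s. (\<forall>\<omega>\<in>space M. s \<omega> \<in> Delta) \<longrightarrow>
        (\<forall>n. (\<lambda>\<omega>. integral\<^sup>L (s \<omega>) (g n)) \<in> borel_measurable M) \<longrightarrow> s \<in> M \<rightarrow>\<^sub>M prob_algebra borel)"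
proof -
  obtain B :: "'a set set" where B: "countable B" "topological_basis B"
    using ex_countable_basis by blast
  define E where "E = (\<lambda>F. \<Inter>F) ` {F. F \<subseteq> B \<and> finite F}"
  have E_cnt: "countable E"
    unfolding E_def using countable_Collect_finite_subset[OF B(1)]
    by (intro countable_image) (auto simp: conj_commute elim: countable_subset[rotated])
  have UNIV_E: "UNIV \<in> E" unfolding E_def by (intro image_eqI[of _ _ "{}"]) auto
  have E_open: "open U" if "U \<in> E" for U
    using that topological_basis_open[OF B(2)] unfolding E_def by auto
  have B_E: "B \<subseteq> E" unfolding E_def by (auto intro!: image_eqI[of _ _ "{b}" for b])
  have E_Int: "Int_stable E"
  proof (rule Int_stableI)
    fix a b assume "a \<in> E" "b \<in> E"
    then obtain F G where "F \<subseteq> B" "finite F" "a = \<Inter>F" "G \<subseteq> B" "finite G" "b = \<Inter>G"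
      by (auto simp: E_def)
    then show "a \<inter> b \<in> E" unfolding E_def by (intro image_eqI[of _ _ "F \<union> G"]) auto
  qed
  have borel_E: "sets borel = sigma_sets UNIV E"
  proof
    have "sets borel = sigma_sets UNIV B" 
      by (subst borel_eq_countable_basis[OF B]) (simp add: sets_measure_of)
    then show "sets borel \<subseteq> sigma_sets UNIV E" using sigma_sets_mono'[OF B_E] by simp
    have "E \<subseteq> sets borel" using E_open by auto
    then show "sigma_sets UNIV E \<subseteq> sets borel" using sets.sigma_sets_subset[of E borel] by simp
  qed
  \<comment> \<open>\<open>infdist\<close> to the empty set is 0 by convention, so the general
    formula would give 0 instead of 1 when \<open>U = UNIV\<close>.\<close>
  define h where "h U n x = (if U = UNIV then 1 else min 1 (real n * infdist x (- U)))" for U :: "'a set" and n x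
  define g where "g m = h (from_nat_into E (fst (prod_decode m))) (snd (prod_decode m))" for m
  have h_lip: "(real n)-lipschitz_on UNIV (h U n)" for U n
  proof (rule lipschitz_onI)
    fix x y :: 'a
    have "real n * \<bar>infdist x (- U) - infdist y (- U)\<bar> \<le> real n * dist x y"
      by (intro mult_left_mono infdist_triangle_abs) auto
    then have "\<bar>real n * infdist x (- U) - real n * infdist y (- U)\<bar> \<le> real n * dist x y"
      by (simp add: abs_mult right_diff_distrib[symmetric])
    then show "dist (h U n x) (h U n y) \<le> real n * dist x y"
      by (auto simp: h_def dist_real_def min_def)
  qed simp
  have h_lim: "(\<lambda>n. integral\<^sup>L p (h U n)) \<longlonglongrightarrow> measure p U" if p: "p \<in> Delta" and U: "open U" for p U
  proof -
    interpret prob_space p using p by (rule DeltaD)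
    have Us: "U \<in> sets p" using U DeltaD(2)[OF p] by simp
    have "(\<lambda>n. integral\<^sup>L p (h U n)) \<longlonglongrightarrow> integral\<^sup>L p (indicator U)"
    proof (rule integral_dominated_convergence[where w="\<lambda>_. 1"])
      show "AE x in p. (\<lambda>n. h U n x) \<longlonglongrightarrow> indicator U x"
      proof (rule AE_I2)
        fix x
        show "(\<lambda>n. h U n x) \<longlonglongrightarrow> indicator U x"
        proof (cases "x \<in> U \<and> U \<noteq> UNIV")
          case True
          then have "infdist x (- U) > 0"
            using in_closed_iff_infdist_zero[of "- U" x] U infdist_nonneg[of x "- U"] by (fastforce simp: closed_def)
          moreover obtain N :: nat where "1 / infdist x (- U) < real N" using reals_Archimedean2 by blast
          ultimately have "1 \<le> real N * infdist x (- U)" by (simp add: divide_less_eq)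
          then have "h U n x = 1" if "n \<ge> N" for n
            using that mult_right_mono[of "real N" "real n" "infdist x (- U)"] infdist_nonneg[of x "- U"]
            by (simp add: h_def)
          then have "\<forall>\<^sub>F n in sequentially. h U n x = 1" by (auto simp: eventually_sequentially)
          then show ?thesis using True by (simp add: tendsto_eventually)
        next
          case False
          then have "x \<in> U \<and> h U = (\<lambda>n x. 1) \<or> x \<notin> U \<and> (\<forall>n. h U n x = 0)"
            by (auto simp: h_def fun_eq_iff)
          then show ?thesis by auto
        qed
      qed
      show "h U n \<in> borel_measurable p" for n
        by (rule borel_measurable_Delta[OF p borel_measurable_lipschitz[OF h_lip]])
      show "AE x in p. norm (h U n x) \<le> 1" for n by (simp add: h_def infdist_nonneg)
    qed (use Us in auto)
    then show ?thesis using Us by simp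
  qed
  have "s \<in> M \<rightarrow>\<^sub>M prob_algebra borel"
    if s: "\<forall>\<omega>\<in>space M. s \<omega> \<in> Delta" and meas: "\<forall>n. (\<lambda>\<omega>. integral\<^sup>L (s \<omega>) (g n)) \<in> borel_measurable M"
    for M :: "'m measure" and s
  proof (rule measurable_prob_algebra_generated[OF borel_E E_Int])
    fix U assume U: "U \<in> E"
    have "(\<lambda>\<omega>. integral\<^sup>L (s \<omega>) (h U i)) \<in> borel_measurable M" for i
      using meas[rule_format, of "prod_encode (to_nat_on E U, i)"] U E_cnt by (simp add: g_def)
    then have "(\<lambda>\<omega>. measure (s \<omega>) U) \<in> borel_measurable M"
      by (rule borel_measurable_LIMSEQ_real[of M "\<lambda>i \<omega>. integral\<^sup>L (s \<omega>) (h U i)", rotated])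
        (use s h_lim E_open[OF U] in auto)
    then have "(\<lambda>\<omega>. ennreal (measure (s \<omega>) U)) \<in> borel_measurable M" by measurable
    moreover have "emeasure (s \<omega>) U = ennreal (measure (s \<omega>) U)" if "\<omega> \<in> space M" for \<omega>
      using s that by (intro finite_measure.emeasure_eq_measure prob_space.finite_measure DeltaD) auto
    ultimately show "(\<lambda>\<omega>. emeasure (s \<omega>) U) \<in> borel_measurable M" by (simp cong: measurable_cong)
  qed (use s in \<open>auto simp: DeltaD\<close>)
  moreover have "\<forall>n. \<exists>L. L-lipschitz_on UNIV (g n)" using h_lip unfolding g_def by blast
  ultimately show ?thesis by blast
qed

text \<open>The last assumption is upper semicontinuity of \<open>\<phi>\<close>, stated through superlevel sets.\<close>

lemma attains_max_seq_compact:
  fixes A :: "'p set" and d :: "'p \<Rightarrow> 'p \<Rightarrow> real" and \<phi> :: "'p \<Rightarrow> real"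
  assumes ne: "A \<noteq> {}" and B: "\<And>p. p \<in> A \<Longrightarrow> \<phi> p \<le> B"
    and compact: "\<And>p :: nat \<Rightarrow> 'p. (\<And>n. p n \<in> A) \<Longrightarrow>
      \<exists>q r. q \<in> A \<and> strict_mono (r :: nat \<Rightarrow> nat) \<and> (\<lambda>n. d (p (r n)) q) \<longlonglongrightarrow> 0"
    and closed: "\<And>(p :: nat \<Rightarrow> 'p) q c. (\<And>n. p n \<in> A) \<Longrightarrow> q \<in> A \<Longrightarrow> (\<lambda>n. d (p n) q) \<longlonglongrightarrow> 0 \<Longrightarrow>
      (\<And>n. c \<le> \<phi> (p n)) \<Longrightarrow> c \<le> \<phi> q"
  shows "\<exists>q\<in>A. \<forall>p\<in>A. \<phi> p \<le> \<phi> q"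
proof -
  define m where "m = (SUP p\<in>A. \<phi> p)"
  have bdd: "bdd_above (\<phi> ` A)" using B by (rule bdd_aboveI2)
  have "\<exists>p\<in>A. m - 1 / real (Suc n) < \<phi> p" for n
    using less_cSUP_iff[OF ne bdd, of "m - 1 / real (Suc n)"] by (simp add: m_def)
  then obtain p where p: "\<And>n. p n \<in> A" "\<And>n. m - 1 / real (Suc n) < \<phi> (p n)" by metis
  obtain q and r :: "nat \<Rightarrow> nat" where q: "q \<in> A" "strict_mono r" "(\<lambda>n. d (p (r n)) q) \<longlonglongrightarrow> 0"
    using compact[of p, OF p(1)] by (elim exE conjE)
  have "m - 1 / real (Suc N) \<le> \<phi> q" for N
  proof (rule closed[of "\<lambda>n. p (r (n + N))"])
    show "(\<lambda>n. d (p (r (n + N))) q) \<longlonglongrightarrow> 0" using q(3) by (rule LIMSEQ_ignore_initial_segment)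
    fix n
    have "N \<le> r (n + N)" using seq_suble[OF q(2), of "n + N"] by linarith
    then have "1 / real (Suc (r (n + N))) \<le> 1 / real (Suc N)" by (intro divide_left_mono) auto
    then show "m - 1 / real (Suc N) \<le> \<phi> (p (r (n + N)))" using p(2)[of "r (n + N)"] by linarith
  qed (use p q in auto)
  then have "m \<le> \<phi> q"
    using LIMSEQ_le_const2[OF LIMSEQ_inverse_real_of_nat_add_minus[of m], of "\<phi> q"]
    by (simp add: inverse_eq_divide)
  moreover have "\<phi> p \<le> m" if "p \<in> A" for p unfolding m_def by (rule cSUP_upper[OF that bdd])
  ultimately show ?thesis using q(1) by (meson order_trans)
qed

text \<open>The limit is confined to \<open>Delta\<close> because \<open>dKR\<close> is 0 by default
  outside, where any measure would otherwise count as a limit.\<close>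

definition kr_closed :: "'a::metric_space measure set \<Rightarrow> bool" where
  "kr_closed C \<longleftrightarrow> (\<forall>p q. (\<forall>n::nat. p n \<in> C) \<longrightarrow> q \<in> Delta \<longrightarrow> (\<lambda>n. dKR (p n) q) \<longlonglongrightarrow> 0 \<longrightarrow> q \<in> C)"

text \<open>A point common to the successive argmax sets of a measure-determining sequence of integrals
  over \<open>F z\<close> has measurable integrals: the set of \<open>z\<close> whose \<open>n\<close>-th argmax set meets a given
  closed set is Borel, because a maximum over a smaller compact set equals the full one iff it
  exceeds every rational below the full one.\<close>

lemma measurable_selection:
  fixes F :: "'z::metric_space \<Rightarrow> 'a::compact_metric_space measure set"
  assumes FD: "\<And>z. F z \<subseteq> Delta" and Fne: "\<And>z. F z \<noteq> {}"
    and uhc: "\<And>z p z'. z \<longlonglongrightarrow> z' \<Longrightarrow> (\<And>n::nat. p n \<in> F (z n)) \<Longrightarrow>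
      \<exists>q r. q \<in> F z' \<and> strict_mono (r :: nat \<Rightarrow> nat) \<and> (\<lambda>n. dKR (p (r n)) q) \<longlonglongrightarrow> 0"
  shows "\<exists>s. s \<in> borel \<rightarrow>\<^sub>M prob_algebra borel \<and> (\<forall>z. s z \<in> F z)"
proof -
  from countable_lipschitz_generators[where 'a='a and 'm='z] obtain g :: "nat \<Rightarrow> 'a \<Rightarrow> real" where
    g_lip: "\<forall>n. \<exists>L. L-lipschitz_on UNIV (g n)"
    and g_meas: "\<forall>(M :: 'z measure) s. (\<forall>\<omega>\<in>space M. s \<omega> \<in> Delta) \<longrightarrow>
        (\<forall>n. (\<lambda>\<omega>. integral\<^sup>L (s \<omega>) (g n)) \<in> borel_measurable M) \<longrightarrow> s \<in> M \<rightarrow>\<^sub>M prob_algebra borel"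
    by (elim exE conjE)
  have lim: "(\<lambda>i. integral\<^sup>L (p i) (g n)) \<longlonglongrightarrow> integral\<^sup>L q (g n)"
    if "\<And>i. p i \<in> Delta" "q \<in> Delta" "(\<lambda>i. dKR (p i) q) \<longlonglongrightarrow> 0" for p q n
    using g_lip integral_lipschitz_tendsto[OF _ that] by metis
  define K where "K = rec_nat F (\<lambda>n A z. {p \<in> A z. \<forall>q\<in>A z. integral\<^sup>L q (g n) \<le> integral\<^sup>L p (g n)})"
  have K0: "K 0 = F" and KS: "K (Suc n) z = {p \<in> K n z. \<forall>q\<in>K n z. integral\<^sup>L q (g n) \<le> integral\<^sup>L p (g n)}" for n z
    by (simp_all add: K_def)
  have K_anti: "K m z \<subseteq> K n z" if "n \<le> m" for n m z
    using that by (induction m rule: dec_induct) (auto simp: KS)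
  have KF: "K n z \<subseteq> F z" for n z using K_anti[of 0 n z] by (simp add: K0)
  have KD: "p \<in> Delta" if "p \<in> K n z" for p n z using that KF FD by blast
  have F_compact: "\<exists>q r. q \<in> F z \<and> strict_mono (r :: nat \<Rightarrow> nat) \<and> (\<lambda>n. dKR (p (r n)) q) \<longlonglongrightarrow> 0"
    if "\<And>n. p n \<in> F z" for p :: "nat \<Rightarrow> 'a measure" and z
    using uhc[of "\<lambda>_. z" z p] that by simp
  have K_closed: "q \<in> K n z" if p: "\<And>i. p i \<in> K n z" and q: "q \<in> F z" and pq: "(\<lambda>i. dKR (p i) q) \<longlonglongrightarrow> 0"
    for p :: "nat \<Rightarrow> 'a measure" and q n z
    using p
  proof (induction n)
    case 0
    then show ?case using q by (simp add: K0)
  next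
    case (Suc n)
    have "q \<in> K n z" using Suc by (simp add: KS)
    moreover have "integral\<^sup>L q' (g n) \<le> integral\<^sup>L q (g n)" if "q' \<in> K n z" for q'
      by (rule LIMSEQ_le_const[OF lim[OF KD[OF Suc.prems] _ pq]]) (use Suc.prems that q FD in \<open>auto simp: KS\<close>)
    ultimately show ?case by (simp add: KS)
  qed
  have KC_compact: "\<exists>q r. q \<in> K n z \<inter> C \<and> strict_mono (r :: nat \<Rightarrow> nat) \<and> (\<lambda>i. dKR (p (r i)) q) \<longlonglongrightarrow> 0"
    if p: "\<And>i. p i \<in> K n z \<inter> C" and C: "kr_closed C" for p n z C
  proof -
    have "\<exists>q r. q \<in> F z \<and> strict_mono (r :: nat \<Rightarrow> nat) \<and> (\<lambda>n. dKR (p (r n)) q) \<longlonglongrightarrow> 0"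
      using p KF by (intro F_compact) blast
    then obtain q and r :: "nat \<Rightarrow> nat" where q: "q \<in> F z" "strict_mono r" "(\<lambda>n. dKR (p (r n)) q) \<longlonglongrightarrow> 0"
      by (elim exE conjE)
    have "q \<in> K n z" using p by (intro K_closed[OF _ q(1,3)]) blast
    moreover have "q \<in> C"
      using C p q FD unfolding kr_closed_def by (metis IntD2 subsetD)
    ultimately show ?thesis using q by blast
  qed
  have UNIV_closed: "kr_closed UNIV" by (simp add: kr_closed_def)
  have max: "\<exists>q\<in>K n z \<inter> C. \<forall>p\<in>K n z \<inter> C. integral\<^sup>L p (g n) \<le> integral\<^sup>L q (g n)"
    if ne: "K n z \<inter> C \<noteq> {}" and C: "kr_closed C" for n z C
  proof -
    obtain L where L: "L-lipschitz_on UNIV (g n)" using g_lip by blast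
    have "bounded (range (g n))"
      using compact_continuous_image[OF lipschitz_on_continuous_on[OF L] compact_space_UNIV]
      by (rule compact_imp_bounded)
    then obtain B where B: "\<And>x. \<bar>g n x\<bar> \<le> B" by (auto simp: bounded_iff)
    show ?thesis
    proof (rule attains_max_seq_compact[where d=dKR, OF ne])
      fix p assume "p \<in> K n z \<inter> C"
      then have D: "p \<in> Delta" using KD by blast
      show "integral\<^sup>L p (g n) \<le> B"
        using integral_bounds_const(2)[OF DeltaD(1)[OF D] borel_measurable_Delta[OF D borel_measurable_lipschitz[OF L]] B]
        by linarith
    next
      fix p q c assume "\<And>i. p i \<in> K n z \<inter> C" "q \<in> K n z \<inter> C" "(\<lambda>i. dKR (p i) q) \<longlonglongrightarrow> 0"
        "\<And>i. c \<le> integral\<^sup>L (p i) (g n)"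
      then show "c \<le> integral\<^sup>L q (g n)"
        by (intro LIMSEQ_le_const[OF lim[of p q n]]) (auto intro: KD)
    qed (rule KC_compact[OF _ C])
  qed
  have K_ne: "K n z \<noteq> {}" for n z
  proof (induction n)
    case (Suc n)
    then show ?case using max[of n z UNIV] UNIV_closed by (auto simp: KS)
  qed (simp add: K0 Fne)
  have level_closed: "kr_closed {p \<in> C. a \<le> integral\<^sup>L p (g n)}" if C: "kr_closed C" "C \<subseteq> Delta" for C a n
    unfolding kr_closed_def
  proof (intro allI impI CollectI conjI)
    fix p q assume *: "\<forall>i. p i \<in> {p \<in> C. a \<le> integral\<^sup>L p (g n)}" "q \<in> Delta" "(\<lambda>i. dKR (p i) q) \<longlonglongrightarrow> 0"
    then show "q \<in> C" using C(1) unfolding kr_closed_def by (metis (mono_tags, lifting) mem_Collect_eq)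
    show "a \<le> integral\<^sup>L q (g n)"
      using * C(2) by (intro LIMSEQ_le_const[OF lim[of p q n]]) auto
  qed
  have Delta_closed: "kr_closed (Delta :: 'a measure set)" by (simp add: kr_closed_def)
  \<comment> \<open>The induction generalizes over \<open>C\<close>: the step applies its hypothesis
    to superlevel sets of the \<open>n\<close>-th integral, once inside \<open>C\<close> and once
    inside \<open>Delta\<close>.\<close>
  have K_borel: "{z. K n z \<inter> C \<noteq> {}} \<in> sets borel" if "kr_closed C" "C \<subseteq> Delta" for n C
    using that
  proof (induction n arbitrary: C)
    case 0
    have "closed {z. F z \<inter> C \<noteq> {}}"
      unfolding closed_sequential_limits
    proof (intro allI impI, elim conjE)
      fix x :: "nat \<Rightarrow> 'z" and l assume x: "\<forall>n. x n \<in> {z. F z \<inter> C \<noteq> {}}" "x \<longlonglongrightarrow> l"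
      then have "\<forall>n. \<exists>p. p \<in> F (x n) \<inter> C" by blast
      then obtain p where p: "\<And>n. p n \<in> F (x n) \<inter> C" by metis
      have "\<exists>q r. q \<in> F l \<and> strict_mono (r :: nat \<Rightarrow> nat) \<and> (\<lambda>n. dKR (p (r n)) q) \<longlonglongrightarrow> 0"
        using p by (intro uhc[OF x(2)]) blast
      then obtain q and r :: "nat \<Rightarrow> nat" where q: "q \<in> F l" "strict_mono r" "(\<lambda>n. dKR (p (r n)) q) \<longlonglongrightarrow> 0"
        by (elim exE conjE)
      have "q \<in> C" using 0(1) p q FD unfolding kr_closed_def by (metis IntD2 subsetD)
      then show "l \<in> {z. F z \<inter> C \<noteq> {}}" using q(1) by blast
    qed
    then show ?case by (simp add: K0)
  next
    case (Suc n)
    let ?L = "\<lambda>C (a::rat). {p \<in> C. of_rat a \<le> integral\<^sup>L p (g n)}"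
    have "{z. K (Suc n) z \<inter> C \<noteq> {}} = {z. K n z \<inter> C \<noteq> {}} \<inter>
        (\<Inter>a. - {z. K n z \<inter> ?L Delta a \<noteq> {}} \<union> {z. K n z \<inter> ?L C a \<noteq> {}})"
    proof (intro set_eqI iffI)
      fix z assume "z \<in> {z. K (Suc n) z \<inter> C \<noteq> {}}"
      then obtain p where p: "p \<in> K n z" "p \<in> C" "\<forall>q\<in>K n z. integral\<^sup>L q (g n) \<le> integral\<^sup>L p (g n)"
        by (auto simp: KS)
      have "p \<in> K n z \<inter> ?L C a" if "q \<in> K n z \<inter> ?L Delta a" for q a
        using p that order_trans[of "of_rat a" "integral\<^sup>L q (g n)" "integral\<^sup>L p (g n)"] by blast
      then show "z \<in> {z. K n z \<inter> C \<noteq> {}} \<inter>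
        (\<Inter>a. - {z. K n z \<inter> ?L Delta a \<noteq> {}} \<union> {z. K n z \<inter> ?L C a \<noteq> {}})"
        using p(1,2) by blast
    next
      fix z assume z: "z \<in> {z. K n z \<inter> C \<noteq> {}} \<inter>
        (\<Inter>a. - {z. K n z \<inter> ?L Delta a \<noteq> {}} \<union> {z. K n z \<inter> ?L C a \<noteq> {}})"
      then have "K n z \<inter> C \<noteq> {}" by simp
      from max[OF this Suc.prems(1)] obtain p where
        p: "p \<in> K n z" "p \<in> C" "\<forall>q\<in>K n z \<inter> C. integral\<^sup>L q (g n) \<le> integral\<^sup>L p (g n)" by blast
      have "integral\<^sup>L q (g n) \<le> integral\<^sup>L p (g n)" if q: "q \<in> K n z" for q
      proof (rule ccontr)
        assume "\<not> ?thesis"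
        then obtain a where a: "integral\<^sup>L p (g n) < of_rat a" "of_rat a < integral\<^sup>L q (g n)"
          using of_rat_dense by (metis not_le)
        then have "K n z \<inter> ?L Delta a \<noteq> {}" using q KD[OF q] by (auto intro: less_imp_le)
        then obtain p' where "p' \<in> K n z \<inter> C" "of_rat a \<le> integral\<^sup>L p' (g n)" using z by blast
        then show False using p(3)[rule_format, of p'] a(1) by linarith
      qed
      then show "z \<in> {z. K (Suc n) z \<inter> C \<noteq> {}}" using p by (auto simp: KS)
    qed
    moreover have "{z. K n z \<inter> ?L D a \<noteq> {}} \<in> sets borel" if "kr_closed D" "D \<subseteq> Delta" for D a
      using that by (intro Suc.IH level_closed) auto
    ultimately show ?case
      using Suc.IH[OF Suc.prems] Suc.prems Delta_closed
      by (simp only:) (intro sets.Int sets.countable_INT'' sets.Un borel_comp; simp)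
  qed
  \<comment> \<open>Nested nonempty compact sets have a common point: a limit of points
    \<open>p n\<close> of \<open>K n z\<close> lies in each \<open>K m z\<close>, because the
    subsequence from index \<open>m\<close> on stays in it.\<close>
  have "\<exists>q. \<forall>n. q \<in> K n z" for z
  proof -
    have "\<exists>p. \<forall>n. p n \<in> K n z" using K_ne by (intro choice) auto
    then obtain p where p: "\<And>n. p n \<in> K n z" by blast
    have "\<exists>q r. q \<in> F z \<and> strict_mono (r :: nat \<Rightarrow> nat) \<and> (\<lambda>n. dKR (p (r n)) q) \<longlonglongrightarrow> 0"
      using p KF by (intro F_compact) blast
    then obtain q and r :: "nat \<Rightarrow> nat" where q: "q \<in> F z" "strict_mono r" "(\<lambda>n. dKR (p (r n)) q) \<longlonglongrightarrow> 0"
      by (elim exE conjE)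
    have "q \<in> K m z" for m
    proof (rule K_closed[OF _ q(1)])
      show "p (r (i + m)) \<in> K m z" for i
        using p[of "r (i + m)"] K_anti[of m "r (i + m)" z] seq_suble[OF q(2), of "i + m"] by auto
      show "(\<lambda>i. dKR (p (r (i + m))) q) \<longlonglongrightarrow> 0" using q(3) by (rule LIMSEQ_ignore_initial_segment)
    qed
    then show ?thesis by blast
  qed
  then obtain s where s: "\<And>z n. s z \<in> K n z" by metis
  have "(\<lambda>z. integral\<^sup>L (s z) (g n)) \<in> borel_measurable borel" for n
    unfolding borel_measurable_iff_ge
  proof
    fix a
    \<comment> \<open>As \<open>s z\<close> lies in \<open>K (Suc n) z\<close>, its
      \<open>n\<close>-th integral is the maximum over \<open>K n z\<close>; it reaches
      \<open>a\<close> exactly when \<open>K n z\<close> meets a closed superlevel set.\<close>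
    have "{z \<in> space borel. a \<le> integral\<^sup>L (s z) (g n)} = {z. K n z \<inter> {p \<in> Delta. a \<le> integral\<^sup>L p (g n)} \<noteq> {}}"
    proof (intro set_eqI iffI)
      fix z assume "z \<in> {z. K n z \<inter> {p \<in> Delta. a \<le> integral\<^sup>L p (g n)} \<noteq> {}}"
      then obtain q where q: "q \<in> K n z" "a \<le> integral\<^sup>L q (g n)" by blast
      have "integral\<^sup>L q (g n) \<le> integral\<^sup>L (s z) (g n)" using s[of z "Suc n"] q(1) by (auto simp: KS)
      then show "z \<in> {z \<in> space borel. a \<le> integral\<^sup>L (s z) (g n)}" using q(2) by simp
    next
      fix z assume "z \<in> {z \<in> space borel. a \<le> integral\<^sup>L (s z) (g n)}"
      then have "s z \<in> K n z \<inter> {p \<in> Delta. a \<le> integral\<^sup>L p (g n)}" using s[of z n] KD[OF s] by simp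
      then show "z \<in> {z. K n z \<inter> {p \<in> Delta. a \<le> integral\<^sup>L p (g n)} \<noteq> {}}" by blast
    qed
    then show "{z \<in> space borel. a \<le> integral\<^sup>L (s z) (g n)} \<in> sets borel"
      using K_borel[OF level_closed[OF Delta_closed]] by simp
  qed
  then have "s \<in> borel \<rightarrow>\<^sub>M prob_algebra borel"
    using g_meas s KD by (metis (full_types))
  moreover have "s z \<in> F z" for z using s[of z 0] by (simp add: K0)
  ultimately show ?thesis by blast
qed

section \<open>Bilinear extensions\<close>

lemma bounded_measurableE:
  assumes "f \<in> bounded_measurable"
  obtains B where "f \<in> borel_measurable borel" "\<And>z. \<bar>f z\<bar> \<le> B"
  using assms by (auto simp: bounded_measurable_def bounded_iff)

lemma bounded_measurableI: "f \<in> borel_measurable borel \<Longrightarrow> (\<And>z. \<bar>f z\<bar> \<le> B) \<Longrightarrow> f \<in> bounded_measurable"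
  by (auto simp: bounded_measurable_def bounded_iff)

lemma sections_bounded_measurable:
  fixes f :: "'a::topological_space \<times> 'b::topological_space \<Rightarrow> real"
  assumes "f \<in> bounded_measurable"
  shows "(\<lambda>x. f (x, y)) \<in> bounded_measurable" "(\<lambda>y. f (x, y)) \<in> bounded_measurable"
proof -
  have "(\<lambda>x. (x, y)) \<in> borel \<rightarrow>\<^sub>M borel" "(\<lambda>y. (x, y)) \<in> borel \<rightarrow>\<^sub>M borel"
    by (auto intro!: borel_measurable_continuous_onI continuous_intros)
  from this[THEN measurable_compose] show "(\<lambda>x. f (x, y)) \<in> bounded_measurable" "(\<lambda>y. f (x, y)) \<in> bounded_measurable"
    using assms by (auto elim!: bounded_measurableE intro!: bounded_measurableI)
qed

lemma integrable_bounded_measurable: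
  assumes "p \<in> Delta" "f \<in> bounded_measurable" shows "integrable p f"
  using assms(2) by (rule bounded_measurableE) (rule integrable_Delta[OF assms(1)])

lemma measurable_pair_Delta:
  fixes f :: "'a::second_countable_topology \<times> 'b::second_countable_topology \<Rightarrow> real"
  assumes "f \<in> borel_measurable borel" "p \<in> Delta" "q \<in> Delta"
  shows "f \<in> borel_measurable (p \<Otimes>\<^sub>M q)" "f \<in> borel_measurable (borel \<Otimes>\<^sub>M q)" "f \<in> borel_measurable (p \<Otimes>\<^sub>M borel)"
proof -
  have 1: "sets (p \<Otimes>\<^sub>M q) = sets borel"
    using sets_pair_measure_cong[OF DeltaD(2)[OF assms(2)] DeltaD(2)[OF assms(3)]] by (simp only: borel_prod)
  have 2: "sets ((borel :: 'a measure) \<Otimes>\<^sub>M q) = sets borel"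
    using sets_pair_measure_cong[OF refl[of "sets (borel :: 'a measure)"] DeltaD(2)[OF assms(3)]]
    by (simp only: borel_prod)
  have 3: "sets (p \<Otimes>\<^sub>M (borel :: 'b measure)) = sets borel"
    using sets_pair_measure_cong[OF DeltaD(2)[OF assms(2)] refl[of "sets (borel :: 'b measure)"]]
    by (simp only: borel_prod)
  show "f \<in> borel_measurable (p \<Otimes>\<^sub>M q)" by (subst measurable_cong_sets[OF 1 refl]) (rule assms(1))
  show "f \<in> borel_measurable (borel \<Otimes>\<^sub>M q)" by (subst measurable_cong_sets[OF 2 refl]) (rule assms(1))
  show "f \<in> borel_measurable (p \<Otimes>\<^sub>M borel)" by (subst measurable_cong_sets[OF 3 refl]) (rule assms(1))
qed

lemma partial_integral_bounded_measurable:
  fixes f :: "'a::second_countable_topology \<times> 'b::second_countable_topology \<Rightarrow> real"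
  assumes f: "f \<in> bounded_measurable"
  shows "p \<in> Delta \<Longrightarrow> (\<lambda>y. \<integral>x. f (x, y) \<partial>p) \<in> bounded_measurable"
    and "q \<in> Delta \<Longrightarrow> (\<lambda>x. \<integral>y. f (x, y) \<partial>q) \<in> bounded_measurable"
proof -
  obtain B where B: "f \<in> borel_measurable borel" "\<And>z. \<bar>f z\<bar> \<le> B" using f by (rule bounded_measurableE) (rule that)
  show "(\<lambda>y. \<integral>x. f (x, y) \<partial>p) \<in> bounded_measurable" if p: "p \<in> Delta"
  proof -
    interpret prob_space p using p by (rule DeltaD)
    have "(\<lambda>z. f (snd z, fst z)) \<in> borel_measurable (borel \<Otimes>\<^sub>M p)"
      using measurable_pair_swap[OF measurable_pair_Delta(3)[OF B(1) p return_in_Delta]]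
      by (simp add: case_prod_beta)
    then have m: "(\<lambda>y. \<integral>x. f (x, y) \<partial>p) \<in> borel_measurable borel"
      by (intro borel_measurable_lebesgue_integral) (simp add: case_prod_beta)
    have "\<bar>\<integral>x. f (x, y) \<partial>p\<bar> \<le> B" for y
      using sections_bounded_measurable(1)[OF f, of y] B(2)
      by (intro integral_bounds_const(2)[OF prob_space_axioms] borel_measurable_Delta[OF p])
        (auto elim: bounded_measurableE)
    with m show ?thesis by (rule bounded_measurableI)
  qed
  show "(\<lambda>x. \<integral>y. f (x, y) \<partial>q) \<in> bounded_measurable" if q: "q \<in> Delta"
  proof -
    interpret prob_space q using q by (rule DeltaD)
    have m: "(\<lambda>x. \<integral>y. f (x, y) \<partial>q) \<in> borel_measurable borel"
      using measurable_pair_Delta(2)[OF B(1) return_in_Delta q]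
      by (intro borel_measurable_lebesgue_integral) (simp add: case_prod_beta)
    have "\<bar>\<integral>y. f (x, y) \<partial>q\<bar> \<le> B" for x
      using sections_bounded_measurable(2)[OF f, of x] B(2)
      by (intro integral_bounds_const(2)[OF prob_space_axioms] borel_measurable_Delta[OF q])
        (auto elim: bounded_measurableE)
    with m show ?thesis by (rule bounded_measurableI)
  qed
qed

lemma mext_return_right:
  fixes f :: "'a::second_countable_topology \<times> 'b::second_countable_topology \<Rightarrow> real"
  assumes "f \<in> bounded_measurable" "p \<in> Delta"
  shows "mext f p (return borel y) = (\<integral>x. f (x, y) \<partial>p)"
  using partial_integral_bounded_measurable(1)[OF assms]
  unfolding mext_def by (intro integral_return) (auto elim: bounded_measurableE)

lemma mext_return_left:
  fixes f :: "'a::second_countable_topology \<times> 'b::second_countable_topology \<Rightarrow> real"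
  assumes "f \<in> bounded_measurable"
  shows "mext f (return borel x) q = (\<integral>y. f (x, y) \<partial>q)"
  unfolding mext_def
proof (rule Bochner_Integration.integral_cong[OF refl])
  fix y show "(\<integral>x. f (x, y) \<partial>return borel x) = f (x, y)"
    using sections_bounded_measurable(1)[OF assms, of y] by (intro integral_return) (auto elim: bounded_measurableE)
qed

lemma mext_Fubini:
  fixes f :: "'a::second_countable_topology \<times> 'b::second_countable_topology \<Rightarrow> real"
  assumes f: "f \<in> bounded_measurable" and p: "p \<in> Delta" and q: "q \<in> Delta"
  shows "mext f p q = (\<integral>x. \<integral>y. f (x, y) \<partial>q \<partial>p)"
    and "(\<integral>z. f z \<partial>(p \<Otimes>\<^sub>M q)) = mext f p q"
proof -
  obtain B where B: "f \<in> borel_measurable borel" "\<And>z. \<bar>f z\<bar> \<le> B" using f by (rule bounded_measurableE) (rule that)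
  interpret p: prob_space p using p by (rule DeltaD)
  interpret q: prob_space q using q by (rule DeltaD)
  interpret pair_prob_space p q ..
  have "integrable (p \<Otimes>\<^sub>M q) (\<lambda>(x, y). f (x, y))"
    using measurable_pair_Delta(1)[OF B(1) p q] B(2)
    by (intro integral_bounds_const(1)[where B=B]) (auto simp: prob_space_axioms case_prod_beta)
  from Fubini_integral[OF this] integral_fst[OF this]
  show "mext f p q = (\<integral>x. \<integral>y. f (x, y) \<partial>q \<partial>p)" "(\<integral>z. f z \<partial>(p \<Otimes>\<^sub>M q)) = mext f p q"
    by (simp_all add: mext_def case_prod_beta)
qed

text \<open>The factor serves two purposes: \<open>c = 1\<close> transports facts about one variable
  to the other, and \<open>c = - 1\<close> turns the minimizer into a maximizer.\<close>

lemma mext_swap: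
  fixes f :: "'a::second_countable_topology \<times> 'b::second_countable_topology \<Rightarrow> real"
  assumes f: "f \<in> bounded_measurable" and p: "p \<in> Delta" and q: "q \<in> Delta"
  shows "mext (\<lambda>z. c * f (snd z, fst z)) q p = c * mext f p q"
  unfolding mext_Fubini(1)[OF assms] by (simp add: mext_def)

lemma mext_bounded:
  fixes f :: "'a::second_countable_topology \<times> 'b::second_countable_topology \<Rightarrow> real"
  assumes f: "f \<in> borel_measurable borel" "\<And>z. \<bar>f z\<bar> \<le> B" and p: "p \<in> Delta" and q: "q \<in> Delta"
  shows "\<bar>mext f p q\<bar> \<le> B"
proof -
  interpret p: prob_space p using p by (rule DeltaD)
  interpret q: prob_space q using q by (rule DeltaD)
  interpret pair_prob_space p q ..
  have "\<bar>\<integral>z. f z \<partial>(p \<Otimes>\<^sub>M q)\<bar> \<le> B"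
    using measurable_pair_Delta(1)[OF f(1) p q] f(2) by (intro integral_bounds_const(2)) (auto simp: prob_space_axioms)
  then show ?thesis using mext_Fubini(2)[OF bounded_measurableI[OF f] p q] by simp
qed

lemma mext_mono:
  fixes f :: "'a::second_countable_topology \<times> 'b::second_countable_topology \<Rightarrow> real"
  assumes f: "f \<in> bounded_measurable" and g: "g \<in> bounded_measurable" and le: "\<And>z. f z \<le> g z"
    and p: "p \<in> Delta" and q: "q \<in> Delta"
  shows "mext f p q \<le> mext g p q"
  unfolding mext_def
  using partial_integral_bounded_measurable(1) sections_bounded_measurable(1) f g p q le
  by (intro integral_mono integrable_bounded_measurable) auto

lemma mext_lincomb:
  fixes f :: "'a::second_countable_topology \<times> 'b::second_countable_topology \<Rightarrow> real"
  assumes f: "f \<in> bounded_measurable" and g: "g \<in> bounded_measurable" and p: "p \<in> Delta" and q: "q \<in> Delta"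
  shows "mext (\<lambda>z. a * f z + b * g z) p q = a * mext f p q + b * mext g p q"
proof -
  have i: "integrable p (\<lambda>x. h (x, y))" "integrable q (\<lambda>y. \<integral>x. h (x, y) \<partial>p)" if "h \<in> bounded_measurable" for h :: "'a \<times> 'b \<Rightarrow> real" and y
    using sections_bounded_measurable(1)[OF that] partial_integral_bounded_measurable(1)[OF that p] p q
    by (auto intro: integrable_bounded_measurable)
  show ?thesis using i[OF f] i[OF g] by (simp add: mext_def)
qed

lemma mext_const_right: "q \<in> Delta \<Longrightarrow> mext (\<lambda>z. f (fst z)) p q = integral\<^sup>L p f"
  using prob_space.prob_space[OF DeltaD(1), of q] by (simp add: mext_def)

lemma mext_zero [simp]: "mext (\<lambda>_. 0) p q = 0"
  by (simp add: mext_def)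

lemma mext_mix_left:
  fixes f :: "'a::second_countable_topology \<times> 'b::second_countable_topology \<Rightarrow> real"
  assumes f: "f \<in> bounded_measurable" and p: "p \<in> Delta" "p' \<in> Delta" and q: "q \<in> Delta" and a: "a \<in> {0..1}"
  shows "mext f (mix a p p') q = a * mext f p q + (1 - a) * mext f p' q"
proof -
  obtain B where B: "(\<lambda>x. \<integral>y. f (x, y) \<partial>q) \<in> borel_measurable borel" "\<And>x. \<bar>\<integral>y. f (x, y) \<partial>q\<bar> \<le> B"
    using partial_integral_bounded_measurable(2)[OF f q] by (rule bounded_measurableE) (rule that)
  show ?thesis
    using integral_mix[OF p a B]
    by (simp only: mext_Fubini(1)[OF f p(1) q] mext_Fubini(1)[OF f p(2) q] mext_Fubini(1)[OF f mix_in_Delta[OF p a] q])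
qed

lemma mext_mix_right:
  fixes f :: "'a::second_countable_topology \<times> 'b::second_countable_topology \<Rightarrow> real"
  assumes f: "f \<in> bounded_measurable" and p: "p \<in> Delta" and q: "q \<in> Delta" "q' \<in> Delta" and a: "a \<in> {0..1}"
  shows "mext f p (mix a q q') = a * mext f p q + (1 - a) * mext f p q'"
proof -
  obtain B where B: "(\<lambda>y. \<integral>x. f (x, y) \<partial>p) \<in> borel_measurable borel" "\<And>y. \<bar>\<integral>x. f (x, y) \<partial>p\<bar> \<le> B"
    using partial_integral_bounded_measurable(1)[OF f p] by (rule bounded_measurableE) (rule that)
  show ?thesis using integral_mix[OF q a B] by (simp only: mext_def)
qed

lemma mext_bind_left:
  fixes f :: "'a::second_countable_topology \<times> 'b::second_countable_topology \<Rightarrow> real"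
  assumes f: "f \<in> bounded_measurable" and M: "prob_space M" and S: "S \<in> M \<rightarrow>\<^sub>M prob_algebra borel" and q: "q \<in> Delta"
  shows "mext f (M \<bind> S) q = (\<integral>\<omega>. mext f (S \<omega>) q \<partial>M)"
proof -
  obtain B where B: "(\<lambda>x. \<integral>y. f (x, y) \<partial>q) \<in> borel_measurable borel" "\<And>x. \<bar>\<integral>y. f (x, y) \<partial>q\<bar> \<le> B"
    using partial_integral_bounded_measurable(2)[OF f q] by (rule bounded_measurableE) (rule that)
  have "mext f (M \<bind> S) q = (\<integral>\<omega>. \<integral>x. \<integral>y. f (x, y) \<partial>q \<partial>S \<omega> \<partial>M)"
    unfolding mext_Fubini(1)[OF f bind_in_Delta[OF M S] q] by (rule integral_bind_kernel[OF M S B])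
  also have "\<dots> = (\<integral>\<omega>. mext f (S \<omega>) q \<partial>M)"
    by (intro Bochner_Integration.integral_cong refl mext_Fubini(1)[symmetric] f q prob_algebra_borel_Delta[OF S])
  finally show ?thesis .
qed

section \<open>Moduli of continuity\<close>

text \<open>The modulus is imposed in each variable separately, because estimates replace the law of
  one player at a time.\<close>

definition osc2_le :: "real \<Rightarrow> real \<Rightarrow> ('a::metric_space \<times> 'b::metric_space \<Rightarrow> real) \<Rightarrow> bool" where
  "osc2_le e C f \<longleftrightarrow> (\<forall>y. osc_le e C (\<lambda>x. f (x, y))) \<and> (\<forall>x. osc_le e C (\<lambda>y. f (x, y)))"

lemma compact_UNIV_prod: "compact (UNIV :: ('a::compact_metric_space \<times> 'b::compact_metric_space) set)"
  using compact_Times[OF compact_space_UNIV compact_space_UNIV] by (metis UNIV_Times_UNIV)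

lemma continuous_bounded_measurable:
  fixes f :: "'a::compact_metric_space \<times> 'b::compact_metric_space \<Rightarrow> real"
  assumes "continuous_on UNIV f" shows "f \<in> bounded_measurable"
  using compact_imp_bounded[OF compact_continuous_image[OF assms compact_UNIV_prod]] borel_measurable_continuous_onI[OF assms]
  by (simp add: bounded_measurable_def)

text \<open>Uniform continuity covers points closer than \<open>d\<close>; beyond that, the slope
  \<open>2 * B / d\<close> already accounts for the largest possible difference
  \<open>2 * B\<close>.\<close>

lemma continuous_imp_osc2_le:
  fixes f :: "'a::compact_metric_space \<times> 'b::compact_metric_space \<Rightarrow> real"
  assumes f: "continuous_on UNIV f" and e: "e > 0"
  shows "\<exists>C\<ge>0. osc2_le e C f"
proof -
  obtain B where B: "\<And>z. \<bar>f z\<bar> \<le> B" using bounded_measurableE[OF continuous_bounded_measurable[OF f]] by metis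
  have "uniformly_continuous_on UNIV f" by (rule compact_uniformly_continuous[OF f compact_UNIV_prod])
  then obtain d where d: "d > 0" "\<And>z z'. dist z z' < d \<Longrightarrow> \<bar>f z - f z'\<bar> < e"
    using e unfolding uniformly_continuous_on_def by (metis UNIV_I dist_real_def dist_commute)
  have B0: "B \<ge> 0" using B[of undefined] by linarith
  have *: "\<bar>f z - f z'\<bar> \<le> e + 2 * B / d * dist z z'" for z z'
  proof (cases "dist z z' < d")
    case True
    have "0 \<le> 2 * B / d * dist z z'" using B0 d(1) by simp
    then show ?thesis using d(2)[OF True] by linarith
  next
    case False
    then have "2 * B * 1 \<le> 2 * B * (dist z z' / d)" using B0 d(1) by (intro mult_left_mono) (auto simp: le_divide_eq)
    then show ?thesis using B[of z] B[of z'] e by (simp add: abs_le_iff)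
  qed
  have "osc2_le e (2 * B / d) f"
    unfolding osc2_le_def osc_le_def
  proof (intro conjI allI)
    show "\<bar>f (x, y) - f (x', y)\<bar> \<le> e + 2 * B / d * dist x x'" for x x' y
      using *[of "(x, y)" "(x', y)"] by (simp add: dist_Pair_Pair)
    show "\<bar>f (x, y) - f (x, y')\<bar> \<le> e + 2 * B / d * dist y y'" for x y y'
      using *[of "(x, y)" "(x, y')"] by (simp add: dist_Pair_Pair)
  qed
  then show ?thesis using B0 d(1) by (intro exI[of _ "2 * B / d"]) simp
qed

lemma osc2_le_diff:
  assumes "osc2_le e C f" "C \<ge> 0"
  shows "\<bar>f z - f z'\<bar> \<le> 2 * e + 2 * C * dist z z'"
proof -
  obtain x y x' y' where z: "z = (x, y)" "z' = (x', y')" by (metis surj_pair)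
  have "\<bar>f (x, y) - f (x', y)\<bar> \<le> e + C * dist x x'" "\<bar>f (x', y) - f (x', y')\<bar> \<le> e + C * dist y y'"
    using assms by (auto simp: osc2_le_def osc_le_def)
  moreover have "C * dist x x' \<le> C * dist z z'" "C * dist y y' \<le> C * dist z z'"
    using assms(2) dist_fst_le[of z z'] dist_snd_le[of z z'] by (auto simp: z intro!: mult_left_mono)
  ultimately show ?thesis unfolding z by linarith
qed

lemma osc2_le_imp_continuous:
  assumes "\<And>e. e > 0 \<Longrightarrow> \<exists>C\<ge>0. osc2_le e C f"
  shows "continuous_on UNIV f"
  unfolding continuous_on_iff
proof (intro ballI allI impI)
  fix z and e :: real assume "e > 0"
  then obtain C where C: "C \<ge> 0" "osc2_le (e / 4) C f" using assms[of "e / 4"] by auto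
  \<comment> \<open>\<open>osc2_le_diff\<close> doubles both constants, hence the quarters of
    \<open>e\<close>; \<open>C + 1\<close> keeps the denominator positive when
    \<open>C = 0\<close>.\<close>
  define d where "d = e / (4 * (C + 1))"
  have d: "d > 0" using \<open>e > 0\<close> C by (simp add: d_def)
  have "dist (f z') (f z) < e" if "dist z' z < d" for z'
  proof -
    have "C * dist z' z \<le> C * d" using that C(1) by (intro mult_left_mono) auto
    moreover have "(C + 1) * d = e / 4" using C by (simp add: d_def field_simps)
    ultimately have "C * dist z' z < e / 4" using d by (simp add: algebra_simps)
    then show ?thesis using osc2_le_diff[OF C(2,1), of z' z] by (simp add: dist_real_def)
  qed
  then show "\<exists>d>0. \<forall>x'\<in>UNIV. dist x' z < d \<longrightarrow> dist (f x') (f z) < e" using d by blast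
qed

lemma osc2_le_swap: "osc2_le e C (\<lambda>z. c * f (snd z, fst z))" if "osc2_le e C f" "\<bar>c\<bar> = 1"
  using that by (auto simp: osc2_le_def osc_le_def right_diff_distrib[symmetric] abs_mult)

text \<open>Integrating out \<open>y\<close> preserves the modulus in \<open>x\<close>, after which
  \<open>integral_diff_le_osc\<close> applies to a function of one variable.\<close>

lemma mext_diff_left:
  fixes f :: "'a::compact_metric_space \<times> 'b::compact_metric_space \<Rightarrow> real"
  assumes f: "f \<in> bounded_measurable" and osc: "osc2_le e C f" "C \<ge> 0"
    and p: "p \<in> Delta" "p' \<in> Delta" and q: "q \<in> Delta"
  shows "\<bar>mext f p q - mext f p' q\<bar> \<le> e + C * dKR p p'"
proof -
  interpret q: prob_space q using q by (rule DeltaD)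
  obtain B where B: "(\<lambda>x. \<integral>y. f (x, y) \<partial>q) \<in> borel_measurable borel" "\<And>x. \<bar>\<integral>y. f (x, y) \<partial>q\<bar> \<le> B"
    using partial_integral_bounded_measurable(2)[OF f q] by (rule bounded_measurableE) (rule that)
  have i: "integrable q (\<lambda>y. f (x, y))" for x
    by (rule integrable_bounded_measurable[OF q sections_bounded_measurable(2)[OF f]])
  have "osc_le e C (\<lambda>x. \<integral>y. f (x, y) \<partial>q)"
    unfolding osc_le_def
  proof (intro allI)
    fix x x'
    have "(\<integral>y. f (x, y) \<partial>q) - (\<integral>y. f (x', y) \<partial>q) = (\<integral>y. f (x, y) - f (x', y) \<partial>q)"
      using i by simp
    also have "\<bar>\<dots>\<bar> \<le> e + C * dist x x'"
      using i osc(1) by (intro integral_bounds_const(2)[OF q.prob_space_axioms]) (auto simp: osc2_le_def osc_le_def)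
    finally show "\<bar>(\<integral>y. f (x, y) \<partial>q) - (\<integral>y. f (x', y) \<partial>q)\<bar> \<le> e + C * dist x x'" .
  qed
  from integral_diff_le_osc[OF p B this osc(2)] show ?thesis
    by (simp only: mext_Fubini(1)[OF f p(1) q] mext_Fubini(1)[OF f p(2) q])
qed

lemma mext_diff_right:
  fixes f :: "'a::compact_metric_space \<times> 'b::compact_metric_space \<Rightarrow> real"
  assumes f: "f \<in> bounded_measurable" and osc: "osc2_le e C f" "C \<ge> 0"
    and p: "p \<in> Delta" and q: "q \<in> Delta" "q' \<in> Delta"
  shows "\<bar>mext f p q - mext f p q'\<bar> \<le> e + C * dKR q q'"
proof -
  have "(\<lambda>z. 1 * f (snd z, fst z)) \<in> bounded_measurable"
  proof -
    obtain B where B: "f \<in> borel_measurable borel" "\<And>z. \<bar>f z\<bar> \<le> B" using f by (rule bounded_measurableE) (rule that)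
    have "(\<lambda>z. (snd z, fst z)) \<in> borel \<rightarrow>\<^sub>M borel"
      by (intro borel_measurable_continuous_onI continuous_intros)
    from measurable_compose[OF this B(1)] show ?thesis using B(2) by (auto intro: bounded_measurableI)
  qed
  from mext_diff_left[OF this osc2_le_swap[OF osc(1)] osc(2) q p] show ?thesis
    unfolding mext_swap[OF f p q(1)] mext_swap[OF f p q(2)] by simp
qed

lemma dKR_return_le: "dKR (return borel (x::'a::compact_metric_space)) (return borel y) \<le> dist x y"
proof (rule dKR_leI[OF return_in_Delta return_in_Delta])
  fix f :: "'a \<Rightarrow> real" assume f: "1-lipschitz_on UNIV f"
  have "integral\<^sup>L (return borel z) f = f z" for z
    using borel_measurable_lipschitz[OF f] by (intro integral_return) auto
  then show "\<bar>integral\<^sup>L (return borel x) f - integral\<^sup>L (return borel y) f\<bar> \<le> dist x y"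
    using lipschitz_onD[OF f, of x y] by (simp add: dist_real_def)
qed

lemma mext_tendsto:
  fixes f :: "'a::compact_metric_space \<times> 'b::compact_metric_space \<Rightarrow> real"
  assumes f: "continuous_on UNIV f"
    and p: "\<And>n. p n \<in> Delta" "p' \<in> Delta" "(\<lambda>n. dKR (p n) p') \<longlonglongrightarrow> 0"
    and q: "\<And>n. q n \<in> Delta" "q' \<in> Delta" "(\<lambda>n. dKR (q n) q') \<longlonglongrightarrow> 0"
  shows "(\<lambda>n. mext f (p n) (q n)) \<longlonglongrightarrow> mext f p' q'"
proof (rule LIMSEQ_I)
  fix r :: real assume "r > 0"
  then obtain C where C: "C \<ge> 0" "osc2_le (r / 4) C f" using continuous_imp_osc2_le[OF f, of "r / 4"] by auto
  note fb = continuous_bounded_measurable[OF f]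
  have le: "\<bar>mext f (p n) (q n) - mext f p' q'\<bar> \<le> r / 2 + (C * dKR (p n) p' + C * dKR (q n) q')" for n
    using mext_diff_left[OF fb C(2,1) p(1)[of n] p(2) q(1)[of n]] mext_diff_right[OF fb C(2,1) p(2) q(1)[of n] q(2)]
    by linarith
  have "(\<lambda>n. C * dKR (p n) p' + C * dKR (q n) q') \<longlonglongrightarrow> 0"
    using tendsto_add[OF tendsto_mult_right_zero[OF p(3), of C] tendsto_mult_right_zero[OF q(3), of C]] by simp
  then have "\<forall>\<^sub>F n in sequentially. C * dKR (p n) p' + C * dKR (q n) q' < r / 2"
    using \<open>r > 0\<close> by (intro order_tendstoD(2)) auto
  then obtain N where "\<And>n. n \<ge> N \<Longrightarrow> C * dKR (p n) p' + C * dKR (q n) q' < r / 2"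
    unfolding eventually_sequentially by blast
  then have "norm (mext f (p n) (q n) - mext f p' q') < r" if "n \<ge> N" for n
    using le[of n] that by fastforce
  then show "\<exists>N. \<forall>n\<ge>N. norm (mext f (p n) (q n) - mext f p' q') < r" by blast
qed

section \<open>A minimax theorem\<close>

text \<open>The payoff pairs generated by \<open>L\<close> form a convex set that misses the open
  quadrant of pairs below \<open>c\<close>. The normal of a separating line has nonnegative
  components because the quadrant is unbounded below; normalized to sum 1, they are the mixing
  weights.\<close>

lemma two_payoffs_minimax:
  fixes f :: "'a::second_countable_topology \<times> 'b::second_countable_topology \<Rightarrow> real"
  assumes L: "convex_probs L" "L \<subseteq> Delta" "L \<noteq> {}" and f: "f \<in> bounded_measurable"
    and p: "p1 \<in> Delta" "p2 \<in> Delta"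
    and ge: "\<And>q. q \<in> L \<Longrightarrow> c \<le> mext f p1 q \<or> c \<le> mext f p2 q"
  shows "\<exists>a\<in>{0..1}. \<forall>q\<in>L. c \<le> a * mext f p1 q + (1 - a) * mext f p2 q"
proof -
  define A where "A = (\<lambda>q. (mext f p1 q, mext f p2 q)) ` L"
  define T where "T = {..<c} \<times> {..<c}"
  have "convex A"
    unfolding convex_alt
  proof (intro ballI allI impI, elim conjE)
    fix x y and a :: real assume "x \<in> A" "y \<in> A" and a: "0 \<le> a" "a \<le> 1"
    then obtain q q' where q: "q \<in> L" "x = (mext f p1 q, mext f p2 q)" "q' \<in> L" "y = (mext f p1 q', mext f p2 q')"
      unfolding A_def by blast
    have a1: "1 - a \<in> {0..1}" using a by simp
    have D: "q \<in> Delta" "q' \<in> Delta" using q L by auto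
    have "mix (1 - a) q q' \<in> L" using L(1) q a1 unfolding convex_probs_def by blast
    moreover have "(1 - a) *\<^sub>R x + a *\<^sub>R y = (mext f p1 (mix (1 - a) q q'), mext f p2 (mix (1 - a) q q'))"
      using mext_mix_right[OF f p(1) D a1] mext_mix_right[OF f p(2) D a1] by (simp add: q)
    ultimately show "(1 - a) *\<^sub>R x + a *\<^sub>R y \<in> A" unfolding A_def by blast
  qed
  moreover have "convex T" unfolding T_def by (intro convex_Times) auto
  moreover have "T \<noteq> {}" by (auto simp: T_def)
  moreover have "A \<noteq> {}" using L(3) by (simp add: A_def)
  moreover have "T \<inter> A = {}" using ge by (force simp: T_def A_def)
  ultimately obtain \<alpha> b where \<alpha>: "\<alpha> \<noteq> 0" "\<forall>x\<in>T. inner \<alpha> x \<le> b" "\<forall>x\<in>A. inner \<alpha> x \<ge> b"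
    using separating_hyperplane_sets[of T A] by metis
  obtain a1 a2 where a: "\<alpha> = (a1, a2)" by (cases \<alpha>)
  have T: "a1 * s + a2 * t \<le> b" if "s < c" "t < c" for s t
    using \<alpha>(2) that by (auto simp: T_def a)
  have nn: "0 \<le> a1" "0 \<le> a2"
  proof -
    show "0 \<le> a1"
    proof (rule ccontr)
      assume n: "\<not> 0 \<le> a1"
      \<comment> \<open>With \<open>a1\<close> negative, this point of the quadrant is far enough to
        the left to push the linear form to at least \<open>b + 1\<close>.\<close>
      define s where "s = min (c - 1) ((b + 1 - a2 * (c - 1)) / a1)"
      have "a1 * ((b + 1 - a2 * (c - 1)) / a1) \<le> a1 * s" using n by (intro mult_left_mono_neg) (auto simp: s_def)
      moreover have "a1 * ((b + 1 - a2 * (c - 1)) / a1) = b + 1 - a2 * (c - 1)" using n by simp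
      moreover have sc: "s < c" by (simp add: s_def min_less_iff_disj)
      ultimately show False using T[OF sc, of "c - 1"] by simp
    qed
    show "0 \<le> a2"
    proof (rule ccontr)
      assume n: "\<not> 0 \<le> a2"
      define s where "s = min (c - 1) ((b + 1 - a1 * (c - 1)) / a2)"
      have "a2 * ((b + 1 - a1 * (c - 1)) / a2) \<le> a2 * s" using n by (intro mult_left_mono_neg) (auto simp: s_def)
      moreover have "a2 * ((b + 1 - a1 * (c - 1)) / a2) = b + 1 - a1 * (c - 1)" using n by simp
      moreover have sc: "s < c" by (simp add: s_def min_less_iff_disj)
      ultimately show False using T[OF _ sc, of "c - 1"] by simp
    qed
  qed
  define m where "m = a1 + a2"
  have m: "m > 0" using nn \<alpha>(1) by (auto simp: m_def a zero_prod_def)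
  \<comment> \<open>The corner \<open>(c, c)\<close> is not in the open quadrant and is approached
    along the diagonal.\<close>
  have cm: "m * c \<le> b"
  proof (rule field_le_epsilon)
    fix e :: real assume "e > 0"
    then have "a1 * (c - e / m) + a2 * (c - e / m) \<le> b" using m by (intro T) auto
    then have "m * (c - e / m) \<le> b" by (simp add: m_def distrib_right)
    then show "m * c \<le> b + e" using m by (simp add: right_diff_distrib)
  qed
  have "c \<le> a1 / m * mext f p1 q + (1 - a1 / m) * mext f p2 q" if "q \<in> L" for q
  proof -
    have "m * c \<le> a1 * mext f p1 q + a2 * mext f p2 q" using \<alpha>(3) cm that by (force simp: A_def a)
    moreover have "1 - a1 / m = a2 / m" using m by (simp add: m_def field_simps)
    then have "a1 / m * mext f p1 q + (1 - a1 / m) * mext f p2 q = (a1 * mext f p1 q + a2 * mext f p2 q) / m"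
      by (simp only: add_divide_distrib times_divide_eq_left)
    ultimately show ?thesis using m by (simp add: le_divide_eq mult.commute)
  qed
  then show ?thesis using nn m by (intro bexI[of _ "a1 / m"]) (auto simp: m_def)
qed

text \<open>Induction on \<open>P\<close> with \<open>L\<close> varying. The \<open>q\<close>
  against which the new \<open>p\<close> fails form a convex set, on which the induction hypothesis
  yields a single good \<open>p'\<close>; every \<open>q\<close> is then met by \<open>p\<close> or
  by \<open>p'\<close>, and the case of two payoffs mixes them.\<close>

lemma finite_minimax:
  fixes f :: "'a::second_countable_topology \<times> 'b::second_countable_topology \<Rightarrow> real"
  assumes K: "convex_probs K" "K \<subseteq> Delta" and f: "f \<in> bounded_measurable"
    and P: "finite P" "P \<noteq> {}" "P \<subseteq> K" and L: "convex_probs L" "L \<subseteq> Delta"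
    and ge: "\<And>q. q \<in> L \<Longrightarrow> \<exists>p\<in>P. c \<le> mext f p q"
  shows "\<exists>p\<in>K. \<forall>q\<in>L. c \<le> mext f p q"
  using P L ge
proof (induction P arbitrary: L rule: finite_ne_induct)
  case (singleton p)
  then show ?case by auto
next
  case (insert p P)
  define L' where "L' = {q \<in> L. mext f p q < c}"
  have p: "p \<in> K" "p \<in> Delta" using insert.prems(1) K by auto
  have "convex_probs L'"
    unfolding convex_probs_def
  proof (intro ballI)
    fix q q' and a :: real assume q: "q \<in> L'" "q' \<in> L'" and a: "a \<in> {0..1}"
    have D: "q \<in> Delta" "q' \<in> Delta" using q insert.prems by (auto simp: L'_def)
    have "mix a q q' \<in> L" using insert.prems(2) q a unfolding convex_probs_def L'_def by blast
    moreover have "mext f p (mix a q q') < c"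
      unfolding mext_mix_right[OF f p(2) D a] using q a convex_bound_lt[of "mext f p q" c "mext f p q'" a "1 - a"]
      by (auto simp: L'_def)
    ultimately show "mix a q q' \<in> L'" by (simp add: L'_def)
  qed
  moreover have "\<exists>p\<in>P. c \<le> mext f p q" if "q \<in> L'" for q
    using insert.prems(4)[of q] that by (auto simp: L'_def)
  ultimately have "\<exists>p\<in>K. \<forall>q\<in>L'. c \<le> mext f p q"
    using insert.prems by (intro insert.IH) (auto simp: L'_def)
  then obtain p' where p': "p' \<in> K" "\<forall>q\<in>L'. c \<le> mext f p' q" by blast
  show ?case
  proof (cases "L = {}")
    case True
    then show ?thesis using p by blast
  next
    case False
    have "c \<le> mext f p q \<or> c \<le> mext f p' q" if "q \<in> L" for q
      using that p'(2) by (force simp: L'_def)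
    then obtain a where a: "a \<in> {0..1}" "\<forall>q\<in>L. c \<le> a * mext f p q + (1 - a) * mext f p' q"
      using two_payoffs_minimax[OF insert.prems(2,3) False f p(2)] p'(1) K(2) by (meson subsetD)
    have "c \<le> mext f (mix a p p') q" if "q \<in> L" for q
      using a(2) that mext_mix_left[OF f p(2) subsetD[OF K(2) p'(1)] subsetD[OF insert.prems(3) that] a(1)] by simp
    moreover have "mix a p p' \<in> K" using K(1) p p' a unfolding convex_probs_def by blast
    ultimately show ?thesis by blast
  qed
qed

section \<open>The one-stage value operator\<close>

text \<open>The payoff \<open>a\<close> is read after the move of player 1 and before that of player
  2, the mixed-time payoff that adapted moves control; \<open>a = 0\<close> leaves the one-stage
  game with payoff \<open>f\<close>. The real suprema and infima are over bounded sets when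
  \<open>a\<close> and \<open>f\<close> are continuous.\<close>

definition Val :: "('a::metric_space \<Rightarrow> 'a measure set) \<Rightarrow> ('b::metric_space \<Rightarrow> 'b measure set) \<Rightarrow>
    ('a \<times> 'b \<Rightarrow> real) \<Rightarrow> ('a \<times> 'b \<Rightarrow> real) \<Rightarrow> 'a \<times> 'b \<Rightarrow> real" where
  "Val \<Gamma> \<Lambda> a f z = (SUP p\<in>\<Gamma> (fst z). INF q\<in>\<Lambda> (snd z). mext a p (return borel (snd z)) + mext f p q)"

locale two_houses =
  fixes \<Gamma> :: "'a::compact_metric_space \<Rightarrow> 'a measure set"
    and \<Lambda> :: "'b::compact_metric_space \<Rightarrow> 'b measure set"
  assumes \<Gamma>: "gambling_house \<Gamma>" and \<Lambda>: "gambling_house \<Lambda>"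
begin

lemma \<Gamma>_Delta: "p \<in> \<Gamma> x \<Longrightarrow> p \<in> Delta" and \<Lambda>_Delta: "q \<in> \<Lambda> y \<Longrightarrow> q \<in> Delta"
  by (rule houseD(1)[OF \<Gamma>], assumption) (rule houseD(1)[OF \<Lambda>])

lemma payoff_bounded:
  assumes "continuous_on UNIV a" "continuous_on UNIV f"
  shows "\<exists>B. \<forall>x y p q. p \<in> \<Gamma> x \<longrightarrow> q \<in> \<Lambda> y \<longrightarrow> \<bar>mext a p (return borel y) + mext f p q\<bar> \<le> B"
proof -
  obtain A where A: "a \<in> borel_measurable borel" "\<And>z. \<bar>a z\<bar> \<le> A"
    using continuous_bounded_measurable[OF assms(1)] by (rule bounded_measurableE) (rule that)
  obtain B where B: "f \<in> borel_measurable borel" "\<And>z. \<bar>f z\<bar> \<le> B"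
    using continuous_bounded_measurable[OF assms(2)] by (rule bounded_measurableE) (rule that)
  have "\<bar>mext a p (return borel y) + mext f p q\<bar> \<le> A + B" if "p \<in> \<Gamma> x" "q \<in> \<Lambda> y" for x y p q
    using mext_bounded[OF A \<Gamma>_Delta[OF that(1)] return_in_Delta, of y] mext_bounded[OF B \<Gamma>_Delta[OF that(1)] \<Lambda>_Delta[OF that(2)]]
    by linarith
  then show ?thesis by blast
qed

lemma INF_payoff_le:
  assumes "continuous_on UNIV a" "continuous_on UNIV f" "p \<in> \<Gamma> x" "q \<in> \<Lambda> y"
  shows "(INF q\<in>\<Lambda> y. mext a p (return borel y) + mext f p q) \<le> mext a p (return borel y) + mext f p q"
proof -
  obtain B where B: "\<forall>x y p q. p \<in> \<Gamma> x \<longrightarrow> q \<in> \<Lambda> y \<longrightarrow> \<bar>mext a p (return borel y) + mext f p q\<bar> \<le> B"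
    using payoff_bounded[OF assms(1,2)] by blast
  show ?thesis
  proof (rule cINF_lower[OF _ assms(4)], rule bdd_belowI2[where m="- B"])
    fix q assume "q \<in> \<Lambda> y"
    then have "\<bar>mext a p (return borel y) + mext f p q\<bar> \<le> B" using B assms(3) by blast
    then show "- B \<le> mext a p (return borel y) + mext f p q" by linarith
  qed
qed

lemma le_INF_payoff:
  assumes "\<And>q. q \<in> \<Lambda> y \<Longrightarrow> c \<le> mext a p (return borel y) + mext f p q"
  shows "c \<le> (INF q\<in>\<Lambda> y. mext a p (return borel y) + mext f p q)"
  using houseD(4)[OF \<Lambda>, of y] assms by (intro cINF_greatest) auto

lemma bdd_above_payoff:
  assumes "continuous_on UNIV a" "continuous_on UNIV f"
  shows "\<exists>B. \<forall>x y. \<forall>p\<in>\<Gamma> x. (INF q\<in>\<Lambda> y. mext a p (return borel y) + mext f p q) \<le> B"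
proof -
  obtain B where B: "\<forall>x y p q. p \<in> \<Gamma> x \<longrightarrow> q \<in> \<Lambda> y \<longrightarrow> \<bar>mext a p (return borel y) + mext f p q\<bar> \<le> B"
    using payoff_bounded[OF assms] by blast
  have "(INF q\<in>\<Lambda> y. mext a p (return borel y) + mext f p q) \<le> B" if p: "p \<in> \<Gamma> x" for x y p
  proof -
    have "\<bar>mext a p (return borel y) + mext f p (return borel y)\<bar> \<le> B"
      using B p houseD(4)[OF \<Lambda>, of y] by blast
    then show ?thesis using INF_payoff_le[OF assms p houseD(4)[OF \<Lambda>, of y]] by linarith
  qed
  then show ?thesis by blast
qed

lemma Val_ge:
  assumes cont: "continuous_on UNIV a" "continuous_on UNIV f" and p: "p \<in> \<Gamma> x"
    and "\<And>q. q \<in> \<Lambda> y \<Longrightarrow> c \<le> mext a p (return borel y) + mext f p q"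
  shows "c \<le> Val \<Gamma> \<Lambda> a f (x, y)"
proof -
  obtain B where B: "\<forall>x y. \<forall>p\<in>\<Gamma> x. (INF q\<in>\<Lambda> y. mext a p (return borel y) + mext f p q) \<le> B"
    using bdd_above_payoff[OF cont] by blast
  have "(INF q\<in>\<Lambda> y. mext a p (return borel y) + mext f p q) \<le> Val \<Gamma> \<Lambda> a f (x, y)"
    unfolding Val_def fst_conv snd_conv using B by (intro cSUP_upper[OF p] bdd_aboveI2[where M=B]) blast
  then show ?thesis using le_INF_payoff[OF assms(4)] by linarith
qed

text \<open>An infimum of continuous functions of \<open>p\<close> is upper semicontinuous and thus
  attains its maximum on the compact set \<open>\<Gamma> x\<close>. With \<open>Val_ge\<close> this
  forms the interface through which values are estimated.\<close>

lemma Val_optimal: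
  assumes cont: "continuous_on UNIV a" "continuous_on UNIV f"
  shows "\<exists>p\<in>\<Gamma> x. \<forall>q\<in>\<Lambda> y. Val \<Gamma> \<Lambda> a f (x, y) \<le> mext a p (return borel y) + mext f p q"
proof -
  let ?\<phi> = "\<lambda>p. INF q\<in>\<Lambda> y. mext a p (return borel y) + mext f p q"
  obtain B where B: "\<forall>x y. \<forall>p\<in>\<Gamma> x. (INF q\<in>\<Lambda> y. mext a p (return borel y) + mext f p q) \<le> B"
    using bdd_above_payoff[OF cont] by blast
  have ne: "\<Gamma> x \<noteq> {}" using houseD(4)[OF \<Gamma>] by blast
  have "\<exists>q\<in>\<Gamma> x. \<forall>p\<in>\<Gamma> x. ?\<phi> p \<le> ?\<phi> q"
  proof (rule attains_max_seq_compact[where d=dKR, OF ne])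
    show "?\<phi> p \<le> B" if "p \<in> \<Gamma> x" for p using B that by blast
    show "\<exists>q r. q \<in> \<Gamma> x \<and> strict_mono (r :: nat \<Rightarrow> nat) \<and> (\<lambda>n. dKR (p (r n)) q) \<longlonglongrightarrow> 0"
      if "\<And>n. p n \<in> \<Gamma> x" for p :: "nat \<Rightarrow> 'a measure"
      using house_seq_compact[OF \<Gamma> that] .
    fix p :: "nat \<Rightarrow> 'a measure" and p' c
    assume p: "\<And>n. p n \<in> \<Gamma> x" "p' \<in> \<Gamma> x" "(\<lambda>n. dKR (p n) p') \<longlonglongrightarrow> 0" and c: "\<And>n. c \<le> ?\<phi> (p n)"
    show "c \<le> ?\<phi> p'"
    proof (rule le_INF_payoff)
      fix q assume q: "q \<in> \<Lambda> y"
      have l0: "(\<lambda>n::nat. dKR r r) \<longlonglongrightarrow> 0" for r :: "'b measure" by simp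
      have l: "(\<lambda>n. mext a (p n) (return borel y) + mext f (p n) q) \<longlonglongrightarrow> mext a p' (return borel y) + mext f p' q"
        by (intro tendsto_add mext_tendsto cont p(3) l0 \<Gamma>_Delta[OF p(1)] \<Gamma>_Delta[OF p(2)] \<Lambda>_Delta[OF q] return_in_Delta)
      have "c \<le> mext a (p n) (return borel y) + mext f (p n) q" for n
        using c[of n] INF_payoff_le[OF cont p(1) q, of n] by linarith
      then show "c \<le> mext a p' (return borel y) + mext f p' q" by (intro LIMSEQ_le_const[OF l]) auto
    qed
  qed
  then obtain p where p: "p \<in> \<Gamma> x" "\<forall>p'\<in>\<Gamma> x. ?\<phi> p' \<le> ?\<phi> p" by blast
  have "Val \<Gamma> \<Lambda> a f (x, y) \<le> ?\<phi> p"
    unfolding Val_def fst_conv snd_conv using p(2) by (intro cSUP_least ne) blast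
  then have "\<forall>q\<in>\<Lambda> y. Val \<Gamma> \<Lambda> a f (x, y) \<le> mext a p (return borel y) + mext f p q"
    using INF_payoff_le[OF cont p(1)] by (meson order_trans)
  then show ?thesis using p(1) by blast
qed

text \<open>When \<open>x\<close> changes, an optimal move is copied to the new state; when
  \<open>y\<close> changes, the reply of the opponent is copied back to the old state.
  Non-expansiveness bounds both copies by the distance of the states, so constants add without
  growing, and for \<open>a = 0\<close> the value inherits the modulus of \<open>f\<close>.\<close>

lemma Val_osc2_le:
  assumes cont: "continuous_on UNIV a" "continuous_on UNIV f"
    and a: "osc2_le e C a" "C \<ge> 0" and f: "osc2_le e' C' f" "C' \<ge> 0"
  shows "osc2_le (e + e') (C + C') (Val \<Gamma> \<Lambda> a f)"
proof -
  note ab = continuous_bounded_measurable[OF cont(1)] and fb = continuous_bounded_measurable[OF cont(2)]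
  have X: "Val \<Gamma> \<Lambda> a f (x, y) \<le> Val \<Gamma> \<Lambda> a f (x', y) + ((e + e') + (C + C') * dist x x')" for x x' y
  proof -
    obtain p where p: "p \<in> \<Gamma> x" "\<forall>q\<in>\<Lambda> y. Val \<Gamma> \<Lambda> a f (x, y) \<le> mext a p (return borel y) + mext f p q"
      using Val_optimal[OF cont] by blast
    obtain p' where p': "p' \<in> \<Gamma> x'" "dKR p p' \<le> dist x x'" using houseD(5)[OF \<Gamma> p(1)] by blast
    have "Val \<Gamma> \<Lambda> a f (x, y) - ((e + e') + (C + C') * dist x x') \<le> Val \<Gamma> \<Lambda> a f (x', y)"
    proof (rule Val_ge[OF cont p'(1)])
      fix q assume q: "q \<in> \<Lambda> y"
      note D = \<Gamma>_Delta[OF p(1)] \<Gamma>_Delta[OF p'(1)]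
      have "C * dKR p p' \<le> C * dist x x'" "C' * dKR p p' \<le> C' * dist x x'"
        using p'(2) a(2) f(2) by (auto intro: mult_left_mono)
      then show "Val \<Gamma> \<Lambda> a f (x, y) - ((e + e') + (C + C') * dist x x') \<le> mext a p' (return borel y) + mext f p' q"
        using p(2)[rule_format, OF q] mext_diff_left[OF ab a D return_in_Delta, of y] mext_diff_left[OF fb f D \<Lambda>_Delta[OF q]]
        unfolding distrib_right by linarith
    qed
    then show ?thesis by linarith
  qed
  have Y: "Val \<Gamma> \<Lambda> a f (x, y) \<le> Val \<Gamma> \<Lambda> a f (x, y') + ((e + e') + (C + C') * dist y y')" for x y y'
  proof -
    obtain p where p: "p \<in> \<Gamma> x" "\<forall>q\<in>\<Lambda> y. Val \<Gamma> \<Lambda> a f (x, y) \<le> mext a p (return borel y) + mext f p q"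
      using Val_optimal[OF cont] by blast
    have "Val \<Gamma> \<Lambda> a f (x, y) - ((e + e') + (C + C') * dist y y') \<le> Val \<Gamma> \<Lambda> a f (x, y')"
    proof (rule Val_ge[OF cont p(1)])
      fix q' assume q': "q' \<in> \<Lambda> y'"
      obtain q where q: "q \<in> \<Lambda> y" "dKR q' q \<le> dist y' y" using houseD(5)[OF \<Lambda> q'] by blast
      have "C * dKR (return borel y) (return borel y') \<le> C * dist y y'" "C' * dKR q q' \<le> C' * dist y y'"
        using q(2) dKR_return_le[of y y'] a(2) f(2) by (auto intro!: mult_left_mono simp: dKR_commute dist_commute)
      then show "Val \<Gamma> \<Lambda> a f (x, y) - ((e + e') + (C + C') * dist y y') \<le> mext a p (return borel y') + mext f p q'"
        using p(2)[rule_format, OF q(1)] mext_diff_right[OF ab a \<Gamma>_Delta[OF p(1)] return_in_Delta return_in_Delta, of y y']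
          mext_diff_right[OF fb f \<Gamma>_Delta[OF p(1)] \<Lambda>_Delta[OF q(1)] \<Lambda>_Delta[OF q']]
        unfolding distrib_right by linarith
    qed
    then show ?thesis by linarith
  qed
  show ?thesis
    unfolding osc2_le_def osc_le_def
  proof (intro conjI allI)
    show "\<bar>Val \<Gamma> \<Lambda> a f (x, y) - Val \<Gamma> \<Lambda> a f (x', y)\<bar> \<le> (e + e') + (C + C') * dist x x'" for x x' y
      using X[of x y x'] X[of x' y x] by (simp add: dist_commute abs_le_iff)
    show "\<bar>Val \<Gamma> \<Lambda> a f (x, y) - Val \<Gamma> \<Lambda> a f (x, y')\<bar> \<le> (e + e') + (C + C') * dist y y'" for x y y'
      using Y[of x y y'] Y[of x y' y] by (simp add: dist_commute abs_le_iff)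
  qed
qed

lemma Val_continuous:
  assumes cont: "continuous_on UNIV a" "continuous_on UNIV f"
  shows "continuous_on UNIV (Val \<Gamma> \<Lambda> a f)"
proof (rule osc2_le_imp_continuous)
  fix e :: real assume "e > 0"
  then obtain C C' where "C \<ge> 0" "osc2_le (e / 2) C a" "C' \<ge> 0" "osc2_le (e / 2) C' f"
    using continuous_imp_osc2_le[OF cont(1), of "e / 2"] continuous_imp_osc2_le[OF cont(2), of "e / 2"] by auto
  then show "\<exists>C\<ge>0. osc2_le e C (Val \<Gamma> \<Lambda> a f)"
    using Val_osc2_le[OF cont, of "e / 2" C "e / 2" C'] by (intro exI[of _ "C + C'"]) auto
qed

text \<open>A relation that survives limits of states and moves cuts out of the house a
  correspondence to which \<open>measurable_selection\<close> applies. Optimal moves and adapted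
  moves for continuous data both have this form.\<close>

lemma closed_selection:
  assumes ne: "\<And>x y. \<exists>p\<in>\<Gamma> x. R p x y"
    and closed: "\<And>p p' x x' y y'. (\<And>n::nat. p n \<in> \<Gamma> (x n)) \<Longrightarrow> (\<And>n. R (p n) (x n) (y n)) \<Longrightarrow>
      x \<longlonglongrightarrow> x' \<Longrightarrow> y \<longlonglongrightarrow> y' \<Longrightarrow> p' \<in> \<Gamma> x' \<Longrightarrow> (\<lambda>n. dKR (p n) p') \<longlonglongrightarrow> 0 \<Longrightarrow> R p' x' y'"
  shows "\<exists>s. s \<in> borel \<rightarrow>\<^sub>M prob_algebra borel \<and> (\<forall>x y. s (x, y) \<in> \<Gamma> x \<and> R (s (x, y)) x (y::'b))"
proof -
  have "\<exists>s. s \<in> borel \<rightarrow>\<^sub>M prob_algebra borel \<and> (\<forall>z. s z \<in> {p \<in> \<Gamma> (fst z). R p (fst z) (snd z :: 'b)})"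
  proof (rule measurable_selection)
    show "{p \<in> \<Gamma> (fst z). R p (fst z) (snd z)} \<subseteq> Delta" for z using \<Gamma>_Delta by blast
    show "{p \<in> \<Gamma> (fst z). R p (fst z) (snd z)} \<noteq> {}" for z using ne by blast
    fix z :: "nat \<Rightarrow> 'a \<times> 'b" and p z'
    assume z: "z \<longlonglongrightarrow> z'" and p: "\<And>n. p n \<in> {p \<in> \<Gamma> (fst (z n)). R p (fst (z n)) (snd (z n))}"
    have p\<Gamma>: "p n \<in> \<Gamma> (fst (z n))" for n using p[of n] by simp
    obtain q and r :: "nat \<Rightarrow> nat" where q: "q \<in> \<Gamma> (fst z')" "strict_mono r" "(\<lambda>n. dKR (p (r n)) q) \<longlonglongrightarrow> 0"
      using house_upper_hemicontinuous[OF \<Gamma> tendsto_fst[OF z] p\<Gamma>] by (elim exE conjE)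
    have zr: "(\<lambda>n. z (r n)) \<longlonglongrightarrow> z'" using LIMSEQ_subseq_LIMSEQ[OF z q(2)] by (simp add: comp_def)
    have "R q (fst z') (snd z')"
    proof (rule closed[OF _ _ tendsto_fst[OF zr] tendsto_snd[OF zr] q(1,3)])
      show "p (r n) \<in> \<Gamma> (fst (z (r n)))" "R (p (r n)) (fst (z (r n))) (snd (z (r n)))" for n
        using p[of "r n"] by auto
    qed
    then show "\<exists>q r. q \<in> {p \<in> \<Gamma> (fst z'). R p (fst z') (snd z')} \<and> strict_mono (r :: nat \<Rightarrow> nat) \<and> (\<lambda>n. dKR (p (r n)) q) \<longlonglongrightarrow> 0"
      using q by blast
  qed
  then obtain s where s: "s \<in> borel \<rightarrow>\<^sub>M prob_algebra borel" "\<forall>z. s z \<in> {p \<in> \<Gamma> (fst z). R p (fst z) (snd z)}"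
    by (elim exE conjE)
  have "s (x, y) \<in> \<Gamma> x \<and> R (s (x, y)) x y" for x y using spec[OF s(2), of "(x, y)"] by simp
  then show ?thesis using s(1) by blast
qed

lemma return_tendsto: "y \<longlonglongrightarrow> y' \<Longrightarrow> (\<lambda>n. dKR (return borel (y n)) (return borel (y' :: 'b))) \<longlonglongrightarrow> 0"
  by (rule tendsto_sandwich[OF _ _ tendsto_const iffD1[OF tendsto_dist_iff]])
    (auto simp: dKR_nonneg dKR_return_le)

lemma Val_selection:
  assumes cont: "continuous_on UNIV a" "continuous_on UNIV f"
  shows "\<exists>s. s \<in> borel \<rightarrow>\<^sub>M prob_algebra borel \<and> (\<forall>x y. s (x, y) \<in> \<Gamma> x \<and>
    (\<forall>q\<in>\<Lambda> y. Val \<Gamma> \<Lambda> a f (x, y) \<le> mext a (s (x, y)) (return borel y) + mext f (s (x, y)) q))"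
proof (rule closed_selection)
  show "\<exists>p\<in>\<Gamma> x. \<forall>q\<in>\<Lambda> y. Val \<Gamma> \<Lambda> a f (x, y) \<le> mext a p (return borel y) + mext f p q" for x y
    by (rule Val_optimal[OF cont])
  fix p :: "nat \<Rightarrow> 'a measure" and p' x x' y y'
  assume p: "\<And>n. p n \<in> \<Gamma> (x n)"
    and opt: "\<And>n. \<forall>q\<in>\<Lambda> (y n). Val \<Gamma> \<Lambda> a f (x n, y n) \<le> mext a (p n) (return borel (y n)) + mext f (p n) q"
    and lim: "x \<longlonglongrightarrow> x'" "y \<longlonglongrightarrow> y'" "p' \<in> \<Gamma> x'" "(\<lambda>n. dKR (p n) p') \<longlonglongrightarrow> 0"
  show "\<forall>q\<in>\<Lambda> y'. Val \<Gamma> \<Lambda> a f (x', y') \<le> mext a p' (return borel y') + mext f p' q"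
  proof
    fix q assume q: "q \<in> \<Lambda> y'"
    \<comment> \<open>Optimality of \<open>p n\<close> concerns replies at \<open>y n\<close> only,
      so the reply \<open>q\<close> at the limit state is first carried to
      \<open>\<Lambda> (y n)\<close>.\<close>
    have "\<exists>q'. q' \<in> \<Lambda> (y n) \<and> dKR q' q \<le> dist (y n) y'" for n
      using houseD(5)[OF \<Lambda> q, of "y n"] by (metis dKR_commute dist_commute)
    then obtain q' where q': "\<And>n. q' n \<in> \<Lambda> (y n)" "\<And>n. dKR (q' n) q \<le> dist (y n) y'" by metis
    have q'lim: "(\<lambda>n. dKR (q' n) q) \<longlonglongrightarrow> 0"
      by (rule tendsto_sandwich[OF _ _ tendsto_const iffD1[OF tendsto_dist_iff lim(2)]])
        (simp_all add: dKR_nonneg q'(2))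
    have "(\<lambda>n. mext a (p n) (return borel (y n)) + mext f (p n) (q' n)) \<longlonglongrightarrow> mext a p' (return borel y') + mext f p' q"
      by (intro tendsto_add mext_tendsto cont lim(4) q'lim return_tendsto[OF lim(2)] \<Gamma>_Delta[OF p] \<Gamma>_Delta[OF lim(3)]
          \<Lambda>_Delta[OF q'(1)] \<Lambda>_Delta[OF q] return_in_Delta)
    moreover have "(\<lambda>n. Val \<Gamma> \<Lambda> a f (x n, y n)) \<longlonglongrightarrow> Val \<Gamma> \<Lambda> a f (x', y')"
      using continuous_on_tendsto_compose[OF Val_continuous[OF cont] tendsto_Pair[OF lim(1,2)]] by simp
    ultimately show "Val \<Gamma> \<Lambda> a f (x', y') \<le> mext a p' (return borel y') + mext f p' q"
      using opt q'(1) by (intro LIMSEQ_le) auto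
  qed
qed

text \<open>This is the equality of sup inf and inf sup, phrased so that player 2 becomes the
  maximizer of the game with payoff \<open>- f\<close>. One inequality pairs two optimal moves; the
  other applies \<open>finite_minimax\<close> to a finite net of \<open>\<Gamma> x\<close>.\<close>

lemma Val_swap:
  assumes f: "continuous_on UNIV f"
  shows "Val \<Lambda> \<Gamma> (\<lambda>_. 0) (\<lambda>z. - f (snd z, fst z)) (y, x) = - Val \<Gamma> \<Lambda> (\<lambda>_. 0) f (x, y)"
proof -
  interpret S: two_houses \<Lambda> \<Gamma> by unfold_locales (rule \<Lambda> \<Gamma>)+
  let ?f = "\<lambda>z. - f (snd z, fst z)"
  have c0: "continuous_on UNIV (\<lambda>_. 0 :: real)" by simp
  have fc: "continuous_on UNIV ?f"
    by (intro continuous_intros continuous_on_compose2[OF f]) auto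
  note fb = continuous_bounded_measurable[OF f]
  have sw: "mext ?f q p = - mext f p q" if "p \<in> \<Gamma> x" "q \<in> \<Lambda> y" for p q
    using mext_swap[OF fb \<Gamma>_Delta[OF that(1)] \<Lambda>_Delta[OF that(2)], of "-1"] by simp
  let ?V = "Val \<Gamma> \<Lambda> (\<lambda>_. 0) f (x, y)" and ?W = "Val \<Lambda> \<Gamma> (\<lambda>_. 0) ?f (y, x)"
  have "?V \<le> - ?W"
  proof -
    obtain p where p: "p \<in> \<Gamma> x" "\<forall>q\<in>\<Lambda> y. ?V \<le> mext f p q" using Val_optimal[OF c0 f, of x y] by auto
    obtain q where q: "q \<in> \<Lambda> y" "\<forall>p\<in>\<Gamma> x. ?W \<le> mext ?f q p" using S.Val_optimal[OF c0 fc, of y x] by auto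
    show ?thesis using p(2)[rule_format, OF q(1)] q(2)[rule_format, OF p(1)] sw[OF p(1) q(1)] by linarith
  qed
  moreover have "- ?W \<le> ?V"
  proof (rule field_le_epsilon)
    fix e :: real assume e: "e > 0"
    \<comment> \<open>Half of \<open>e\<close> pays for a nearly best answer to \<open>q\<close>, a
      quarter for the modulus of \<open>f\<close> and a quarter for replacing that answer by a point
      of the net.\<close>
    then obtain C where C: "C \<ge> 0" "osc2_le (e / 4) C f" using continuous_imp_osc2_le[OF f, of "e / 4"] by auto
    have "e / (4 * (C + 1)) > 0" using e C(1) by simp
    from house_finite_net[OF \<Gamma> this, of x] obtain P where
      P: "finite P" "P \<subseteq> \<Gamma> x" "\<forall>p\<in>\<Gamma> x. \<exists>k\<in>P. dKR k p < e / (4 * (C + 1))"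
      by (elim exE conjE)
    have "P \<noteq> {}" using P(3) houseD(4)[OF \<Gamma>, of x] by blast
    moreover have "\<exists>p\<in>P. - ?W - e \<le> mext f p q" if q: "q \<in> \<Lambda> y" for q
    proof -
      have "\<exists>p\<in>\<Gamma> x. - ?W - e / 2 < mext f p q"
      proof (rule ccontr)
        assume *: "\<not> ?thesis"
        have "?W + e / 2 \<le> ?W"
        proof (rule S.Val_ge[OF c0 fc q])
          fix p assume p: "p \<in> \<Gamma> x"
          then have "mext f p q \<le> - ?W - e / 2" using * by (meson not_le)
          then show "?W + e / 2 \<le> mext (\<lambda>_. 0) q (return borel x) + mext ?f q p" using sw[OF p q] by simp
        qed
        then show False using e by simp
      qed
      then obtain p where p: "p \<in> \<Gamma> x" "- ?W - e / 2 < mext f p q" by blast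
      then obtain k where k: "k \<in> P" "dKR k p < e / (4 * (C + 1))" using P(3) by blast
      have "C * dKR k p \<le> (C + 1) * (e / (4 * (C + 1)))"
        using k(2) C(1) dKR_nonneg[of k p] by (intro mult_mono) auto
      also have "\<dots> = e / 4" using C(1) by (simp add: field_simps)
      finally have "- ?W - e \<le> mext f k q"
        using mext_diff_left[OF fb C(2,1) \<Gamma>_Delta[of k x] \<Gamma>_Delta[OF p(1)] \<Lambda>_Delta[OF q]] k(1) P(2) p(2) by (auto simp: abs_le_iff)
      then show ?thesis using k(1) by blast
    qed
    ultimately have "\<exists>p\<in>\<Gamma> x. \<forall>q\<in>\<Lambda> y. - ?W - e \<le> mext f p q"
      using P \<Gamma>_Delta \<Lambda>_Delta by (intro finite_minimax[OF houseD(2)[OF \<Gamma>] _ fb P(1) _ P(2) houseD(2)[OF \<Lambda>]]) auto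
    then obtain p where p: "p \<in> \<Gamma> x" "\<forall>q\<in>\<Lambda> y. - ?W - e \<le> mext f p q" by blast
    have "- ?W - e \<le> ?V" using p(2) by (intro Val_ge[OF c0 f p(1)]) simp
    then show "- ?W \<le> ?V + e" by linarith
  qed
  ultimately show ?thesis by linarith
qed

text \<open>Idempotence: composing a first move \<open>p\<close> with an optimal kernel is again a single move.\<close>

lemma Val_superharmonic:
  assumes id: "idempotent \<Gamma>" and f: "continuous_on UNIV f" and p: "p \<in> \<Gamma> x"
  shows "mext (Val \<Gamma> \<Lambda> (\<lambda>_. 0) f) p (return borel y) \<le> Val \<Gamma> \<Lambda> (\<lambda>_. 0) f (x, y)"
proof -
  have c0: "continuous_on UNIV (\<lambda>_. 0 :: real)" by simp
  let ?V = "Val \<Gamma> \<Lambda> (\<lambda>_. 0) f"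
  note Vb = continuous_bounded_measurable[OF Val_continuous[OF c0 f]] and fb = continuous_bounded_measurable[OF f]
  have pD: "p \<in> Delta" by (rule \<Gamma>_Delta[OF p])
  interpret prob_space p using pD by (rule DeltaD)
  obtain s where s: "s \<in> borel \<rightarrow>\<^sub>M prob_algebra borel" "\<forall>x y. s (x, y) \<in> \<Gamma> x \<and>
    (\<forall>q\<in>\<Lambda> y. ?V (x, y) \<le> mext (\<lambda>_. 0) (s (x, y)) (return borel y) + mext f (s (x, y)) q)"
    using Val_selection[OF c0 f] by (elim exE conjE)
  have "(\<lambda>x'. (x', y)) \<in> borel \<rightarrow>\<^sub>M borel" by (intro borel_measurable_continuous_onI continuous_intros)
  from measurable_compose[OF this s(1)] have "(\<lambda>x'. s (x', y)) \<in> borel \<rightarrow>\<^sub>M prob_algebra borel" .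
  then have S: "(\<lambda>x'. s (x', y)) \<in> p \<rightarrow>\<^sub>M prob_algebra borel"
    by (subst measurable_cong_sets[OF DeltaD(2)[OF pD] refl])
  have idm: "(\<lambda>x. x) \<in> p \<rightarrow>\<^sub>M borel"
    by (subst measurable_cong_sets[OF DeltaD(2)[OF pD] refl]) simp
  have "distr p borel (\<lambda>x. x) = p" using distr_cong[OF refl DeltaD(2)[OF pD, symmetric]] distr_id2[OF DeltaD(2)[OF pD, symmetric]] by metis
  then have "p \<bind> (\<lambda>x'. s (x', y)) \<in> lift \<Gamma> p"
    using bind_mem_lift[OF prob_space_axioms idm S, of \<Gamma>] s(2) by simp
  then have P: "p \<bind> (\<lambda>x'. s (x', y)) \<in> \<Gamma> x" using id p unfolding idempotent_def by blast
  show ?thesis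
  proof (rule Val_ge[OF c0 f P])
    \<comment> \<open>The coordinate \<open>y\<close> is frozen while \<open>x\<close> moves, so one
      reply \<open>q\<close> faces all kernel values \<open>s (x', y)\<close>, each of which is
      optimal against it.\<close>
    fix q assume q: "q \<in> \<Lambda> y"
    have "mext ?V p (return borel y) = (\<integral>x'. ?V (x', y) \<partial>p)" by (rule mext_return_right[OF Vb pD])
    also have "\<dots> \<le> (\<integral>x'. mext f (s (x', y)) q \<partial>p)"
    proof (rule integral_mono)
      show "integrable p (\<lambda>x'. ?V (x', y))"
        by (rule integrable_bounded_measurable[OF pD sections_bounded_measurable(1)[OF Vb]])
      obtain B where B: "f \<in> borel_measurable borel" "\<And>z. \<bar>f z\<bar> \<le> B" using fb by (rule bounded_measurableE) (rule that)
      obtain B' where B': "(\<lambda>x. \<integral>y. f (x, y) \<partial>q) \<in> borel_measurable borel"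
        using partial_integral_bounded_measurable(2)[OF fb \<Lambda>_Delta[OF q]] by (rule bounded_measurableE) (rule that)
      have sD: "s (x', y) \<in> Delta" for x' using s(2) \<Gamma>_Delta by blast
      have "(\<lambda>x'. mext f (s (x', y)) q) \<in> borel_measurable p"
        unfolding mext_Fubini(1)[OF fb sD \<Lambda>_Delta[OF q]] by (rule measurable_integral_kernel[OF S B'])
      then show "integrable p (\<lambda>x'. mext f (s (x', y)) q)"
        using mext_bounded[OF B sD \<Lambda>_Delta[OF q]] by (rule integral_bounds_const(1)[OF prob_space_axioms])
      show "?V (x', y) \<le> mext f (s (x', y)) q" for x' using s(2) q by simp
    qed
    also have "\<dots> = mext f (p \<bind> (\<lambda>x'. s (x', y))) q"
      by (rule mext_bind_left[OF fb prob_space_axioms S \<Lambda>_Delta[OF q], symmetric])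
    finally show "mext ?V p (return borel y) \<le>
      mext (\<lambda>_. 0) (p \<bind> (\<lambda>x'. s (x', y))) (return borel y) + mext f (p \<bind> (\<lambda>x'. s (x', y))) q" by simp
  qed
qed

end

section \<open>Discounted values and their limit\<close>

lemma mext_le_add:
  fixes f :: "'a::second_countable_topology \<times> 'b::second_countable_topology \<Rightarrow> real"
  assumes f: "f \<in> bounded_measurable" and g: "g \<in> bounded_measurable" and le: "\<And>z. f z \<le> g z + c"
    and p: "p \<in> Delta" and q: "q \<in> Delta"
  shows "mext f p q \<le> mext g p q + c"
proof -
  have one: "(\<lambda>_. 1) \<in> bounded_measurable" by (rule bounded_measurableI[of _ 1]) auto
  obtain B where B: "g \<in> borel_measurable borel" "\<And>z. \<bar>g z\<bar> \<le> B" using g by (rule bounded_measurableE) (rule that)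
  have gc: "(\<lambda>z. 1 * g z + c * 1) \<in> bounded_measurable"
    using B by (intro bounded_measurableI[of _ "B + \<bar>c\<bar>"]) (auto intro: order_trans[OF abs_triangle_ineq] add_mono)
  have "mext f p q \<le> mext (\<lambda>z. 1 * g z + c * 1) p q" using le by (intro mext_mono f gc p q) simp
  also have "\<dots> = mext g p q + c * mext (\<lambda>_. 1) p q" using mext_lincomb[OF g one p q, of 1 c] by simp
  also have "mext (\<lambda>_. 1) p q = 1"
    using mext_const_right[OF q, of "\<lambda>_. 1" p] prob_space.prob_space[OF DeltaD(1)[OF p]] by simp
  finally show ?thesis by simp
qed

lemma continuous_swap:
  assumes "continuous_on UNIV (f :: 'a::topological_space \<times> 'b::topological_space \<Rightarrow> real)"
  shows "continuous_on UNIV (\<lambda>z. - f (snd z, fst z))"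
  by (intro continuous_intros continuous_on_compose2[OF assms]) auto

lemma osc2_le_convex:
  assumes "osc2_le e C f" "osc2_le e C g" "0 \<le> l" "l \<le> (1::real)"
  shows "osc2_le e C (\<lambda>z. l * f z + (1 - l) * g z)"
proof -
  have *: "\<bar>(l * a + (1 - l) * b) - (l * a' + (1 - l) * b')\<bar> \<le> D" if "\<bar>a - a'\<bar> \<le> D" "\<bar>b - b'\<bar> \<le> D" for a b a' b' D :: real
  proof -
    have "(l * a + (1 - l) * b) - (l * a' + (1 - l) * b') = l * (a - a') + (1 - l) * (b - b')" by (simp add: algebra_simps)
    also have "\<bar>\<dots>\<bar> \<le> l * \<bar>a - a'\<bar> + (1 - l) * \<bar>b - b'\<bar>"
      using assms(3,4) abs_triangle_ineq[of "l * (a - a')" "(1 - l) * (b - b')"] by (simp add: abs_mult)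
    also have "\<dots> \<le> D" using that assms(3,4) by (intro convex_bound_le) auto
    finally show ?thesis .
  qed
  show ?thesis using assms(1,2) unfolding osc2_le_def osc_le_def by (intro conjI allI *) auto
qed

section \<open>Fixed points of the discounted operator in an equicontinuous class\<close>

context two_houses
begin

text \<open>Applied in both directions, this makes the operator 1-Lipschitz in the sup norm, so
  weighting the continuation by \<open>1 - l\<close> gives a contraction.\<close>

lemma Val_le_add:
  assumes f: "continuous_on UNIV f" and g: "continuous_on UNIV g" and le: "\<And>z. f z \<le> g z + c"
  shows "Val \<Gamma> \<Lambda> (\<lambda>_. 0) f z \<le> Val \<Gamma> \<Lambda> (\<lambda>_. 0) g z + c"
proof -
  obtain x y where z: "z = (x, y)" by (cases z)
  have c0: "continuous_on UNIV (\<lambda>_. 0 :: real)" by simp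
  obtain p where p: "p \<in> \<Gamma> x" "\<forall>q\<in>\<Lambda> y. Val \<Gamma> \<Lambda> (\<lambda>_. 0) f (x, y) \<le> mext (\<lambda>_. 0) p (return borel y) + mext f p q"
    using Val_optimal[OF c0 f, of x y] by blast
  have "Val \<Gamma> \<Lambda> (\<lambda>_. 0) f (x, y) - c \<le> Val \<Gamma> \<Lambda> (\<lambda>_. 0) g (x, y)"
  proof (rule Val_ge[OF c0 g p(1)])
    fix q assume q: "q \<in> \<Lambda> y"
    show "Val \<Gamma> \<Lambda> (\<lambda>_. 0) f (x, y) - c \<le> mext (\<lambda>_. 0) p (return borel y) + mext g p q"
      using p(2)[rule_format, OF q]
        mext_le_add[OF continuous_bounded_measurable[OF f] continuous_bounded_measurable[OF g] le \<Gamma>_Delta[OF p(1)] \<Lambda>_Delta[OF q]]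
      by linarith
  qed
  then show ?thesis by (simp add: z)
qed

lemma Val_bounded:
  assumes f: "continuous_on UNIV f" and B: "\<And>z. \<bar>f z\<bar> \<le> B"
  shows "\<bar>Val \<Gamma> \<Lambda> (\<lambda>_. 0) f z\<bar> \<le> B"
proof -
  obtain x y where z: "z = (x, y)" by (cases z)
  have c0: "continuous_on UNIV (\<lambda>_. 0 :: real)" by simp
  note fm = borel_measurable_continuous_onI[OF f]
  have "- B \<le> Val \<Gamma> \<Lambda> (\<lambda>_. 0) f (x, y)"
  proof (rule Val_ge[OF c0 f houseD(4)[OF \<Gamma>]])
    fix q assume "q \<in> \<Lambda> y"
    from mext_bounded[OF fm B return_in_Delta \<Lambda>_Delta[OF this], of x]
    show "- B \<le> mext (\<lambda>_. 0) (return borel x) (return borel y) + mext f (return borel x) q" by simp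
  qed
  moreover obtain p where p: "p \<in> \<Gamma> x" "\<forall>q\<in>\<Lambda> y. Val \<Gamma> \<Lambda> (\<lambda>_. 0) f (x, y) \<le> mext (\<lambda>_. 0) p (return borel y) + mext f p q"
    using Val_optimal[OF c0 f, of x y] by blast
  then have "Val \<Gamma> \<Lambda> (\<lambda>_. 0) f (x, y) \<le> B"
    using mext_bounded[OF fm B \<Gamma>_Delta[OF p(1)] return_in_Delta, of y] p(2)[rule_format, OF houseD(4)[OF \<Lambda>]] by simp
  ultimately show ?thesis by (simp add: z)
qed

text \<open>Demanding every modulus of \<open>u\<close>, not one chosen pair, makes the class
  equicontinuous even when \<open>u\<close> is not Lipschitz. Neither clause involves the discount
  factor, so all discounted values lie in the same compact set.\<close>

definition admissible :: "('a \<times> 'b \<Rightarrow> real) \<Rightarrow> real \<Rightarrow> (('a \<times> 'b) \<Rightarrow>\<^sub>C real) set" where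
  "admissible u B = {f. (\<forall>z. \<bar>apply_bcontfun f z\<bar> \<le> B) \<and>
     (\<forall>e C. C \<ge> 0 \<longrightarrow> osc2_le e C u \<longrightarrow> osc2_le e C (apply_bcontfun f))}"

lemma admissibleD:
  assumes "f \<in> admissible u B"
  shows "\<bar>apply_bcontfun f z\<bar> \<le> B" "C \<ge> 0 \<Longrightarrow> osc2_le e C u \<Longrightarrow> osc2_le e C (apply_bcontfun f)"
proof -
  have *: "(\<forall>z. \<bar>apply_bcontfun f z\<bar> \<le> B) \<and> (\<forall>e C. C \<ge> 0 \<longrightarrow> osc2_le e C u \<longrightarrow> osc2_le e C (apply_bcontfun f))"
    using assms unfolding admissible_def by (rule CollectD)
  show "\<bar>apply_bcontfun f z\<bar> \<le> B" by (rule conjunct1[OF *, rule_format])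
  show "osc2_le e C (apply_bcontfun f)" if "C \<ge> 0" "osc2_le e C u"
    by (rule mp[OF mp[OF spec[OF spec[OF conjunct2[OF *], of e], of C] that(1)] that(2)])
qed

text \<open>Both clauses are inequalities between finitely many values of the function, hence closed
  under pointwise and so under uniform limits.\<close>

lemma complete_admissible: "Topological_Spaces.complete (admissible u B)"
proof (rule complete_eq_closed[THEN iffD2])
  show "closed (admissible u B)"
    unfolding closed_sequential_limits
  proof (intro allI impI, elim conjE)
    fix F :: "nat \<Rightarrow> ('a \<times> 'b) \<Rightarrow>\<^sub>C real" and f
    assume F: "\<forall>n. F n \<in> admissible u B" and lim: "F \<longlonglongrightarrow> f"
    have pt: "(\<lambda>n. apply_bcontfun (F n) z) \<longlonglongrightarrow> apply_bcontfun f z" for z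
    proof -
      have "(\<lambda>n. dist (apply_bcontfun (F n) z) (apply_bcontfun f z)) \<longlonglongrightarrow> 0"
        by (rule tendsto_sandwich[OF _ _ tendsto_const iffD1[OF tendsto_dist_iff lim]]) (simp_all add: dist_bounded)
      then show ?thesis by (rule iffD2[OF tendsto_dist_iff])
    qed
    have "\<bar>apply_bcontfun f z\<bar> \<le> B" for z
      by (rule LIMSEQ_le_const2[OF tendsto_rabs[OF pt]]) (use admissibleD(1)[OF spec[OF F]] in blast)
    moreover have "osc2_le e C (apply_bcontfun f)" if "C \<ge> 0" "osc2_le e C u" for e C
    proof -
      have osc: "osc2_le e C (apply_bcontfun (F n))" for n using F that unfolding admissible_def by blast
      have "\<bar>apply_bcontfun f z - apply_bcontfun f z'\<bar> \<le> D"
        if "\<And>n. \<bar>apply_bcontfun (F n) z - apply_bcontfun (F n) z'\<bar> \<le> D" for z z' D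
        by (rule LIMSEQ_le_const2[OF tendsto_rabs[OF tendsto_diff[OF pt pt]]]) (use that in auto)
      then show ?thesis using osc unfolding osc2_le_def osc_le_def by blast
    qed
    ultimately show "f \<in> admissible u B" unfolding admissible_def by blast
  qed
qed

lemma compact_admissible:
  assumes u: "continuous_on UNIV u"
  shows "compact (admissible u B)"
  unfolding compact_eq_totally_bounded
proof (intro conjI complete_admissible allI impI)
  fix e :: real assume e: "e > 0"
  have "\<exists>G. finite G \<and> G \<subseteq> apply_bcontfun ` admissible u B \<and>
    (\<forall>f\<in>apply_bcontfun ` admissible u B. \<exists>g\<in>G. \<forall>z. \<bar>f z - g z\<bar> < e / 2)"
  proof (rule finite_net_equicontinuous[OF compact_UNIV_prod])
    show "\<bar>f z\<bar> \<le> B" if "f \<in> apply_bcontfun ` admissible u B" for f z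
      using that admissibleD(1) by blast
    fix e' :: real assume e': "e' > 0"
    then obtain C where C: "C \<ge> 0" "osc2_le (e' / 4) C u" using continuous_imp_osc2_le[OF u, of "e' / 4"] by auto
    define d where "d = e' / (4 * (C + 1))"
    have d: "d > 0" "(C + 1) * d = e' / 4" using e' C(1) by (simp_all add: d_def field_simps)
    have "\<bar>apply_bcontfun f z - apply_bcontfun f z'\<bar> < e'"
      if f: "f \<in> admissible u B" and z: "dist z z' < d" for f z z'
    proof -
      have "C * dist z z' \<le> C * d" using z C(1) by (intro mult_left_mono) auto
      then have "C * dist z z' < e' / 4" using d by (simp add: algebra_simps)
      moreover have "osc2_le (e' / 4) C (apply_bcontfun f)" using f C unfolding admissible_def by blast
      ultimately show ?thesis using osc2_le_diff[of "e' / 4" C _ z z'] C(1) by fastforce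
    qed
    then show "\<exists>d>0. \<forall>f\<in>apply_bcontfun ` admissible u B. \<forall>z z'. dist z z' < d \<longrightarrow> \<bar>f z - f z'\<bar> < e'"
      using d(1) by blast
  qed (use e in simp)
  then obtain G where G: "finite G" "G \<subseteq> apply_bcontfun ` admissible u B"
    "\<forall>f\<in>apply_bcontfun ` admissible u B. \<exists>g\<in>G. \<forall>z. \<bar>f z - g z\<bar> < e / 2" by (elim exE conjE)
  have "f \<in> (\<Union>g\<in>Bcontfun ` G. ball g e)" if f: "f \<in> admissible u B" for f
  proof -
    obtain g where g: "g \<in> G" "\<forall>z. \<bar>apply_bcontfun f z - g z\<bar> < e / 2" using G(3) f by blast
    obtain h where h: "g = apply_bcontfun h" using g(1) G(2) by blast
    have "dist h f \<le> e / 2"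
    proof (rule dist_bound)
      show "dist (apply_bcontfun h z) (apply_bcontfun f z) \<le> e / 2" for z
        using spec[OF g(2), of z] unfolding h dist_real_def by linarith
    qed
    moreover have "Bcontfun g = h" by (simp add: h apply_bcontfun_inverse)
    ultimately show ?thesis using g(1) e by (intro UN_I[of h]) auto
  qed
  then show "\<exists>k. finite k \<and> admissible u B \<subseteq> (\<Union>g\<in>k. ball g e)" using G(1) by blast
qed

text \<open>The stage payoff is collected at the new pair of states, together with the continuation;
  it enters through the second payoff argument and the mixed-time argument is 0, as
  \<open>Val_swap\<close> and \<open>Val_superharmonic\<close> require.\<close>

definition discounted_value :: "('a \<times> 'b \<Rightarrow> real) \<Rightarrow> real \<Rightarrow> ('a \<times> 'b \<Rightarrow> real) \<Rightarrow> bool" where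
  "discounted_value u l f \<longleftrightarrow> continuous_on UNIV f \<and> f = Val \<Gamma> \<Lambda> (\<lambda>_. 0) (\<lambda>z. l * u z + (1 - l) * f z)"

text \<open>Banach's fixed point theorem with contraction factor \<open>1 - l\<close>: the bound and
  the moduli of \<open>u\<close> pass through the convex combination with weight \<open>l\<close>
  and then through the value operator, so the class is mapped into itself.\<close>

lemma discounted_value_exists:
  assumes u: "continuous_on UNIV u" "\<And>z. \<bar>u z\<bar> \<le> B" and l: "0 < l" "l < 1"
  shows "\<exists>f\<in>admissible u B. discounted_value u l (apply_bcontfun f)"
proof -
  have c0: "continuous_on UNIV (\<lambda>_. 0 :: real)" by simp
  define g where "g f z = l * u z + (1 - l) * apply_bcontfun f z" for f z
  have g: "continuous_on UNIV (g f)" for f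
    unfolding g_def by (intro continuous_intros u(1) continuous_on_apply_bcontfun)
  define T where "T f = Bcontfun (Val \<Gamma> \<Lambda> (\<lambda>_. 0) (g f))" for f
  have T: "apply_bcontfun (T f) = Val \<Gamma> \<Lambda> (\<lambda>_. 0) (g f)" for f
  proof -
    have c: "continuous_on UNIV (Val \<Gamma> \<Lambda> (\<lambda>_. 0) (g f))" by (rule Val_continuous[OF c0 g])
    have "bounded (range (Val \<Gamma> \<Lambda> (\<lambda>_. 0) (g f)))"
      using compact_imp_bounded[OF compact_continuous_image[OF c compact_UNIV_prod]] .
    with c show ?thesis unfolding T_def by (intro Bcontfun_inverse) (simp add: bcontfun_def)
  qed
  have "\<exists>!f\<in>admissible u B. T f = f"
  proof (rule Banach_fix[OF complete_admissible])
    have "Bcontfun u \<in> admissible u B"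
    proof -
      have "u \<in> bcontfun" using u by (intro bcontfun_normI[of _ B]) auto
      then show ?thesis using u(2) by (simp add: admissible_def Bcontfun_inverse)
    qed
    then show "admissible u B \<noteq> {}" by blast
    show "T ` admissible u B \<subseteq> admissible u B"
    proof
      fix f' assume "f' \<in> T ` admissible u B"
      then obtain f where f: "f \<in> admissible u B" "f' = T f" by blast
      have gB: "\<bar>g f z\<bar> \<le> B" for z
      proof -
        have "\<bar>g f z\<bar> \<le> l * \<bar>u z\<bar> + (1 - l) * \<bar>apply_bcontfun f z\<bar>"
          unfolding g_def using l abs_triangle_ineq[of "l * u z" "(1 - l) * apply_bcontfun f z"] by (simp add: abs_mult)
        also have "\<dots> \<le> B" using u(2)[of z] admissibleD(1)[OF f(1), of z] l by (intro convex_bound_le) auto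
        finally show ?thesis .
      qed
      have "osc2_le e C (Val \<Gamma> \<Lambda> (\<lambda>_. 0) (g f))" if C: "C \<ge> 0" "osc2_le e C u" for e C
      proof -
        have "osc2_le e C (apply_bcontfun f)" using f(1) C unfolding admissible_def by blast
        then have "osc2_le e C (g f)" unfolding g_def using l by (intro osc2_le_convex C(2)) auto
        moreover have "osc2_le 0 0 (\<lambda>_. 0)" by (simp add: osc2_le_def osc_le_def)
        ultimately show ?thesis using Val_osc2_le[OF c0 g, of 0 0 e C] C(1) by simp
      qed
      then show "f' \<in> admissible u B" using Val_bounded[OF g gB] by (simp add: admissible_def T f(2))
    qed
    show "dist (T f) (T f') \<le> (1 - l) * dist f f'" if "f \<in> admissible u B" "f' \<in> admissible u B" for f f'
    proof (rule dist_bound)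
      fix z
      have le: "g h z \<le> g h' z + (1 - l) * dist h h'" for h h' z
      proof -
        have "apply_bcontfun h z - apply_bcontfun h' z \<le> dist h h'"
          using dist_bounded[of h z h'] by (simp add: dist_real_def)
        then have "(1 - l) * (apply_bcontfun h z - apply_bcontfun h' z) \<le> (1 - l) * dist h h'"
          using l by (intro mult_left_mono) auto
        then show ?thesis by (simp add: g_def right_diff_distrib)
      qed
      show "dist (apply_bcontfun (T f) z) (apply_bcontfun (T f') z) \<le> (1 - l) * dist f f'"
        using Val_le_add[OF g[of f] g[of f'] le, of z] Val_le_add[OF g[of f'] g[of f] le, of z]
        by (simp add: T dist_real_def dist_commute[of f'] abs_le_iff)
    qed
  qed (use l in auto)
  then obtain f where f: "f \<in> admissible u B" "T f = f" by blast
  have "discounted_value u l (apply_bcontfun f)"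
    unfolding discounted_value_def using T[of f] f(2) by (simp add: g_def[abs_def])
  then show ?thesis using f(1) by blast
qed

section \<open>Vanishing discount\<close>

definition limit_value :: "('a \<times> 'b \<Rightarrow> real) \<Rightarrow> ('a \<times> 'b \<Rightarrow> real) \<Rightarrow> bool" where
  "limit_value u v \<longleftrightarrow> continuous_on UNIV v \<and>
     (\<forall>e>0. \<exists>l f. 0 < l \<and> l < e \<and> l < 1 \<and> discounted_value u l f \<and> (\<forall>z. \<bar>f z - v z\<bar> \<le> e))"

lemma limit_value_exists:
  assumes u: "continuous_on UNIV u"
  shows "\<exists>v. limit_value u v"
proof -
  obtain B where B: "\<And>z. \<bar>u z\<bar> \<le> B" using continuous_bounded_measurable[OF u] by (rule bounded_measurableE) (rule that)
  \<comment> \<open>Adding 2 keeps the factor strictly below 1 from \<open>k = 0\<close> on.\<close>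
  define l where "l k = 1 / (real k + 2)" for k :: nat
  have l: "0 < l k" "l k < 1" for k by (auto simp: l_def)
  have "\<forall>k. \<exists>f. f \<in> admissible u B \<and> discounted_value u (l k) (apply_bcontfun f)"
    using discounted_value_exists[OF u B l] by blast
  then obtain F where F: "\<And>k. F k \<in> admissible u B" "\<And>k. discounted_value u (l k) (apply_bcontfun (F k))"
    by metis
  obtain v r where v: "v \<in> admissible u B" "strict_mono (r :: nat \<Rightarrow> nat)" "(F \<circ> r) \<longlonglongrightarrow> v"
    using compact_admissible[OF u, of B] F(1) unfolding compact_def by metis
  have "limit_value u (apply_bcontfun v)"
    unfolding limit_value_def
  proof (intro conjI continuous_on_apply_bcontfun allI impI)
    fix e :: real assume e: "e > 0"
    then obtain N where N: "\<And>n. n \<ge> N \<Longrightarrow> dist (F (r n)) v < e"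
      using v(3) unfolding lim_sequentially comp_def by blast
    obtain m :: nat where m: "1 / e < real m" using reals_Archimedean2 by blast
    define n where "n = max N m"
    have "m \<le> r n" using seq_suble[OF v(2), of n] by (simp add: n_def)
    then have "1 / e < real (r n) + 2" using m by linarith
    then have "l (r n) < e" using e by (simp add: l_def field_simps)
    moreover have "\<bar>apply_bcontfun (F (r n)) z - apply_bcontfun v z\<bar> \<le> e" for z
      using dist_bounded[of "F (r n)" z v] N[of n] by (simp add: n_def dist_real_def)
    ultimately show "\<exists>l f. 0 < l \<and> l < e \<and> l < 1 \<and> discounted_value u l f \<and> (\<forall>z. \<bar>f z - apply_bcontfun v z\<bar> \<le> e)"
      using F(2) l by blast
  qed
  then show ?thesis by blast
qed

lemma limit_value_superharmonic:
  assumes id: "idempotent \<Gamma>" and u: "continuous_on UNIV u" and v: "limit_value u v" and p: "p \<in> \<Gamma> x"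
  shows "mext v p (return borel y) \<le> v (x, y)"
proof (rule field_le_epsilon)
  fix e :: real assume "e > 0"
  then have "e / 2 > 0" by simp
  then obtain l f where f: "discounted_value u l f" "\<And>z. \<bar>f z - v z\<bar> \<le> e / 2"
    using v unfolding limit_value_def by blast
  have fc: "continuous_on UNIV f" and vc: "continuous_on UNIV v" using f(1) v by (simp_all add: discounted_value_def limit_value_def)
  have g: "continuous_on UNIV (\<lambda>z. l * u z + (1 - l) * f z)" by (intro continuous_intros u fc)
  have "mext v p (return borel y) \<le> mext f p (return borel y) + e / 2"
  proof (rule mext_le_add[OF continuous_bounded_measurable[OF vc] continuous_bounded_measurable[OF fc] _ \<Gamma>_Delta[OF p] return_in_Delta])
    show "v z \<le> f z + e / 2" for z using f(2)[of z] by linarith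
  qed
  also have "mext f p (return borel y) \<le> f (x, y)"
    using Val_superharmonic[OF id g p, of y] f(1) by (simp add: discounted_value_def)
  also have "f (x, y) \<le> v (x, y) + e / 2" using f(2)[of "(x, y)"] by linarith
  finally show "mext v p (return borel y) \<le> v (x, y) + e" by simp
qed

text \<open>At a discounted optimum, answering with the Dirac mass at \<open>y\<close> and using superharmonicity
  cancels the continuation payoff, leaving the stage payoff alone.\<close>

lemma limit_value_Q1:
  assumes id: "idempotent \<Gamma>" and u: "continuous_on UNIV u" and v: "limit_value u v"
  shows "\<exists>p\<in>\<Gamma> x. v (x, y) \<le> mext v p (return borel y) \<and> v (x, y) \<le> mext u p (return borel y)"
proof -
  obtain B where B: "u \<in> borel_measurable borel" "\<And>z. \<bar>u z\<bar> \<le> B"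
    using continuous_bounded_measurable[OF u] by (rule bounded_measurableE) (rule that)
  have vc: "continuous_on UNIV v" using v by (simp add: limit_value_def)
  obtain B' where B': "v \<in> borel_measurable borel" "\<And>z. \<bar>v z\<bar> \<le> B'"
    using continuous_bounded_measurable[OF vc] by (rule bounded_measurableE) (rule that)
  \<comment> \<open>This bounds \<open>?u - ?f\<close>: \<open>u\<close> is bounded by
    \<open>B\<close>, and \<open>f\<close>, within \<open>e < 1\<close> of \<open>v\<close>, by
    \<open>B' + 1\<close>.\<close>
  define A where "A = B + B' + 1"
  have A: "A > 0" using B(2)[of undefined] B'(2)[of undefined] by (simp add: A_def)
  \<comment> \<open>The error \<open>A * e\<close> comes from handing the weight
    \<open>l < e\<close> of the stage payoff to the continuation, and \<open>2 * e\<close> from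
    passing between \<open>f\<close> and \<open>v\<close> at both ends.\<close>
  have "\<exists>p\<in>\<Gamma> x. v (x, y) \<le> mext v p (return borel y) + (A + 2) * e \<and> v (x, y) \<le> mext u p (return borel y) + (A + 2) * e"
    if e: "0 < e" "e < 1" for e
  proof -
    obtain l f where l: "0 < l" "l < e" "l < 1" and f: "discounted_value u l f" "\<And>z. \<bar>f z - v z\<bar> \<le> e"
      using v e(1) unfolding limit_value_def by blast
    have c0: "continuous_on UNIV (\<lambda>_. 0 :: real)" by simp
    have fc: "continuous_on UNIV f" using f(1) by (simp add: discounted_value_def)
    note ub = continuous_bounded_measurable[OF u] and vb = continuous_bounded_measurable[OF vc]
      and fb = continuous_bounded_measurable[OF fc]
    have g: "continuous_on UNIV (\<lambda>z. l * u z + (1 - l) * f z)" by (intro continuous_intros u fc)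
    obtain p where p: "p \<in> \<Gamma> x" "\<forall>q\<in>\<Lambda> y. f (x, y) \<le> mext (\<lambda>z. l * u z + (1 - l) * f z) p q"
      using Val_optimal[OF c0 g, of x y] f(1) by (auto simp: discounted_value_def)
    note pD = \<Gamma>_Delta[OF p(1)]
    let ?u = "mext u p (return borel y)" and ?f = "mext f p (return borel y)" and ?v = "mext v p (return borel y)"
    have opt: "f (x, y) \<le> l * ?u + (1 - l) * ?f"
      using p(2)[rule_format, OF houseD(4)[OF \<Lambda>]] mext_lincomb[OF ub fb pD return_in_Delta, of l "1 - l" y] by simp
    have sup: "?f \<le> f (x, y)"
      using Val_superharmonic[OF id g p(1), of y] f(1) by (simp add: discounted_value_def)
    have "f (x, y) \<le> l * ?u + (1 - l) * f (x, y)"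
      using opt mult_left_mono[OF sup, of "1 - l"] l(3) by linarith
    then have "l * f (x, y) \<le> l * ?u" by (simp add: algebra_simps)
    then have fu: "f (x, y) \<le> ?u" using l(1) by simp
    have "\<bar>f z\<bar> \<le> B' + 1" for z using f(2)[of z] B'(2)[of z] e(2) by linarith
    from mext_bounded[OF borel_measurable_continuous_onI[OF fc] this pD return_in_Delta, of y]
    have "?u - ?f \<le> A" using mext_bounded[OF B pD return_in_Delta, of y] by (simp add: A_def abs_le_iff)
    then have "l * (?u - ?f) \<le> l * A" using l(1) by (intro mult_left_mono) auto
    also have "\<dots> \<le> e * A" using l(2) A by (intro mult_right_mono) auto
    finally have "l * (?u - ?f) \<le> e * A" .
    then have "f (x, y) \<le> ?f + e * A" using opt by (simp add: algebra_simps)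
    moreover have "?f \<le> ?v + e"
    proof (rule mext_le_add[OF fb vb _ pD return_in_Delta])
      show "f z \<le> v z + e" for z using f(2)[of z] by linarith
    qed
    moreover have "v (x, y) \<le> f (x, y) + e" using f(2)[of "(x, y)"] by linarith
    moreover have "0 \<le> A * e" using A e(1) by simp
    ultimately show ?thesis using fu p(1) e(1) by (intro bexI[of _ p]) (auto simp: algebra_simps)
  qed
  note near = this
  have "\<exists>p. p \<in> \<Gamma> x \<and> v (x, y) \<le> mext v p (return borel y) + (A + 2) * (1 / (real n + 2)) \<and>
      v (x, y) \<le> mext u p (return borel y) + (A + 2) * (1 / (real n + 2))" for n
    using near[of "1 / (real n + 2)"] by auto
  then obtain p where p: "\<And>n. p n \<in> \<Gamma> x" "\<And>n. v (x, y) \<le> mext v (p n) (return borel y) + (A + 2) * (1 / (real n + 2))"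
      "\<And>n. v (x, y) \<le> mext u (p n) (return borel y) + (A + 2) * (1 / (real n + 2))" by metis
  obtain q and r :: "nat \<Rightarrow> nat" where q: "q \<in> \<Gamma> x" "strict_mono r" "(\<lambda>n. dKR (p (r n)) q) \<longlonglongrightarrow> 0"
    using house_seq_compact[of \<Gamma> p, OF \<Gamma> p(1)] by (elim exE conjE)
  have l0: "(\<lambda>n::nat. dKR s s) \<longlonglongrightarrow> 0" for s :: "'b measure" by simp
  have "(\<lambda>n. (A + 2) * (1 / (real n + 2))) \<longlonglongrightarrow> 0"
    using tendsto_mult_right_zero[OF LIMSEQ_ignore_initial_segment[OF lim_1_over_n, of 2], of "A + 2"] by (simp add: add.commute)
  from LIMSEQ_subseq_LIMSEQ[OF this q(2)] have e0: "(\<lambda>n. (A + 2) * (1 / (real (r n) + 2))) \<longlonglongrightarrow> 0" by (simp add: comp_def)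
  have lim: "(\<lambda>n. mext w (p (r n)) (return borel y) + (A + 2) * (1 / (real (r n) + 2))) \<longlonglongrightarrow> mext w q (return borel y)"
    if "continuous_on UNIV w" for w
    using tendsto_add[OF mext_tendsto[OF that \<Gamma>_Delta[OF p(1)] \<Gamma>_Delta[OF q(1)] q(3) return_in_Delta return_in_Delta l0] e0] by simp
  have "v (x, y) \<le> mext v q (return borel y)" using p(2) by (intro LIMSEQ_le_const[OF lim[OF vc]]) blast
  moreover have "v (x, y) \<le> mext u q (return borel y)" using p(3) by (intro LIMSEQ_le_const[OF lim[OF u]]) blast
  ultimately show ?thesis using q(1) by blast
qed

end

text \<open>By \<open>Val_swap\<close> each discounted value becomes, up to sign, the discounted
  value of the game with roles exchanged, at the same uniform distance from the limit. The
  properties of \<open>v\<close> on the side of player 2 are read off from this.\<close>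

lemma limit_value_swap:
  fixes \<Gamma> :: "'a::compact_metric_space \<Rightarrow> 'a measure set" and \<Lambda> :: "'b::compact_metric_space \<Rightarrow> 'b measure set"
  assumes h: "two_houses \<Gamma> \<Lambda>" and u: "continuous_on UNIV u" and v: "two_houses.limit_value \<Gamma> \<Lambda> u v"
  shows "two_houses.limit_value \<Lambda> \<Gamma> (\<lambda>z. - u (snd z, fst z)) (\<lambda>z. - v (snd z, fst z))"
proof -
  interpret two_houses \<Gamma> \<Lambda> by fact
  interpret S: two_houses \<Lambda> \<Gamma> by unfold_locales (rule \<Lambda> \<Gamma>)+
  have disc: "S.discounted_value (\<lambda>z. - u (snd z, fst z)) l (\<lambda>z. - f (snd z, fst z))" if f: "discounted_value u l f" for l f
    unfolding S.discounted_value_def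
  proof (intro conjI ext)
    have fc: "continuous_on UNIV f" and fV: "f = Val \<Gamma> \<Lambda> (\<lambda>_. 0) (\<lambda>z. l * u z + (1 - l) * f z)"
      using f unfolding discounted_value_def by blast+
    show "continuous_on UNIV (\<lambda>z. - f (snd z, fst z))" by (rule continuous_swap[OF fc])
    fix z :: "'b \<times> 'a"
    have g: "continuous_on UNIV (\<lambda>z. l * u z + (1 - l) * f z)" by (intro continuous_intros u fc)
    have "(\<lambda>z. l * (- u (snd z, fst z)) + (1 - l) * (- f (snd z, fst z))) = (\<lambda>z. - (l * u (snd z, fst z) + (1 - l) * f (snd z, fst z)))"
      by (simp add: fun_eq_iff)
    then show "- f (snd z, fst z) = Val \<Lambda> \<Gamma> (\<lambda>_. 0) (\<lambda>z. l * (- u (snd z, fst z)) + (1 - l) * (- f (snd z, fst z))) z"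
      using Val_swap[OF g, of "fst z" "snd z"] fun_cong[OF fV, of "(snd z, fst z)"] by simp
  qed
  have vc: "continuous_on UNIV v" using v by (simp add: limit_value_def)
  show ?thesis
    unfolding S.limit_value_def
  proof (intro conjI continuous_swap[OF vc] allI impI)
    fix e :: real assume "e > 0"
    then obtain l f where l: "0 < l" "l < e" "l < 1" "discounted_value u l f" "\<And>z. \<bar>f z - v z\<bar> \<le> e"
      using v unfolding limit_value_def by blast
    have "\<bar>- f (snd z, fst z) - - v (snd z, fst z)\<bar> \<le> e" for z using l(5)[of "(snd z, fst z)"] by linarith
    then show "\<exists>l f. 0 < l \<and> l < e \<and> l < 1 \<and> S.discounted_value (\<lambda>z. - u (snd z, fst z)) l f \<and> (\<forall>z. \<bar>f z - - v (snd z, fst z)\<bar> \<le> e)"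
      using l(1-3) disc[OF l(4)] by blast
  qed
qed

section \<open>Gambling processes\<close>

text \<open>The last clause says that, as far as consecutive pairs of states can tell, the next pair
  is drawn from the product of \<open>S i\<close> and \<open>R i\<close>. The kernels are arbitrary
  functions on the sample space and may encode any history; exchanging the players is a permutation
  of arguments.\<close>

definition gambling_process :: "('a::compact_metric_space \<Rightarrow> 'a measure set) \<Rightarrow> ('b::compact_metric_space \<Rightarrow> 'b measure set) \<Rightarrow>
    'm measure \<Rightarrow> (nat \<Rightarrow> 'm \<Rightarrow> 'a) \<Rightarrow> (nat \<Rightarrow> 'm \<Rightarrow> 'b) \<Rightarrow> (nat \<Rightarrow> 'm \<Rightarrow> 'a measure) \<Rightarrow> (nat \<Rightarrow> 'm \<Rightarrow> 'b measure) \<Rightarrow> bool" where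
  "gambling_process \<Gamma> \<Lambda> M X Y S R \<longleftrightarrow> prob_space M \<and>
     (\<forall>i. X i \<in> M \<rightarrow>\<^sub>M borel \<and> Y i \<in> M \<rightarrow>\<^sub>M borel \<and> S i \<in> M \<rightarrow>\<^sub>M prob_algebra borel \<and> R i \<in> M \<rightarrow>\<^sub>M prob_algebra borel \<and>
       (\<forall>\<omega>\<in>space M. S i \<omega> \<in> \<Gamma> (X i \<omega>)) \<and> (\<forall>\<omega>\<in>space M. R i \<omega> \<in> \<Lambda> (Y i \<omega>)) \<and>
       (\<forall>f\<in>bounded_measurable. (\<integral>\<omega>. f ((X i \<omega>, Y i \<omega>), (X (Suc i) \<omega>, Y (Suc i) \<omega>)) \<partial>M) =
          (\<integral>\<omega>. mext (\<lambda>z. f ((X i \<omega>, Y i \<omega>), z)) (S i \<omega>) (R i \<omega>) \<partial>M)))"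

lemma gambling_processD:
  assumes "gambling_process \<Gamma> \<Lambda> M X Y S R"
  shows "prob_space M" "X i \<in> M \<rightarrow>\<^sub>M borel" "Y i \<in> M \<rightarrow>\<^sub>M borel" "S i \<in> M \<rightarrow>\<^sub>M prob_algebra borel" "R i \<in> M \<rightarrow>\<^sub>M prob_algebra borel"
    "\<omega> \<in> space M \<Longrightarrow> S i \<omega> \<in> \<Gamma> (X i \<omega>)" "\<omega> \<in> space M \<Longrightarrow> R i \<omega> \<in> \<Lambda> (Y i \<omega>)"
    "f \<in> bounded_measurable \<Longrightarrow> (\<integral>\<omega>. f ((X i \<omega>, Y i \<omega>), (X (Suc i) \<omega>, Y (Suc i) \<omega>)) \<partial>M) =
      (\<integral>\<omega>. mext (\<lambda>z. f ((X i \<omega>, Y i \<omega>), z)) (S i \<omega>) (R i \<omega>) \<partial>M)"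
  using assms unfolding gambling_process_def by blast+

lemma bounded_measurable_compose:
  assumes "f \<in> bounded_measurable" "g \<in> borel \<rightarrow>\<^sub>M borel"
  shows "(\<lambda>x. f (g x)) \<in> bounded_measurable"
proof -
  obtain B where B: "f \<in> borel_measurable borel" "\<And>z. \<bar>f z\<bar> \<le> B" using assms(1) by (rule bounded_measurableE) (rule that)
  show ?thesis using measurable_compose[OF assms(2) B(1)] B(2) by (rule bounded_measurableI)
qed

lemma continuous_imp_borel:
  "continuous_on UNIV g \<Longrightarrow> g \<in> borel \<rightarrow>\<^sub>M (borel :: 'b::topological_space measure)"
  by (rule borel_measurable_continuous_onI)

lemma gambling_process_swap:
  assumes P: "gambling_process \<Gamma> \<Lambda> M X Y S R"
  shows "gambling_process \<Lambda> \<Gamma> M Y X R S"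
proof -
  note D = gambling_processD[OF P]
  have "(\<integral>\<omega>. f ((Y i \<omega>, X i \<omega>), (Y (Suc i) \<omega>, X (Suc i) \<omega>)) \<partial>M) =
      (\<integral>\<omega>. mext (\<lambda>z. f ((Y i \<omega>, X i \<omega>), z)) (R i \<omega>) (S i \<omega>) \<partial>M)" if f: "f \<in> bounded_measurable" for i f
  proof -
    define g where "g = (\<lambda>z. f ((snd (fst z), fst (fst z)), (snd (snd z), fst (snd z))))"
    have g: "g \<in> bounded_measurable"
      unfolding g_def by (rule bounded_measurable_compose[OF f]) (intro continuous_imp_borel continuous_intros)
    have "(\<integral>\<omega>. f ((Y i \<omega>, X i \<omega>), (Y (Suc i) \<omega>, X (Suc i) \<omega>)) \<partial>M) = (\<integral>\<omega>. mext (\<lambda>z. g ((X i \<omega>, Y i \<omega>), z)) (S i \<omega>) (R i \<omega>) \<partial>M)"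
      using D(8)[OF g, of i] by (simp add: g_def)
    also have "\<dots> = (\<integral>\<omega>. mext (\<lambda>z. f ((Y i \<omega>, X i \<omega>), z)) (R i \<omega>) (S i \<omega>) \<partial>M)"
    proof (rule Bochner_Integration.integral_cong[OF refl])
      fix \<omega> assume w: "\<omega> \<in> space M"
      have "mext (\<lambda>z. 1 * g ((X i \<omega>, Y i \<omega>), (snd z, fst z))) (R i \<omega>) (S i \<omega>) = 1 * mext (\<lambda>z. g ((X i \<omega>, Y i \<omega>), z)) (S i \<omega>) (R i \<omega>)"
        by (rule mext_swap[OF sections_bounded_measurable(2)[OF g] prob_algebra_borel_Delta[OF D(4) w] prob_algebra_borel_Delta[OF D(5) w]])
      then show "mext (\<lambda>z. g ((X i \<omega>, Y i \<omega>), z)) (S i \<omega>) (R i \<omega>) = mext (\<lambda>z. f ((Y i \<omega>, X i \<omega>), z)) (R i \<omega>) (S i \<omega>)"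
        by (simp add: g_def)
    qed
    finally show ?thesis .
  qed
  then show ?thesis unfolding gambling_process_def using D by blast
qed

text \<open>A product of indicators in the coordinates of player 1 integrates the other player out
  of the one-step identity.\<close>

lemma gambling_process_house_process:
  assumes P: "gambling_process \<Gamma> \<Lambda> M X Y S R"
  shows "house_process \<Gamma> M X S"
proof -
  note D = gambling_processD[OF P]
  interpret prob_space M by (rule D(1))
  note [measurable] = D(2,3)
  have "emeasure M {\<omega>\<in>space M. X i \<omega> \<in> A \<and> X (Suc i) \<omega> \<in> B} = (\<integral>\<^sup>+\<omega>. indicator A (X i \<omega>) * emeasure (S i \<omega>) B \<partial>M)"
    if [measurable]: "A \<in> sets borel" "B \<in> sets borel" for i A B
  proof -
    define f where "f z = indicator A (fst (fst z)) * (indicator B (fst (snd z)) :: real)" for z :: "('a \<times> 'b) \<times> ('a \<times> 'b)"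
    have f: "f \<in> bounded_measurable"
    proof (rule bounded_measurableI[of _ 1])
      have "(\<lambda>z::('a \<times> 'b) \<times> ('a \<times> 'b). fst (fst z)) \<in> borel \<rightarrow>\<^sub>M borel" "(\<lambda>z::('a \<times> 'b) \<times> ('a \<times> 'b). fst (snd z)) \<in> borel \<rightarrow>\<^sub>M borel"
        by (intro continuous_imp_borel continuous_intros)+
      then show "f \<in> borel_measurable borel" unfolding f_def[abs_def] by measurable
    qed (simp add: f_def indicator_def)
    have SD: "S i \<omega> \<in> Delta" "R i \<omega> \<in> Delta" if "\<omega> \<in> space M" for \<omega>
      using prob_algebra_borel_Delta[OF D(4) that] prob_algebra_borel_Delta[OF D(5) that] .
    have m: "(\<lambda>\<omega>. measure (S i \<omega>) B) \<in> borel_measurable M"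
      using measurable_compose[OF measurable_prob_algebraD[OF D(4)] measurable_measure_subprob_algebra] by simp
    have le1: "measure (S i \<omega>) B \<le> 1" if "\<omega> \<in> space M" for \<omega>
      using prob_space.prob_le_1[OF DeltaD(1)[OF SD(1)[OF that]]] .
    have "measure M {\<omega>\<in>space M. X i \<omega> \<in> A \<and> X (Suc i) \<omega> \<in> B} =
        (\<integral>\<omega>. indicator {\<omega>\<in>space M. X i \<omega> \<in> A \<and> X (Suc i) \<omega> \<in> B} \<omega> \<partial>M)"
      by (simp add: Int_absorb1)
    also have "\<dots> = (\<integral>\<omega>. f ((X i \<omega>, Y i \<omega>), (X (Suc i) \<omega>, Y (Suc i) \<omega>)) \<partial>M)"
      by (intro Bochner_Integration.integral_cong refl) (auto simp: f_def indicator_def)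
    also have "\<dots> = (\<integral>\<omega>. mext (\<lambda>z. f ((X i \<omega>, Y i \<omega>), z)) (S i \<omega>) (R i \<omega>) \<partial>M)" by (rule D(8)[OF f])
    also have "\<dots> = (\<integral>\<omega>. indicator A (X i \<omega>) * measure (S i \<omega>) B \<partial>M)"
    proof (rule Bochner_Integration.integral_cong[OF refl])
      fix \<omega> assume w: "\<omega> \<in> space M"
      have "B \<in> sets (S i \<omega>)" using DeltaD(2)[OF SD(1)[OF w]] that(2) by simp
      then have "(\<integral>x. indicator A (X i \<omega>) * indicator B x \<partial>S i \<omega>) = indicator A (X i \<omega>) * measure (S i \<omega>) B"
        using sets.sets_into_space[of B "S i \<omega>"] by (simp add: Int_absorb1)
      then show "mext (\<lambda>z. f ((X i \<omega>, Y i \<omega>), z)) (S i \<omega>) (R i \<omega>) = indicator A (X i \<omega>) * measure (S i \<omega>) B"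
        using mext_const_right[OF SD(2)[OF w], of "\<lambda>x. indicator A (X i \<omega>) * indicator B x" "S i \<omega>"] by (simp add: f_def)
    qed
    finally have eq: "measure M {\<omega>\<in>space M. X i \<omega> \<in> A \<and> X (Suc i) \<omega> \<in> B} = (\<integral>\<omega>. indicator A (X i \<omega>) * measure (S i \<omega>) B \<partial>M)" .
    have mm: "(\<lambda>\<omega>. indicator A (X i \<omega>) * measure (S i \<omega>) B) \<in> borel_measurable M" using m by measurable
    have int: "integrable M (\<lambda>\<omega>. indicator A (X i \<omega>) * measure (S i \<omega>) B)"
      using le1 by (intro integral_bounds_const(1)[OF D(1) mm, of 1]) (auto simp: indicator_def)
    have "(\<integral>\<^sup>+\<omega>. indicator A (X i \<omega>) * emeasure (S i \<omega>) B \<partial>M) = (\<integral>\<^sup>+\<omega>. ennreal (indicator A (X i \<omega>) * measure (S i \<omega>) B) \<partial>M)"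
    proof (rule nn_integral_cong)
      fix \<omega> assume w: "\<omega> \<in> space M"
      have "emeasure (S i \<omega>) B = ennreal (measure (S i \<omega>) B)"
        by (intro finite_measure.emeasure_eq_measure prob_space.finite_measure DeltaD(1) SD(1) w)
      then show "indicator A (X i \<omega>) * emeasure (S i \<omega>) B = ennreal (indicator A (X i \<omega>) * measure (S i \<omega>) B)"
        by (simp add: indicator_def)
    qed
    also have "\<dots> = ennreal (\<integral>\<omega>. indicator A (X i \<omega>) * measure (S i \<omega>) B \<partial>M)"
      by (rule nn_integral_eq_integral[OF int]) simp
    finally show ?thesis using eq by (simp add: emeasure_eq_measure)
  qed
  then show ?thesis unfolding house_process_def using D by blast
qed

lemma process_integrable:
  assumes P: "gambling_process \<Gamma> \<Lambda> M X Y S R" and f: "f \<in> bounded_measurable"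
  shows "integrable M (\<lambda>\<omega>. f (X i \<omega>, Y j \<omega>))"
proof -
  note D = gambling_processD[OF P]
  obtain B where B: "f \<in> borel_measurable borel" "\<And>z. \<bar>f z\<bar> \<le> B" using f by (rule bounded_measurableE) (rule that)
  have "(\<lambda>\<omega>. (X i \<omega>, Y j \<omega>)) \<in> M \<rightarrow>\<^sub>M borel" using D(2,3) by (rule borel_measurable_Pair)
  from measurable_compose[OF this B(1)] show ?thesis using B(2) by (rule integral_bounds_const(1)[OF D(1)])
qed

text \<open>In the mixed-time identity the integrand ignores the next \<open>y\<close>, so it sees
  \<open>R i\<close> only through its total mass 1 and the Dirac mass at the current
  \<open>y\<close> may replace it.\<close>

lemma process_step:
  assumes P: "gambling_process \<Gamma> \<Lambda> M X Y S R" and f: "f \<in> bounded_measurable"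
  shows "(\<integral>\<omega>. f (X (Suc i) \<omega>, Y (Suc i) \<omega>) \<partial>M) = (\<integral>\<omega>. mext f (S i \<omega>) (R i \<omega>) \<partial>M)"
    and "(\<integral>\<omega>. f (X (Suc i) \<omega>, Y i \<omega>) \<partial>M) = (\<integral>\<omega>. mext f (S i \<omega>) (return borel (Y i \<omega>)) \<partial>M)"
proof -
  note D = gambling_processD[OF P]
  have "(\<lambda>z::('a \<times> 'b) \<times> ('a \<times> 'b). f (snd z)) \<in> bounded_measurable"
    by (rule bounded_measurable_compose[OF f]) (intro continuous_imp_borel continuous_intros)
  from D(8)[OF this, of i] show "(\<integral>\<omega>. f (X (Suc i) \<omega>, Y (Suc i) \<omega>) \<partial>M) = (\<integral>\<omega>. mext f (S i \<omega>) (R i \<omega>) \<partial>M)" by simp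
  have "(\<lambda>z::('a \<times> 'b) \<times> ('a \<times> 'b). f (fst (snd z), snd (fst z))) \<in> bounded_measurable"
    by (rule bounded_measurable_compose[OF f]) (intro continuous_imp_borel continuous_intros)
  from D(8)[OF this, of i] have "(\<integral>\<omega>. f (X (Suc i) \<omega>, Y i \<omega>) \<partial>M) = (\<integral>\<omega>. mext (\<lambda>z. f (fst z, Y i \<omega>)) (S i \<omega>) (R i \<omega>) \<partial>M)" by simp
  also have "\<dots> = (\<integral>\<omega>. mext f (S i \<omega>) (return borel (Y i \<omega>)) \<partial>M)"
  proof (rule Bochner_Integration.integral_cong[OF refl])
    fix \<omega> assume w: "\<omega> \<in> space M"
    show "mext (\<lambda>z. f (fst z, Y i \<omega>)) (S i \<omega>) (R i \<omega>) = mext f (S i \<omega>) (return borel (Y i \<omega>))"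
      using mext_const_right[OF prob_algebra_borel_Delta[OF D(5) w], of "\<lambda>x. f (x, Y i \<omega>)"]
        mext_return_right[OF f prob_algebra_borel_Delta[OF D(4) w]] by simp
  qed
  finally show "(\<integral>\<omega>. f (X (Suc i) \<omega>, Y i \<omega>) \<partial>M) = (\<integral>\<omega>. mext f (S i \<omega>) (return borel (Y i \<omega>)) \<partial>M)" .
qed

lemma measurable_mext_kernels:
  fixes f :: "'a::second_countable_topology \<times> 'b::second_countable_topology \<Rightarrow> real"
  assumes f: "f \<in> bounded_measurable" and S: "S \<in> M \<rightarrow>\<^sub>M prob_algebra borel" and R: "R \<in> M \<rightarrow>\<^sub>M prob_algebra borel"
  shows "(\<lambda>\<omega>. mext f (S \<omega>) (R \<omega>)) \<in> borel_measurable M"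
proof -
  obtain B where B: "f \<in> borel_measurable borel" "\<And>z. \<bar>f z\<bar> \<le> B" using f by (rule bounded_measurableE) (rule that)
  have "(\<lambda>\<omega>. S \<omega> \<Otimes>\<^sub>M R \<omega>) \<in> M \<rightarrow>\<^sub>M prob_algebra (borel \<Otimes>\<^sub>M borel)" using S R by measurable
  then have "(\<lambda>\<omega>. S \<omega> \<Otimes>\<^sub>M R \<omega>) \<in> M \<rightarrow>\<^sub>M prob_algebra borel" by (simp only: borel_prod)
  from measurable_integral_kernel[OF this B(1)] have "(\<lambda>\<omega>. \<integral>z. f z \<partial>(S \<omega> \<Otimes>\<^sub>M R \<omega>)) \<in> borel_measurable M" .
  moreover have "(\<integral>z. f z \<partial>(S \<omega> \<Otimes>\<^sub>M R \<omega>)) = mext f (S \<omega>) (R \<omega>)" if "\<omega> \<in> space M" for \<omega>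
    by (rule mext_Fubini(2)[OF f prob_algebra_borel_Delta[OF S that] prob_algebra_borel_Delta[OF R that]])
  ultimately show ?thesis by (simp cong: measurable_cong)
qed

lemma integrable_mext_kernels:
  fixes f :: "'a::second_countable_topology \<times> 'b::second_countable_topology \<Rightarrow> real"
  assumes M: "prob_space M" and f: "f \<in> bounded_measurable" and S: "S \<in> M \<rightarrow>\<^sub>M prob_algebra borel" and R: "R \<in> M \<rightarrow>\<^sub>M prob_algebra borel"
  shows "integrable M (\<lambda>\<omega>. mext f (S \<omega>) (R \<omega>))"
proof -
  obtain B where B: "f \<in> borel_measurable borel" "\<And>z. \<bar>f z\<bar> \<le> B" using f by (rule bounded_measurableE) (rule that)
  show ?thesis
    by (rule integral_bounds_const(1)[OF M measurable_mext_kernels[OF f S R]])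
      (rule mext_bounded[OF B prob_algebra_borel_Delta[OF S] prob_algebra_borel_Delta[OF R]])
qed

text \<open>The hypothesis at each fixed \<open>x\<close> is integrated against \<open>p\<close>;
  Fubini puts the integrals in the required order.\<close>

lemma mext_subharmonic_right:
  fixes v :: "'a::second_countable_topology \<times> 'b::second_countable_topology \<Rightarrow> real"
  assumes v: "v \<in> bounded_measurable" and p: "p \<in> Delta" and q: "q \<in> Delta"
    and le: "\<And>x. v (x, y) \<le> mext v (return borel x) q"
  shows "mext v p (return borel y) \<le> mext v p q"
  unfolding mext_return_right[OF v p] mext_Fubini(1)[OF v p q]
proof (rule integral_mono)
  show "integrable p (\<lambda>x. v (x, y))" by (rule integrable_bounded_measurable[OF p sections_bounded_measurable(1)[OF v]])
  show "integrable p (\<lambda>x. \<integral>y. v (x, y) \<partial>q)"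
    by (rule integrable_bounded_measurable[OF p partial_integral_bounded_measurable(2)[OF v q]])
  show "v (x, y) \<le> (\<integral>y. v (x, y) \<partial>q)" for x using le[of x] mext_return_left[OF v] by metis
qed

text \<open>At a frozen \<open>y\<close> the adapted move does not lower the mean of
  \<open>v\<close>, and the independent move of player 2 does not lower it either because
  \<open>v\<close> is depressive. The bound has no error term: approximation enters only with the
  passage from mixed to equal times.\<close>

lemma adapted_sum_ge:
  assumes P: "gambling_process \<Gamma> \<Lambda> M X Y S R" and u: "u \<in> bounded_measurable" and v: "v \<in> bounded_measurable"
    and dep: "\<And>x y q. q \<in> \<Lambda> y \<Longrightarrow> v (x, y) \<le> mext v (return borel x) q"
    and adapted: "\<And>i \<omega>. \<omega> \<in> space M \<Longrightarrow> v (X i \<omega>, Y i \<omega>) \<le> mext v (S i \<omega>) (return borel (Y i \<omega>)) \<and>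
      mext v (S i \<omega>) (return borel (Y i \<omega>)) \<le> mext u (S i \<omega>) (return borel (Y i \<omega>))"
  shows "real n * (\<integral>\<omega>. v (X 0 \<omega>, Y 0 \<omega>) \<partial>M) \<le> (\<Sum>i<n. \<integral>\<omega>. u (X (Suc i) \<omega>, Y i \<omega>) \<partial>M)"
proof -
  note D = gambling_processD[OF P]
  have ret: "(\<lambda>\<omega>. return borel (Y i \<omega>)) \<in> M \<rightarrow>\<^sub>M prob_algebra borel" for i
    by (rule measurable_compose[OF D(3) measurable_return_prob_space])
  note iv = integrable_mext_kernels[OF D(1) v D(4) ret] and iu = integrable_mext_kernels[OF D(1) u D(4) ret]
  have step: "(\<integral>\<omega>. v (X i \<omega>, Y i \<omega>) \<partial>M) \<le> (\<integral>\<omega>. mext v (S i \<omega>) (return borel (Y i \<omega>)) \<partial>M)" for i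
    by (rule integral_mono[OF process_integrable[OF P v] iv]) (use adapted in blast)
  have "(\<integral>\<omega>. mext v (S i \<omega>) (return borel (Y i \<omega>)) \<partial>M) \<le> (\<integral>\<omega>. v (X (Suc i) \<omega>, Y (Suc i) \<omega>) \<partial>M)" for i
    unfolding process_step(1)[OF P v]
  proof (rule integral_mono[OF iv integrable_mext_kernels[OF D(1) v D(4,5)]])
    fix \<omega> assume w: "\<omega> \<in> space M"
    show "mext v (S i \<omega>) (return borel (Y i \<omega>)) \<le> mext v (S i \<omega>) (R i \<omega>)"
      by (rule mext_subharmonic_right[OF v prob_algebra_borel_Delta[OF D(4) w] prob_algebra_borel_Delta[OF D(5) w] dep[OF D(7)[OF w]]])
  qed
  with step have mono: "(\<integral>\<omega>. v (X i \<omega>, Y i \<omega>) \<partial>M) \<le> (\<integral>\<omega>. v (X (Suc i) \<omega>, Y (Suc i) \<omega>) \<partial>M)" for i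
    by (meson order_trans)
  have v0: "(\<integral>\<omega>. v (X 0 \<omega>, Y 0 \<omega>) \<partial>M) \<le> (\<integral>\<omega>. v (X i \<omega>, Y i \<omega>) \<partial>M)" for i
    by (rule lift_Suc_mono_le[of "\<lambda>i. \<integral>\<omega>. v (X i \<omega>, Y i \<omega>) \<partial>M", OF mono]) simp
  have "(\<integral>\<omega>. v (X 0 \<omega>, Y 0 \<omega>) \<partial>M) \<le> (\<integral>\<omega>. u (X (Suc i) \<omega>, Y i \<omega>) \<partial>M)" for i
  proof -
    have "(\<integral>\<omega>. mext v (S i \<omega>) (return borel (Y i \<omega>)) \<partial>M) \<le> (\<integral>\<omega>. mext u (S i \<omega>) (return borel (Y i \<omega>)) \<partial>M)"
      by (rule integral_mono[OF iv iu]) (use adapted in blast)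
    then show ?thesis using v0[of i] step[of i] unfolding process_step(2)[OF P u] by linarith
  qed
  then have "(\<Sum>i<n. \<integral>\<omega>. v (X 0 \<omega>, Y 0 \<omega>) \<partial>M) \<le> (\<Sum>i<n. \<integral>\<omega>. u (X (Suc i) \<omega>, Y i \<omega>) \<partial>M)" by (intro sum_mono)
  then show ?thesis by simp
qed

lemma process_dist_integrable:
  assumes P: "gambling_process \<Gamma> \<Lambda> M X Y S R"
  shows "integrable M (\<lambda>\<omega>. dist (X i \<omega>) (X j \<omega>))"
proof -
  note D = gambling_processD[OF P]
  note [measurable] = D(2)
  obtain d where "\<And>x y :: 'a. dist x y \<le> d"
    using diameter_bounded_bound[OF compact_imp_bounded[OF compact_space_UNIV]] by blast
  then show ?thesis by (intro integral_bounds_const(1)[OF D(1), of _ d]) auto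
qed

text \<open>Small average displacement makes the payoff at mixed times \<open>u (X (Suc i), Y i)\<close> the same
  on average as the stage payoff.\<close>

lemma adapted_guarantee:
  fixes \<Gamma> :: "'a::compact_metric_space \<Rightarrow> 'a measure set" and \<Lambda> :: "'b::compact_metric_space \<Rightarrow> 'b measure set"
  assumes \<Gamma>: "leavable \<Gamma>" "vanishing_L1_variation \<Gamma>" and u: "continuous_on UNIV u" and v: "v \<in> bounded_measurable"
    and dep: "\<forall>x y. \<forall>q\<in>\<Lambda> y. v (x, y) \<le> mext v (return borel x) q" and e: "e > 0"
  shows "\<exists>N\<ge>1. \<forall>n\<ge>N. \<forall>(M :: 'm measure) X Y S R. gambling_process \<Gamma> \<Lambda> M X Y S R \<longrightarrow>
    (\<forall>i. \<forall>\<omega>\<in>space M. v (X i \<omega>, Y i \<omega>) \<le> mext v (S i \<omega>) (return borel (Y i \<omega>)) \<and>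
      mext v (S i \<omega>) (return borel (Y i \<omega>)) \<le> mext u (S i \<omega>) (return borel (Y i \<omega>))) \<longrightarrow>
    real n * ((\<integral>\<omega>. v (X 0 \<omega>, Y 0 \<omega>) \<partial>M) - e) \<le> (\<Sum>i<n. \<integral>\<omega>. u (X i \<omega>, Y i \<omega>) \<partial>M)"
proof -
  obtain C where C: "C \<ge> 0" "osc2_le (e / 2) C u" using continuous_imp_osc2_le[OF u, of "e / 2"] e by auto
  \<comment> \<open>Half of \<open>e\<close> goes to the modulus of \<open>u\<close>; the slope
    \<open>C\<close> times a mean displacement of at most \<open>e'\<close> stays within the other
    half.\<close>
  define e' where "e' = e / (2 * (C + 1))"
  have e': "e' > 0" "(C + 1) * e' = e / 2" using e C(1) by (simp_all add: e'_def field_simps)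
  from vanishing_variation_paths[OF \<Gamma> e'(1), where 'm='m] obtain N where N: "N \<ge> 1"
    "\<forall>n\<ge>N. \<forall>(M :: 'm measure) X S. house_process \<Gamma> M X S \<longrightarrow> (\<Sum>i<n. \<integral>\<omega>. dist (X i \<omega>) (X (Suc i) \<omega>) \<partial>M) \<le> e' * real n"
    by (elim exE conjE)
  note ub = continuous_bounded_measurable[OF u]
  have "real n * ((\<integral>\<omega>. v (X 0 \<omega>, Y 0 \<omega>) \<partial>M) - e) \<le> (\<Sum>i<n. \<integral>\<omega>. u (X i \<omega>, Y i \<omega>) \<partial>M)"
    if n: "n \<ge> N" and P: "gambling_process \<Gamma> \<Lambda> M X Y S R"
      and ad: "\<forall>i. \<forall>\<omega>\<in>space M. v (X i \<omega>, Y i \<omega>) \<le> mext v (S i \<omega>) (return borel (Y i \<omega>)) \<and>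
        mext v (S i \<omega>) (return borel (Y i \<omega>)) \<le> mext u (S i \<omega>) (return borel (Y i \<omega>))"
    for n and M :: "'m measure" and X Y S R
  proof -
    interpret prob_space M by (rule gambling_processD(1)[OF P])
    note id = process_dist_integrable[OF P] and iu = process_integrable[OF P ub]
    have "(\<integral>\<omega>. u (X (Suc i) \<omega>, Y i \<omega>) \<partial>M) \<le> (\<integral>\<omega>. u (X i \<omega>, Y i \<omega>) \<partial>M) + (e / 2 + C * (\<integral>\<omega>. dist (X i \<omega>) (X (Suc i) \<omega>) \<partial>M))" for i
    proof -
      have "(\<integral>\<omega>. u (X (Suc i) \<omega>, Y i \<omega>) \<partial>M) \<le> (\<integral>\<omega>. u (X i \<omega>, Y i \<omega>) + (e / 2 + C * dist (X i \<omega>) (X (Suc i) \<omega>)) \<partial>M)"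
      proof (rule integral_mono)
        fix \<omega>
        have "\<bar>u (X i \<omega>, Y i \<omega>) - u (X (Suc i) \<omega>, Y i \<omega>)\<bar> \<le> e / 2 + C * dist (X i \<omega>) (X (Suc i) \<omega>)"
          using C(2) unfolding osc2_le_def osc_le_def by blast
        then show "u (X (Suc i) \<omega>, Y i \<omega>) \<le> u (X i \<omega>, Y i \<omega>) + (e / 2 + C * dist (X i \<omega>) (X (Suc i) \<omega>))" by linarith
      qed (use iu id in auto)
      also have "\<dots> = (\<integral>\<omega>. u (X i \<omega>, Y i \<omega>) \<partial>M) + (e / 2 + C * (\<integral>\<omega>. dist (X i \<omega>) (X (Suc i) \<omega>) \<partial>M))"
        using iu id by (simp add: prob_space)
      finally show ?thesis .
    qed
    then have "(\<Sum>i<n. \<integral>\<omega>. u (X (Suc i) \<omega>, Y i \<omega>) \<partial>M) \<le>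
        (\<Sum>i<n. (\<integral>\<omega>. u (X i \<omega>, Y i \<omega>) \<partial>M) + (e / 2 + C * (\<integral>\<omega>. dist (X i \<omega>) (X (Suc i) \<omega>) \<partial>M)))"
      by (intro sum_mono)
    also have "\<dots> = (\<Sum>i<n. \<integral>\<omega>. u (X i \<omega>, Y i \<omega>) \<partial>M) + (real n * (e / 2) + C * (\<Sum>i<n. \<integral>\<omega>. dist (X i \<omega>) (X (Suc i) \<omega>) \<partial>M))"
      by (simp add: sum.distrib sum_distrib_left)
    finally have 1: "(\<Sum>i<n. \<integral>\<omega>. u (X (Suc i) \<omega>, Y i \<omega>) \<partial>M) \<le>
        (\<Sum>i<n. \<integral>\<omega>. u (X i \<omega>, Y i \<omega>) \<partial>M) + (real n * (e / 2) + C * (\<Sum>i<n. \<integral>\<omega>. dist (X i \<omega>) (X (Suc i) \<omega>) \<partial>M))" .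
    have "(\<Sum>i<n. \<integral>\<omega>. dist (X i \<omega>) (X (Suc i) \<omega>) \<partial>M) \<le> e' * real n"
      using N(2) n gambling_process_house_process[OF P] by blast
    then have "C * (\<Sum>i<n. \<integral>\<omega>. dist (X i \<omega>) (X (Suc i) \<omega>) \<partial>M) \<le> C * (e' * real n)"
      using C(1) by (intro mult_left_mono)
    also have "\<dots> \<le> (C + 1) * e' * real n" using e'(1) by (simp add: distrib_right)
    also have "\<dots> = e / 2 * real n" using e'(2) by simp
    finally have 2: "C * (\<Sum>i<n. \<integral>\<omega>. dist (X i \<omega>) (X (Suc i) \<omega>) \<partial>M) \<le> e / 2 * real n" .
    have 3: "real n * (\<integral>\<omega>. v (X 0 \<omega>, Y 0 \<omega>) \<partial>M) \<le> (\<Sum>i<n. \<integral>\<omega>. u (X (Suc i) \<omega>, Y i \<omega>) \<partial>M)"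
      by (rule adapted_sum_ge[OF P ub v]) (use dep ad in blast)+
    show ?thesis using 1 2 3 by (simp add: algebra_simps)
  qed
  then show ?thesis using N(1) by blast
qed

section \<open>Plays\<close>

locale strategy_pair =
  fixes \<Gamma> :: "'a::compact_metric_space \<Rightarrow> 'a measure set"
    and \<Lambda> :: "'b::compact_metric_space \<Rightarrow> 'b measure set"
    and \<sigma> :: "('a, 'b, 'a) strategy" and \<tau> :: "('a, 'b, 'b) strategy" and z :: "'a \<times> 'b"
  assumes \<sigma>: "strategy1 \<Gamma> \<sigma>" and \<tau>: "strategy2 \<Lambda> \<tau>"
begin

sublocale IT: Ionescu_Tulcea "step z \<sigma> \<tau>" "\<lambda>_. borel"
  by (rule Ionescu_Tulcea_step[OF \<sigma> \<tau>])

lemma play_eq: "play z \<sigma> \<tau> = IT.PF.lim"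
  by (simp add: play_def)

lemma sets_play: "sets (play z \<sigma> \<tau>) = sets (PiM UNIV (\<lambda>_. borel))"
  by (simp add: play_eq)

lemma measurable_restrict_play: "(\<lambda>\<omega>. restrict \<omega> {0..<n}) \<in> play z \<sigma> \<tau> \<rightarrow>\<^sub>M PiM {0..<n} (\<lambda>_. borel)"
  by (subst measurable_cong_sets[OF sets_play refl]) (rule measurable_restrict_subset, simp)

text \<open>The projective limit has marginals \<open>CI\<close>, built from a horizon
  \<open>up_to\<close> that may exceed \<open>n\<close>; consistency of the finite compositions
  identifies the marginal on the first \<open>n\<close> coordinates.\<close>

lemma distr_play: "distr (play z \<sigma> \<tau>) (PiM {0..<n} (\<lambda>_. borel)) (\<lambda>\<omega>. restrict \<omega> {0..<n}) = IT.C 0 n (\<lambda>_. undefined)"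
proof -
  have "n \<le> IT.up_to {0..<n}" using IT.up_to[of "{0..<n}"] by (cases n) auto
  then have "IT.C 0 n (\<lambda>_. undefined) = IT.CI {0..<n}"
    using IT.distr_C[of n "IT.up_to {0..<n}" "\<lambda>_. undefined" 0] by (simp add: IT.CI_def space_PiM)
  then show ?thesis using IT.distr_lim[of "{0..<n}"] by (simp add: play_eq)
qed

lemma prob_space_play: "prob_space (play z \<sigma> \<tau>)"
proof (rule prob_space_distrD[OF measurable_restrict_play])
  show "prob_space (distr (play z \<sigma> \<tau>) (PiM {0..<0} (\<lambda>_. borel)) (\<lambda>\<omega>. restrict \<omega> {0..<0}))"
    unfolding distr_play by (rule IT.prob_space_C) (simp add: space_PiM)
qed

text \<open>The law of the first \<open>Suc n\<close> states is the law of the first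
  \<open>n\<close> followed by the kernel; both finite laws are pulled back to the same infinite
  play.\<close>

lemma integral_play_step:
  fixes g :: "(nat \<Rightarrow> 'a \<times> 'b) \<Rightarrow> real"
  assumes g: "g \<in> borel_measurable (PiM {0..<Suc n} (\<lambda>_. borel))" and B: "\<And>h. \<bar>g h\<bar> \<le> B"
  shows "(\<integral>\<omega>. g (restrict \<omega> {0..<Suc n}) \<partial>play z \<sigma> \<tau>) =
    (\<integral>\<omega>. (\<integral>x. g ((restrict \<omega> {0..<n})(n := x)) \<partial>step z \<sigma> \<tau> n (restrict \<omega> {0..<n})) \<partial>play z \<sigma> \<tau>)"
proof -
  let ?u = "\<lambda>_::nat. undefined :: 'a \<times> 'b"
  have u0: "?u \<in> space (PiM {0..<0} (\<lambda>_. borel))" by (simp add: space_PiM)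
  have spC: "space (IT.C 0 n ?u) = space (PiM {0..<n} (\<lambda>_. borel))" using IT.space_C[OF u0, of n] by simp
  have seC: "sets (IT.C 0 n ?u) = sets (PiM {0..<n} (\<lambda>_. borel))" using IT.sets_C[OF u0, of n] by simp
  have eP: "IT.eP n \<in> IT.C 0 n ?u \<rightarrow>\<^sub>M subprob_algebra (PiM {0..<Suc n} (\<lambda>_. borel))"
    by (subst measurable_cong_sets[OF seC refl]) (rule IT.measurable_eP)
  interpret C: prob_space "IT.C 0 n ?u" by (rule IT.prob_space_C[OF u0])
  have "(\<integral>\<omega>. g (restrict \<omega> {0..<Suc n}) \<partial>play z \<sigma> \<tau>) = (\<integral>h. g h \<partial>IT.C 0 (Suc n) ?u)"
    unfolding distr_play[symmetric] by (rule integral_distr[OF measurable_restrict_play g, symmetric])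
  also have "\<dots> = (\<integral>h. (\<integral>x. g x \<partial>IT.eP n h) \<partial>IT.C 0 n ?u)"
    unfolding IT.C.simps add_0
  proof (rule integral_bind[OF g _ eP, where B=B and B'=1])
    show "finite_measure (IT.C 0 n ?u)" by unfold_locales
    show "AE h in IT.C 0 n ?u. emeasure (IT.eP n h) (space (IT.eP n h)) \<le> ennreal 1"
      using prob_space.emeasure_space_1[OF IT.prob_space_eP] by (intro AE_I2) (simp add: spC)
  qed (rule B)
  also have "\<dots> = (\<integral>\<omega>. (\<integral>x. g x \<partial>IT.eP n (restrict \<omega> {0..<n})) \<partial>play z \<sigma> \<tau>)"
    unfolding distr_play[symmetric]
    by (rule integral_distr[OF measurable_restrict_play])
      (rule measurable_compose[OF IT.measurable_eP integral_measurable_subprob_algebra[OF g]])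
  also have "\<dots> = (\<integral>\<omega>. (\<integral>x. g ((restrict \<omega> {0..<n})(n := x)) \<partial>step z \<sigma> \<tau> n (restrict \<omega> {0..<n})) \<partial>play z \<sigma> \<tau>)"
  proof (rule Bochner_Integration.integral_cong[OF refl])
    fix \<omega> :: "nat \<Rightarrow> 'a \<times> 'b"
    have h: "restrict \<omega> {0..<n} \<in> space (PiM {0..<n} (\<lambda>_. borel))" by (simp add: space_PiM)
    have m: "fun_upd (restrict \<omega> {0..<n}) n \<in> step z \<sigma> \<tau> n (restrict \<omega> {0..<n}) \<rightarrow>\<^sub>M PiM {0..<Suc n} (\<lambda>_. borel)"
      by (subst measurable_cong_sets[OF IT.sets_P[OF h] refl])
        (rule measurable_fun_upd[where J="{0..<n}"], use h in \<open>auto simp: measurable_const\<close>)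
    show "(\<integral>x. g x \<partial>IT.eP n (restrict \<omega> {0..<n})) = (\<integral>x. g ((restrict \<omega> {0..<n})(n := x)) \<partial>step z \<sigma> \<tau> n (restrict \<omega> {0..<n}))"
      unfolding IT.eP_def by (rule integral_distr[OF m g])
  qed
  finally show ?thesis .
qed

lemma measurable_coordinate: "(i::nat) < n \<Longrightarrow> (\<lambda>h. h i) \<in> PiM {0..<n} (\<lambda>_. borel) \<rightarrow>\<^sub>M borel"
  by (rule measurable_component_singleton) simp

lemma integral_play_initial:
  assumes g: "g \<in> bounded_measurable"
  shows "(\<integral>\<omega>. g (\<omega> 0) \<partial>play z \<sigma> \<tau>) = g z"
proof -
  interpret prob_space "play z \<sigma> \<tau>" by (rule prob_space_play)
  obtain B where B: "g \<in> borel_measurable borel" "\<And>z. \<bar>g z\<bar> \<le> B" using g by (rule bounded_measurableE) (rule that)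
  have "(\<lambda>h. g (h 0)) \<in> borel_measurable (PiM {0..<Suc 0} (\<lambda>_. borel))"
    by (rule measurable_compose[OF measurable_coordinate B(1)]) simp
  from integral_play_step[OF this B(2)] show ?thesis
    using integral_return[OF _ B(1)] by (simp add: step_def prob_space)
qed

lemma measurable_play_component: "(\<lambda>\<omega>. \<omega> i) \<in> play z \<sigma> \<tau> \<rightarrow>\<^sub>M borel"
  by (subst measurable_cong_sets[OF sets_play refl]) (rule measurable_component_singleton, simp)

text \<open>The coordinate \<open>\<omega> i\<close> is the pair of states at stage
  \<open>i + 1\<close>, so the moves made from it are those of index \<open>Suc i\<close>, which see
  the first \<open>Suc i\<close> pairs.\<close>

lemma gambling_process_play:
  "gambling_process \<Gamma> \<Lambda> (play z \<sigma> \<tau>) (\<lambda>i \<omega>. fst (\<omega> i)) (\<lambda>i \<omega>. snd (\<omega> i))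
    (\<lambda>i \<omega>. \<sigma> (Suc i) (restrict \<omega> {0..<Suc i})) (\<lambda>i \<omega>. \<tau> (Suc i) (restrict \<omega> {0..<Suc i}))"
  unfolding gambling_process_def
proof (intro conjI allI ballI prob_space_play)
  fix i
  have fs: "fst \<in> borel \<rightarrow>\<^sub>M (borel :: 'a measure)" "snd \<in> borel \<rightarrow>\<^sub>M (borel :: 'b measure)"
    by (intro continuous_imp_borel continuous_intros)+
  show "(\<lambda>\<omega>. fst (\<omega> i)) \<in> play z \<sigma> \<tau> \<rightarrow>\<^sub>M borel" "(\<lambda>\<omega>. snd (\<omega> i)) \<in> play z \<sigma> \<tau> \<rightarrow>\<^sub>M borel"
    by (rule measurable_compose[OF measurable_play_component fs(1)], rule measurable_compose[OF measurable_play_component fs(2)])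
  have \<sigma>m: "\<sigma> (Suc i) \<in> PiM {0..<Suc i} (\<lambda>_. borel) \<rightarrow>\<^sub>M prob_algebra borel"
    and \<sigma>\<Gamma>: "\<And>h. h \<in> space (hist (Suc i)) \<Longrightarrow> \<sigma> (Suc i) h \<in> \<Gamma> (fst (h i))"
    using \<sigma> unfolding strategy1_def hist_def by force+
  have \<tau>m: "\<tau> (Suc i) \<in> PiM {0..<Suc i} (\<lambda>_. borel) \<rightarrow>\<^sub>M prob_algebra borel"
    and \<tau>\<Lambda>: "\<And>h. h \<in> space (hist (Suc i)) \<Longrightarrow> \<tau> (Suc i) h \<in> \<Lambda> (snd (h i))"
    using \<tau> unfolding strategy2_def hist_def by force+
  show S: "(\<lambda>\<omega>. \<sigma> (Suc i) (restrict \<omega> {0..<Suc i})) \<in> play z \<sigma> \<tau> \<rightarrow>\<^sub>M prob_algebra borel"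
    by (rule measurable_compose[OF measurable_restrict_play \<sigma>m])
  show R: "(\<lambda>\<omega>. \<tau> (Suc i) (restrict \<omega> {0..<Suc i})) \<in> play z \<sigma> \<tau> \<rightarrow>\<^sub>M prob_algebra borel"
    by (rule measurable_compose[OF measurable_restrict_play \<tau>m])
  have h: "restrict \<omega> {0..<Suc i} \<in> space (hist (Suc i))" for \<omega> :: "nat \<Rightarrow> 'a \<times> 'b"
    by (simp add: hist_def space_PiM)
  show "\<sigma> (Suc i) (restrict \<omega> {0..<Suc i}) \<in> \<Gamma> (fst (\<omega> i))" for \<omega> using \<sigma>\<Gamma>[OF h[of \<omega>]] by simp
  show "\<tau> (Suc i) (restrict \<omega> {0..<Suc i}) \<in> \<Lambda> (snd (\<omega> i))" for \<omega> using \<tau>\<Lambda>[OF h[of \<omega>]] by simp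
  fix f :: "('a \<times> 'b) \<times> ('a \<times> 'b) \<Rightarrow> real" assume f: "f \<in> bounded_measurable"
  obtain B where B: "f \<in> borel_measurable borel" "\<And>z. \<bar>f z\<bar> \<le> B" using f by (rule bounded_measurableE) (rule that)
  have "(\<lambda>h. (h i, h (Suc i))) \<in> PiM {0..<Suc (Suc i)} (\<lambda>_. borel) \<rightarrow>\<^sub>M (borel :: (('a \<times> 'b) \<times> ('a \<times> 'b)) measure)"
    by (intro borel_measurable_Pair measurable_coordinate) auto
  from measurable_compose[OF this B(1)]
  have "(\<lambda>h. f (h i, h (Suc i))) \<in> borel_measurable (PiM {0..<Suc (Suc i)} (\<lambda>_. borel))" .
  from integral_play_step[OF this B(2)]
  have "(\<integral>\<omega>. f (\<omega> i, \<omega> (Suc i)) \<partial>play z \<sigma> \<tau>) = (\<integral>\<omega>. (\<integral>x. f (\<omega> i, x) \<partial>step z \<sigma> \<tau> (Suc i) (restrict \<omega> {0..<Suc i})) \<partial>play z \<sigma> \<tau>)"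
    by simp
  also have "\<dots> = (\<integral>\<omega>. mext (\<lambda>z. f (\<omega> i, z)) (\<sigma> (Suc i) (restrict \<omega> {0..<Suc i})) (\<tau> (Suc i) (restrict \<omega> {0..<Suc i})) \<partial>play z \<sigma> \<tau>)"
  proof (rule Bochner_Integration.integral_cong[OF refl])
    fix \<omega> assume w: "\<omega> \<in> space (play z \<sigma> \<tau>)"
    show "(\<integral>x. f (\<omega> i, x) \<partial>step z \<sigma> \<tau> (Suc i) (restrict \<omega> {0..<Suc i})) =
        mext (\<lambda>z. f (\<omega> i, z)) (\<sigma> (Suc i) (restrict \<omega> {0..<Suc i})) (\<tau> (Suc i) (restrict \<omega> {0..<Suc i}))"
      using mext_Fubini(2)[OF sections_bounded_measurable(2)[OF f] prob_algebra_borel_Delta[OF S w] prob_algebra_borel_Delta[OF R w]]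
      by (simp add: step_def)
  qed
  finally show "(\<integral>\<omega>. f ((fst (\<omega> i), snd (\<omega> i)), (fst (\<omega> (Suc i)), snd (\<omega> (Suc i)))) \<partial>play z \<sigma> \<tau>) =
    (\<integral>\<omega>. mext (\<lambda>z. f ((fst (\<omega> i), snd (\<omega> i)), z)) (\<sigma> (Suc i) (restrict \<omega> {0..<Suc i})) (\<tau> (Suc i) (restrict \<omega> {0..<Suc i})) \<partial>play z \<sigma> \<tau>)"
    by simp
qed

lemma mean_payoff_eq:
  assumes u: "u \<in> bounded_measurable"
  shows "mean_payoff u n z \<sigma> \<tau> = (\<Sum>i<n. \<integral>\<omega>. u (\<omega> i) \<partial>play z \<sigma> \<tau>) / real n"
proof -
  have i: "integrable (play z \<sigma> \<tau>) (\<lambda>\<omega>. u (\<omega> i))" for i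
    using process_integrable[OF gambling_process_play u, of i i] by simp
  have "(\<Sum>t=1..n. u (\<omega> (t - 1))) = (\<Sum>i<n. u (\<omega> i))" for \<omega> :: "nat \<Rightarrow> 'a \<times> 'b"
    by (rule sum.reindex_bij_witness[of _ Suc "\<lambda>t. t - 1"]) auto
  then show ?thesis using i by (simp add: mean_payoff_def)
qed

end

section \<open>Solutions, guarantees and uniqueness\<close>

lemma mext_neg_swap:
  fixes f :: "'a::second_countable_topology \<times> 'b::second_countable_topology \<Rightarrow> real"
  assumes "f \<in> bounded_measurable" "p \<in> Delta" "q \<in> Delta"
  shows "mext (\<lambda>z. - f (snd z, fst z)) q p = - mext f p q"
  using mext_swap[OF assms, of "-1"] by simp

lemma bounded_measurable_neg_swap:
  fixes f :: "'a::topological_space \<times> 'b::topological_space \<Rightarrow> real"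
  assumes "f \<in> bounded_measurable"
  shows "(\<lambda>z. - f (snd z, fst z)) \<in> bounded_measurable"
proof -
  have "(\<lambda>z. (snd z, fst z)) \<in> borel \<rightarrow>\<^sub>M (borel :: ('a \<times> 'b) measure)"
    by (intro continuous_imp_borel continuous_intros)
  from bounded_measurable_compose[OF assms this] obtain B where
    B: "(\<lambda>z. f (snd z, fst z)) \<in> borel_measurable borel" "\<And>z. \<bar>f (snd z, fst z)\<bar> \<le> B"
    by (rule bounded_measurableE) (rule that)
  from borel_measurable_uminus[OF B(1)] show ?thesis
    by (rule bounded_measurableI[where B=B]) (use B(2) in simp)
qed

lemma mext_return_both:
  fixes f :: "'a::second_countable_topology \<times> 'b::second_countable_topology \<Rightarrow> real"
  assumes "f \<in> bounded_measurable"
  shows "mext f (return borel x) (return borel y) = f (x, y)"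
proof -
  obtain B where "(\<lambda>y. f (x, y)) \<in> borel_measurable borel"
    using sections_bounded_measurable(2)[OF assms] by (rule bounded_measurableE) (rule that)
  then show ?thesis unfolding mext_return_left[OF assms] by (intro integral_return) auto
qed

text \<open>In \<open>adapted_guarantee\<close> the bound \<open>N\<close> is chosen before the
  process. All plays live on one sample type, so the same \<open>N\<close> serves every initial
  state and every opponent.\<close>

lemma guarantee_of_adapted:
  fixes \<Gamma> :: "'a::compact_metric_space \<Rightarrow> 'a measure set" and \<Lambda> :: "'b::compact_metric_space \<Rightarrow> 'b measure set"
  assumes \<Gamma>: "gambling_house \<Gamma>" "vanishing_L1_variation \<Gamma>" and u: "continuous_on UNIV u" and v: "v \<in> bounded_measurable"
    and dep: "\<And>x y q. q \<in> \<Lambda> y \<Longrightarrow> v (x, y) \<le> mext v (return borel x) q"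
    and strat: "strategy1 \<Gamma> \<sigma>" "adapted1 u v \<sigma>"
  shows "uniformly_guarantees1 \<Lambda> u \<sigma> v"
  unfolding uniformly_guarantees1_def
proof (intro allI impI)
  fix e :: real assume e: "e > 0"
  note ub = continuous_bounded_measurable[OF u]
  have lv: "leavable \<Gamma>" using \<Gamma>(1) by (simp add: gambling_house_def)
  have dep': "\<forall>x y. \<forall>q\<in>\<Lambda> y. v (x, y) \<le> mext v (return borel x) q" using dep by blast
  from adapted_guarantee[OF lv \<Gamma>(2) u v dep' e, where 'm="nat \<Rightarrow> 'a \<times> 'b"] obtain N where N: "N \<ge> 1"
    "\<forall>n\<ge>N. \<forall>(M :: (nat \<Rightarrow> 'a \<times> 'b) measure) X Y S R. gambling_process \<Gamma> \<Lambda> M X Y S R \<longrightarrow>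
    (\<forall>i. \<forall>\<omega>\<in>space M. v (X i \<omega>, Y i \<omega>) \<le> mext v (S i \<omega>) (return borel (Y i \<omega>)) \<and>
      mext v (S i \<omega>) (return borel (Y i \<omega>)) \<le> mext u (S i \<omega>) (return borel (Y i \<omega>))) \<longrightarrow>
    real n * ((\<integral>\<omega>. v (X 0 \<omega>, Y 0 \<omega>) \<partial>M) - e) \<le> (\<Sum>i<n. \<integral>\<omega>. u (X i \<omega>, Y i \<omega>) \<partial>M)"
    by (elim exE conjE)
  have "mean_payoff u n z \<sigma> \<tau> \<ge> v z - e" if n: "n \<ge> N" and \<tau>: "strategy2 \<Lambda> \<tau>" for n z \<tau>
  proof -
    interpret strategy_pair \<Gamma> \<Lambda> \<sigma> \<tau> z by unfold_locales (rule strat(1) \<tau>)+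
    have ad: "v (fst (\<omega> i), snd (\<omega> i)) \<le> mext v (\<sigma> (Suc i) (restrict \<omega> {0..<Suc i})) (return borel (snd (\<omega> i))) \<and>
      mext v (\<sigma> (Suc i) (restrict \<omega> {0..<Suc i})) (return borel (snd (\<omega> i))) \<le>
      mext u (\<sigma> (Suc i) (restrict \<omega> {0..<Suc i})) (return borel (snd (\<omega> i)))" for i \<omega>
    proof -
      have "restrict \<omega> {0..<Suc i} \<in> space (hist (Suc i))" by (simp add: hist_def space_PiM)
      then show ?thesis using strat(2)[unfolded adapted1_def, rule_format, of "Suc i" "restrict \<omega> {0..<Suc i}" "fst (\<omega> i)" "snd (\<omega> i)"]
        by simp
    qed
    have "real n * ((\<integral>\<omega>. v (fst (\<omega> 0), snd (\<omega> 0)) \<partial>play z \<sigma> \<tau>) - e) \<le>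
        (\<Sum>i<n. \<integral>\<omega>. u (fst (\<omega> i), snd (\<omega> i)) \<partial>play z \<sigma> \<tau>)"
      using N(2) n gambling_process_play ad by blast
    then have "real n * (v z - e) \<le> (\<Sum>i<n. \<integral>\<omega>. u (\<omega> i) \<partial>play z \<sigma> \<tau>)"
      by (simp add: integral_play_initial[OF v])
    moreover have "real n > 0" using n N(1) by simp
    ultimately show ?thesis unfolding mean_payoff_eq[OF ub] by (simp add: le_divide_eq mult.commute)
  qed
  then show "\<exists>N. \<forall>n\<ge>N. \<forall>z \<tau>. strategy2 \<Lambda> \<tau> \<longrightarrow> v z - e \<le> mean_payoff u n z \<sigma> \<tau>" by blast
qed

text \<open>The swapped play is a gambling process in which player 2 comes first; with
  \<open>- u\<close> and \<open>- v\<close> it falls under \<open>adapted_guarantee\<close>, where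
  excessiveness of \<open>v\<close> takes the place of depressiveness.\<close>

lemma guarantee_of_adapted2:
  fixes \<Gamma> :: "'a::compact_metric_space \<Rightarrow> 'a measure set" and \<Lambda> :: "'b::compact_metric_space \<Rightarrow> 'b measure set"
  assumes \<Lambda>: "gambling_house \<Lambda>" "vanishing_L1_variation \<Lambda>" and u: "continuous_on UNIV u" and v: "v \<in> bounded_measurable"
    and \<Gamma>: "gambling_house \<Gamma>"
    and exc: "\<And>x y p. p \<in> \<Gamma> x \<Longrightarrow> mext v p (return borel y) \<le> v (x, y)"
    and strat: "strategy2 \<Lambda> \<tau>" "adapted2 u v \<tau>"
  shows "uniformly_guarantees2 \<Gamma> u \<tau> v"
  unfolding uniformly_guarantees2_def
proof (intro allI impI)
  fix e :: real assume e: "e > 0"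
  let ?u = "\<lambda>z. - u (snd z, fst z)" and ?v = "\<lambda>z. - v (snd z, fst z)"
  note ub = continuous_bounded_measurable[OF u]
  have lv: "leavable \<Lambda>" using \<Lambda>(1) by (simp add: gambling_house_def)
  have dep: "\<forall>y x. \<forall>p\<in>\<Gamma> x. ?v (y, x) \<le> mext ?v (return borel y) p"
  proof (intro allI ballI)
    fix x y p assume p: "p \<in> \<Gamma> x"
    show "?v (y, x) \<le> mext ?v (return borel y) p"
      using exc[OF p, of y] mext_neg_swap[OF v houseD(1)[OF \<Gamma> p] return_in_Delta, of y] by simp
  qed
  from adapted_guarantee[where v="?v" and \<Lambda>=\<Gamma> and 'm="nat \<Rightarrow> 'a \<times> 'b",
      OF lv \<Lambda>(2) continuous_swap[OF u] bounded_measurable_neg_swap[OF v] dep e]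
  obtain N where N: "N \<ge> 1"
    "\<forall>n\<ge>N. \<forall>(M :: (nat \<Rightarrow> 'a \<times> 'b) measure) X Y S R. gambling_process \<Lambda> \<Gamma> M X Y S R \<longrightarrow>
    (\<forall>i. \<forall>\<omega>\<in>space M. ?v (X i \<omega>, Y i \<omega>) \<le> mext ?v (S i \<omega>) (return borel (Y i \<omega>)) \<and>
      mext ?v (S i \<omega>) (return borel (Y i \<omega>)) \<le> mext ?u (S i \<omega>) (return borel (Y i \<omega>))) \<longrightarrow>
    real n * ((\<integral>\<omega>. ?v (X 0 \<omega>, Y 0 \<omega>) \<partial>M) - e) \<le> (\<Sum>i<n. \<integral>\<omega>. ?u (X i \<omega>, Y i \<omega>) \<partial>M)"
    by (elim exE conjE)
  have "mean_payoff u n z \<sigma> \<tau> \<le> v z + e" if n: "n \<ge> N" and \<sigma>: "strategy1 \<Gamma> \<sigma>" for n z \<sigma>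
  proof -
    interpret strategy_pair \<Gamma> \<Lambda> \<sigma> \<tau> z by unfold_locales (rule \<sigma> strat(1))+
    have ad: "?v (snd (\<omega> i), fst (\<omega> i)) \<le> mext ?v (\<tau> (Suc i) (restrict \<omega> {0..<Suc i})) (return borel (fst (\<omega> i))) \<and>
      mext ?v (\<tau> (Suc i) (restrict \<omega> {0..<Suc i})) (return borel (fst (\<omega> i))) \<le>
      mext ?u (\<tau> (Suc i) (restrict \<omega> {0..<Suc i})) (return borel (fst (\<omega> i)))" for i \<omega>
    proof -
      have h: "restrict \<omega> {0..<Suc i} \<in> space (hist (Suc i))" by (simp add: hist_def space_PiM)
      have D: "\<tau> (Suc i) (restrict \<omega> {0..<Suc i}) \<in> Delta"
        using strat(1)[unfolded strategy2_def, rule_format, of "Suc i"] h houseD(1)[OF \<Lambda>(1)] by auto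
      show ?thesis
        using strat(2)[unfolded adapted2_def, rule_format, of "Suc i" "restrict \<omega> {0..<Suc i}" "fst (\<omega> i)" "snd (\<omega> i)"] h
        by (simp add: mext_neg_swap[OF v return_in_Delta D] mext_neg_swap[OF ub return_in_Delta D])
    qed
    have "real n * ((\<integral>\<omega>. ?v (snd (\<omega> 0), fst (\<omega> 0)) \<partial>play z \<sigma> \<tau>) - e) \<le>
        (\<Sum>i<n. \<integral>\<omega>. ?u (snd (\<omega> i), fst (\<omega> i)) \<partial>play z \<sigma> \<tau>)"
      using N(2) n gambling_process_swap[OF gambling_process_play] ad by blast
    then have "real n * (- v z - e) \<le> - (\<Sum>i<n. \<integral>\<omega>. u (\<omega> i) \<partial>play z \<sigma> \<tau>)"
      by (simp add: integral_play_initial[OF v] sum_negf)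
    then have "(\<Sum>i<n. \<integral>\<omega>. u (\<omega> i) \<partial>play z \<sigma> \<tau>) \<le> (v z + e) * real n" by (simp add: algebra_simps)
    moreover have "real n > 0" using n N(1) by simp
    ultimately show ?thesis unfolding mean_payoff_eq[OF ub] by (simp add: divide_le_eq)
  qed
  then show "\<exists>N. \<forall>n\<ge>N. \<forall>z \<sigma>. strategy1 \<Gamma> \<sigma> \<longrightarrow> mean_payoff u n z \<sigma> \<tau> \<le> v z + e" by blast
qed

section \<open>Functional equations, their selections and finite horizon bounds\<close>

context two_houses
begin

text \<open>The functional equations reduced to inequalities, the form in which limits and the
  exchange of players deliver them and in which estimates consume them.\<close>

definition solution :: "('a \<times> 'b \<Rightarrow> real) \<Rightarrow> ('a \<times> 'b \<Rightarrow> real) \<Rightarrow> bool" where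
  "solution u v \<longleftrightarrow> v \<in> bounded_measurable \<and>
     (\<forall>x y. \<forall>p\<in>\<Gamma> x. mext v p (return borel y) \<le> v (x, y)) \<and>
     (\<forall>x y. \<forall>q\<in>\<Lambda> y. v (x, y) \<le> mext v (return borel x) q) \<and>
     (\<forall>x y. \<exists>p\<in>\<Gamma> x. v (x, y) \<le> mext v p (return borel y) \<and> mext v p (return borel y) \<le> mext u p (return borel y)) \<and>
     (\<forall>x y. \<exists>q\<in>\<Lambda> y. mext v (return borel x) q \<le> v (x, y) \<and> mext u (return borel x) q \<le> mext v (return borel x) q)"

lemma solutionD:
  assumes "solution u v"
  shows "v \<in> bounded_measurable" "p \<in> \<Gamma> x \<Longrightarrow> mext v p (return borel y) \<le> v (x, y)"
    "q \<in> \<Lambda> y \<Longrightarrow> v (x, y) \<le> mext v (return borel x) q"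
    "\<exists>p\<in>\<Gamma> x. v (x, y) \<le> mext v p (return borel y) \<and> mext v p (return borel y) \<le> mext u p (return borel y)"
    "\<exists>q\<in>\<Lambda> y. mext v (return borel x) q \<le> v (x, y) \<and> mext u (return borel x) q \<le> mext v (return borel x) q"
  using assms unfolding solution_def by blast+

text \<open>Leavability lets the Dirac mass attain the maximum in \<open>excessive\<close> and the
  minimum in \<open>depressive\<close>; the equalities in \<open>Q1\<close> and \<open>Q2\<close>
  each combine two opposite inequalities.\<close>

lemma solution_iff:
  "solution u v \<longleftrightarrow> v \<in> bounded_measurable \<and> excessive \<Gamma> v \<and> depressive \<Lambda> v \<and> Q1 \<Gamma> u v \<and> Q2 \<Lambda> u v"
proof
  assume s: "solution u v"
  note D = solutionD[OF s]
  have d: "mext v (return borel x) (return borel y) = v (x, y)" for x y by (rule mext_return_both[OF D(1)])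
  have "excessive \<Gamma> v"
    unfolding excessive_def using D(2) houseD(4)[OF \<Gamma>] d by metis
  moreover have "depressive \<Lambda> v"
    unfolding depressive_def using D(3) houseD(4)[OF \<Lambda>] d by metis
  moreover have "Q1 \<Gamma> u v" unfolding Q1_def using D(2,4) by (meson order_antisym)
  moreover have "Q2 \<Lambda> u v" unfolding Q2_def using D(3,5) by (meson order_antisym)
  ultimately show "v \<in> bounded_measurable \<and> excessive \<Gamma> v \<and> depressive \<Lambda> v \<and> Q1 \<Gamma> u v \<and> Q2 \<Lambda> u v" using D(1) by blast
next
  assume "v \<in> bounded_measurable \<and> excessive \<Gamma> v \<and> depressive \<Lambda> v \<and> Q1 \<Gamma> u v \<and> Q2 \<Lambda> u v"
  then show "solution u v"
    unfolding solution_def excessive_def depressive_def Q1_def Q2_def by (metis order_refl)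
qed

text \<open>Continuity of \<open>v\<close> makes the adaptedness inequalities stable under limits,
  as \<open>closed_selection\<close> demands.\<close>

lemma adapted_selection:
  assumes u: "continuous_on UNIV u" and v: "continuous_on UNIV v" and s: "solution u v"
  shows "\<exists>s. s \<in> borel \<rightarrow>\<^sub>M prob_algebra borel \<and> (\<forall>x y. s (x, y) \<in> \<Gamma> x \<and>
    v (x, y) \<le> mext v (s (x, y)) (return borel y) \<and> mext v (s (x, y)) (return borel y) \<le> mext u (s (x, y)) (return borel y))"
proof (rule closed_selection[OF solutionD(4)[OF s]])
  fix p :: "nat \<Rightarrow> 'a measure" and p' x x' y y'
  assume p: "\<And>n. p n \<in> \<Gamma> (x n)"
    and R: "\<And>n. v (x n, y n) \<le> mext v (p n) (return borel (y n)) \<and> mext v (p n) (return borel (y n)) \<le> mext u (p n) (return borel (y n))"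
    and lim: "x \<longlonglongrightarrow> x'" "y \<longlonglongrightarrow> y'" "p' \<in> \<Gamma> x'" "(\<lambda>n. dKR (p n) p') \<longlonglongrightarrow> 0"
  have m: "(\<lambda>n. mext f (p n) (return borel (y n))) \<longlonglongrightarrow> mext f p' (return borel y')" if "continuous_on UNIV f" for f
    by (rule mext_tendsto[OF that \<Gamma>_Delta[OF p] \<Gamma>_Delta[OF lim(3)] lim(4) return_in_Delta return_in_Delta return_tendsto[OF lim(2)]])
  have "(\<lambda>n. v (x n, y n)) \<longlonglongrightarrow> v (x', y')"
    using continuous_on_tendsto_compose[OF v tendsto_Pair[OF lim(1,2)]] by simp
  then have "v (x', y') \<le> mext v p' (return borel y')" by (rule LIMSEQ_le[OF _ m[OF v]]) (use R in blast)
  moreover have "mext v p' (return borel y') \<le> mext u p' (return borel y')" by (rule LIMSEQ_le[OF m[OF v] m[OF u]]) (use R in blast)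
  ultimately show "v (x', y') \<le> mext v p' (return borel y') \<and> mext v p' (return borel y') \<le> mext u p' (return borel y')" ..
qed

text \<open>The selection may vary with the stage, since optimal moves in a finite game depend on
  the number of stages left.\<close>

lemma strategy1_of_selections:
  fixes s :: "nat \<Rightarrow> 'a \<times> 'b \<Rightarrow> 'a measure"
  assumes "\<And>t. s t \<in> borel \<rightarrow>\<^sub>M prob_algebra borel" "\<And>t x y. s t (x, y) \<in> \<Gamma> x"
  shows "strategy1 \<Gamma> (\<lambda>t h. s t (h (t - 1)))"
  unfolding strategy1_def
proof (intro allI impI conjI ballI)
  fix t :: nat assume t: "t \<ge> 1"
  have "(\<lambda>h. h (t - 1)) \<in> hist t \<rightarrow>\<^sub>M (borel :: ('a \<times> 'b) measure)"
    unfolding hist_def by (rule measurable_component_singleton) (use t in auto)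
  from measurable_compose[OF this assms(1)] show "(\<lambda>h. s t (h (t - 1))) \<in> hist t \<rightarrow>\<^sub>M prob_algebra borel" .
  show "s t (h (t - 1)) \<in> \<Gamma> (fst (h (t - 1)))" for h :: "nat \<Rightarrow> 'a \<times> 'b"
    using assms(2)[of t "fst (h (t - 1))" "snd (h (t - 1))"] by simp
qed

lemma strategy2_of_selection:
  fixes r :: "'b \<times> 'a \<Rightarrow> 'b measure"
  assumes "r \<in> borel \<rightarrow>\<^sub>M prob_algebra borel" "\<And>y x. r (y, x) \<in> \<Lambda> y"
  shows "strategy2 \<Lambda> (\<lambda>t h. r (snd (h (t - 1)), fst (h (t - 1))))"
  unfolding strategy2_def
proof (intro allI impI conjI ballI)
  fix t :: nat assume t: "t \<ge> 1"
  have 1: "(\<lambda>h. h (t - 1)) \<in> hist t \<rightarrow>\<^sub>M (borel :: ('a \<times> 'b) measure)"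
    unfolding hist_def by (rule measurable_component_singleton) (use t in auto)
  have "(\<lambda>z. (snd z, fst z)) \<in> (borel :: ('a \<times> 'b) measure) \<rightarrow>\<^sub>M (borel :: ('b \<times> 'a) measure)"
    by (intro continuous_imp_borel continuous_intros)
  from measurable_compose[OF measurable_compose[OF 1 this] assms(1)]
  show "(\<lambda>h. r (snd (h (t - 1)), fst (h (t - 1)))) \<in> hist t \<rightarrow>\<^sub>M prob_algebra borel" .
  show "r (snd (h (t - 1)), fst (h (t - 1))) \<in> \<Lambda> (snd (h (t - 1)))" for h :: "nat \<Rightarrow> 'a \<times> 'b"
    by (rule assms(2))
qed

text \<open>Total, not average, value with \<open>k\<close> stages left. Its stage payoff couples
  the next \<open>x\<close> with the current \<open>y\<close>, so that (Q1) bounds it below with no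
  continuity of the solution.\<close>

primrec horizon_value :: "('a \<times> 'b \<Rightarrow> real) \<Rightarrow> nat \<Rightarrow> 'a \<times> 'b \<Rightarrow> real" where
  "horizon_value u 0 = (\<lambda>_. 0)"
| "horizon_value u (Suc k) = Val \<Gamma> \<Lambda> u (horizon_value u k)"

lemma horizon_value_continuous: "continuous_on UNIV u \<Longrightarrow> continuous_on UNIV (horizon_value u k)"
  by (induction k) (auto intro: Val_continuous)

text \<open>A move given by (Q1) earns at least \<open>w\<close> at the current stage, and as
  \<open>w\<close> is depressive its mean does not drop before the continuation, whatever the reply.
  The move is used state by state, so no measurable choice is involved.\<close>

lemma solution_le_horizon_value:
  assumes u: "continuous_on UNIV u" and w: "solution u w"
  shows "real k * w z \<le> horizon_value u k z"
proof (induction k arbitrary: z)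
  case (Suc k)
  obtain x y where z: "z = (x, y)" by (cases z)
  note D = solutionD[OF w] and Uc = horizon_value_continuous[OF u, of k]
  obtain p where p: "p \<in> \<Gamma> x" "w (x, y) \<le> mext w p (return borel y)" "mext w p (return borel y) \<le> mext u p (return borel y)"
    using D(4)[of x y] by blast
  have "(1 + real k) * w (x, y) \<le> Val \<Gamma> \<Lambda> u (horizon_value u k) (x, y)"
  proof (rule Val_ge[OF u Uc p(1)])
    fix q assume q: "q \<in> \<Lambda> y"
    note pD = \<Gamma>_Delta[OF p(1)] and qD = \<Lambda>_Delta[OF q]
    have zb: "(\<lambda>_. 0) \<in> bounded_measurable" by (rule bounded_measurableI[of _ 0]) auto
    have "(\<lambda>z. real k * w z) \<in> bounded_measurable"
    proof -
      obtain B where B: "w \<in> borel_measurable borel" "\<And>z. \<bar>w z\<bar> \<le> B" using D(1) by (rule bounded_measurableE) (rule that)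
      then show ?thesis by (intro bounded_measurableI[of _ "real k * B"]) (auto simp: abs_mult intro: mult_left_mono)
    qed
    from mext_mono[OF this continuous_bounded_measurable[OF Uc] Suc.IH pD qD]
    have "real k * mext w p q \<le> mext (horizon_value u k) p q"
      using mext_lincomb[OF D(1) zb pD qD, of "real k" 0] by simp
    moreover have "w (x, y) \<le> mext w p q"
      using p(2) mext_subharmonic_right[OF D(1) pD qD D(3)[OF q]] by linarith
    then have "real k * w (x, y) \<le> real k * mext w p q" by (intro mult_left_mono) auto
    ultimately show "(1 + real k) * w (x, y) \<le> mext u p (return borel y) + mext (horizon_value u k) p q"
      using p(2,3) by (simp add: distrib_right)
  qed
  then show ?case by (simp add: z)
qed simp

end

lemma solution_swap:
  fixes \<Gamma> :: "'a::compact_metric_space \<Rightarrow> 'a measure set" and \<Lambda> :: "'b::compact_metric_space \<Rightarrow> 'b measure set"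
  assumes h: "two_houses \<Gamma> \<Lambda>" and u: "u \<in> bounded_measurable" and s: "two_houses.solution \<Gamma> \<Lambda> u v"
  shows "two_houses.solution \<Lambda> \<Gamma> (\<lambda>z. - u (snd z, fst z)) (\<lambda>z. - v (snd z, fst z))"
proof -
  interpret two_houses \<Gamma> \<Lambda> by fact
  interpret S: two_houses \<Lambda> \<Gamma> by unfold_locales (rule \<Lambda> \<Gamma>)+
  note D = solutionD[OF s]
  have q: "mext (\<lambda>z. - f (snd z, fst z)) q (return borel x) = - mext f (return borel x) q"
    if "q \<in> \<Lambda> y" "f \<in> bounded_measurable" for f :: "'a \<times> 'b \<Rightarrow> real" and q x y
    by (rule mext_neg_swap[OF that(2) return_in_Delta \<Lambda>_Delta[OF that(1)]])
  have p: "mext (\<lambda>z. - f (snd z, fst z)) (return borel y) p = - mext f p (return borel y)"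
    if "p \<in> \<Gamma> x" "f \<in> bounded_measurable" for f :: "'a \<times> 'b \<Rightarrow> real" and p x y
    by (rule mext_neg_swap[OF that(2) \<Gamma>_Delta[OF that(1)] return_in_Delta])
  show ?thesis
    unfolding S.solution_def fst_conv snd_conv
  proof (intro conjI allI ballI bounded_measurable_neg_swap D(1))
    show "mext (\<lambda>z. - v (snd z, fst z)) q' (return borel x) \<le> - v (x, y)" if "q' \<in> \<Lambda> y" for x y q'
      using D(3)[OF that, of x] q[OF that D(1), of x] by linarith
    show "- v (x, y) \<le> mext (\<lambda>z. - v (snd z, fst z)) (return borel y) p'" if "p' \<in> \<Gamma> x" for x y p'
      using D(2)[OF that, of y] p[OF that D(1), of y] by linarith
    fix x y
    obtain q' where q': "q' \<in> \<Lambda> y" "mext v (return borel x) q' \<le> v (x, y)" "mext u (return borel x) q' \<le> mext v (return borel x) q'"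
      using D(5)[of y x] by blast
    then show "\<exists>p\<in>\<Lambda> y. - v (x, y) \<le> mext (\<lambda>z. - v (snd z, fst z)) p (return borel x) \<and>
        mext (\<lambda>z. - v (snd z, fst z)) p (return borel x) \<le> mext (\<lambda>z. - u (snd z, fst z)) p (return borel x)"
      using q[OF q'(1) D(1), of x] q[OF q'(1) u, of x] by (intro bexI[OF _ q'(1)]) simp
    obtain p' where p': "p' \<in> \<Gamma> x" "v (x, y) \<le> mext v p' (return borel y)" "mext v p' (return borel y) \<le> mext u p' (return borel y)"
      using D(4)[of x y] by blast
    then show "\<exists>q\<in>\<Gamma> x. mext (\<lambda>z. - v (snd z, fst z)) (return borel y) q \<le> - v (x, y) \<and>
        mext (\<lambda>z. - u (snd z, fst z)) (return borel y) q \<le> mext (\<lambda>z. - v (snd z, fst z)) (return borel y) q"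
      using p[OF p'(1) D(1), of y] p[OF p'(1) u, of y] by (intro bexI[OF _ p'(1)]) simp
  qed
qed

section \<open>The limit value solves the equations; comparison of solutions\<close>

context two_houses
begin

lemma limit_value_solution:
  assumes id: "idempotent \<Gamma>" "idempotent \<Lambda>" and u: "continuous_on UNIV u" and v: "limit_value u v"
  shows "solution u v"
proof -
  interpret S: two_houses \<Lambda> \<Gamma> by unfold_locales (rule \<Lambda> \<Gamma>)+
  have h: "two_houses \<Gamma> \<Lambda>" by (rule two_houses_axioms)
  note v' = limit_value_swap[OF h u v] and u' = continuous_swap[OF u]
  have vb: "v \<in> bounded_measurable" using v by (intro continuous_bounded_measurable) (simp add: limit_value_def)
  note ub = continuous_bounded_measurable[OF u]
  note super = limit_value_superharmonic[OF id(1) u v]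
  have sub: "v (x, y) \<le> mext v (return borel x) q" if q: "q \<in> \<Lambda> y" for x y q
    using S.limit_value_superharmonic[OF id(2) u' v' q, of x] mext_neg_swap[OF vb return_in_Delta \<Lambda>_Delta[OF q], of x] by simp
  show ?thesis
    unfolding solution_def
  proof (intro conjI allI ballI vb super sub)
    fix x y
    obtain p where p: "p \<in> \<Gamma> x" "v (x, y) \<le> mext v p (return borel y)" "v (x, y) \<le> mext u p (return borel y)"
      using limit_value_Q1[OF id(1) u v, of x y] by blast
    \<comment> \<open>\<open>limit_value_Q1\<close> bounds \<open>v (x, y)\<close> by the extension
      of \<open>u\<close>; superharmonicity inserts the extension of \<open>v\<close> between
      them.\<close>
    then show "\<exists>p\<in>\<Gamma> x. v (x, y) \<le> mext v p (return borel y) \<and> mext v p (return borel y) \<le> mext u p (return borel y)"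
      using super[OF p(1), of y] by (intro bexI[OF _ p(1)]) simp
    obtain q where q: "q \<in> \<Lambda> y" "- v (x, y) \<le> mext (\<lambda>z. - v (snd z, fst z)) q (return borel x)"
        "- v (x, y) \<le> mext (\<lambda>z. - u (snd z, fst z)) q (return borel x)"
      using S.limit_value_Q1[OF id(2) u' v', of y x] by auto
    then show "\<exists>q\<in>\<Lambda> y. mext v (return borel x) q \<le> v (x, y) \<and> mext u (return borel x) q \<le> mext v (return borel x) q"
      using sub[OF q(1), of x] mext_neg_swap[OF vb return_in_Delta \<Lambda>_Delta[OF q(1)], of x]
        mext_neg_swap[OF ub return_in_Delta \<Lambda>_Delta[OF q(1)], of x] by (intro bexI[OF _ q(1)]) simp
  qed
qed

text \<open>A measurable solution \<open>w\<close> need not admit measurable adapted strategies, so it is compared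
  with the continuous finite-horizon values instead, which player 1 can attain by measurable
  strategies while player 2 follows one adapted to \<open>v\<close>.\<close>

lemma horizon_value_le:
  assumes u: "continuous_on UNIV u" and v: "continuous_on UNIV v" "solution u v"
    and van: "vanishing_L1_variation \<Gamma>" "vanishing_L1_variation \<Lambda>" and e: "e > 0"
  shows "\<exists>n\<ge>1. horizon_value u n z \<le> real n * (v z + e)"
proof -
  interpret S: two_houses \<Lambda> \<Gamma> by unfold_locales (rule \<Lambda> \<Gamma>)+
  let ?u = "\<lambda>z. - u (snd z, fst z)" and ?v = "\<lambda>z. - v (snd z, fst z)"
  note ub = continuous_bounded_measurable[OF u] and vb = continuous_bounded_measurable[OF v(1)]
  note sol' = solution_swap[OF two_houses_axioms ub v(2)]
  note u' = continuous_swap[OF u] and v' = continuous_swap[OF v(1)]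
  note ub' = continuous_bounded_measurable[OF u'] and vb' = continuous_bounded_measurable[OF v']
  have lv: "leavable \<Gamma>" "leavable \<Lambda>" using \<Gamma> \<Lambda> by (simp_all add: gambling_house_def)
  \<comment> \<open>The two bounds below use opposite mixed times, so both coordinates must be
    shifted: each shift costs \<open>e / 4\<close> for the modulus and \<open>e / 4\<close> for the
    displacement of that player.\<close>
  obtain C where C: "C \<ge> 0" "osc2_le (e / 4) C u" using continuous_imp_osc2_le[OF u, of "e / 4"] e by auto
  define e' where "e' = e / (4 * (C + 1))"
  have e': "e' > 0" "(C + 1) * e' = e / 4" using e C(1) by (simp_all add: e'_def field_simps)
  from vanishing_variation_paths[OF lv(1) van(1) e'(1), where 'm="nat \<Rightarrow> 'a \<times> 'b"] obtain N1 where N1: "N1 \<ge> 1"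
    "\<forall>n\<ge>N1. \<forall>(M :: (nat \<Rightarrow> 'a \<times> 'b) measure) X S. house_process \<Gamma> M X S \<longrightarrow> (\<Sum>i<n. \<integral>\<omega>. dist (X i \<omega>) (X (Suc i) \<omega>) \<partial>M) \<le> e' * real n"
    by (elim exE conjE)
  from vanishing_variation_paths[OF lv(2) van(2) e'(1), where 'm="nat \<Rightarrow> 'a \<times> 'b"] obtain N2 where N2: "N2 \<ge> 1"
    "\<forall>n\<ge>N2. \<forall>(M :: (nat \<Rightarrow> 'a \<times> 'b) measure) X S. house_process \<Lambda> M X S \<longrightarrow> (\<Sum>i<n. \<integral>\<omega>. dist (X i \<omega>) (X (Suc i) \<omega>) \<partial>M) \<le> e' * real n"
    by (elim exE conjE)
  define n where "n = max N1 N2"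
  have Uc: "continuous_on UNIV (horizon_value u k)" for k by (rule horizon_value_continuous[OF u])
  note Ub = continuous_bounded_measurable[OF Uc]
  have "\<forall>k. \<exists>s. s \<in> borel \<rightarrow>\<^sub>M prob_algebra borel \<and> (\<forall>x y. s (x, y) \<in> \<Gamma> x \<and>
      (\<forall>q\<in>\<Lambda> y. horizon_value u (Suc k) (x, y) \<le> mext u (s (x, y)) (return borel y) + mext (horizon_value u k) (s (x, y)) q))"
    using Val_selection[OF u Uc] by simp
  then obtain s where s: "\<And>k. s k \<in> borel \<rightarrow>\<^sub>M prob_algebra borel" "\<And>k x y. s k (x, y) \<in> \<Gamma> x"
    "\<And>k x y q. q \<in> \<Lambda> y \<Longrightarrow> horizon_value u (Suc k) (x, y) \<le> mext u (s k (x, y)) (return borel y) + mext (horizon_value u k) (s k (x, y)) q"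
    by metis
  obtain r where r: "r \<in> borel \<rightarrow>\<^sub>M prob_algebra borel" "\<forall>y x. r (y, x) \<in> \<Lambda> y \<and>
      ?v (y, x) \<le> mext ?v (r (y, x)) (return borel x) \<and> mext ?v (r (y, x)) (return borel x) \<le> mext ?u (r (y, x)) (return borel x)"
    using S.adapted_selection[OF u' v' sol'] by (elim exE conjE)
  \<comment> \<open>At stage \<open>t \<le> n\<close> there are \<open>n - t + 1\<close> stages to
    play, and \<open>s (n - t)\<close> is optimal for that horizon. Past stage \<open>n\<close> the
    truncated subtraction yields \<open>s 0\<close>, a harmless default that keeps the strategy
    legal.\<close>
  define \<sigma> :: "('a, 'b, 'a) strategy" where "\<sigma> t h = s (n - t) (h (t - 1))" for t h
  define \<tau> :: "('a, 'b, 'b) strategy" where "\<tau> t h = r (snd (h (t - 1)), fst (h (t - 1)))" for t h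
  have \<sigma>: "strategy1 \<Gamma> \<sigma>" unfolding \<sigma>_def[abs_def] by (rule strategy1_of_selections[of "\<lambda>t. s (n - t)"]) (rule s)+
  have \<tau>: "strategy2 \<Lambda> \<tau>" unfolding \<tau>_def[abs_def] by (rule strategy2_of_selection[OF r(1)]) (use r(2) in blast)
  interpret strategy_pair \<Gamma> \<Lambda> \<sigma> \<tau> z by unfold_locales (rule \<sigma> \<tau>)+
  interpret prob_space "play z \<sigma> \<tau>" by (rule prob_space_play)
  note P = gambling_process_play and P' = gambling_process_swap[OF gambling_process_play]
  let ?M = "play z \<sigma> \<tau>"
  let ?S = "\<lambda>i \<omega>. \<sigma> (Suc i) (restrict \<omega> {0..<Suc i})" and ?R = "\<lambda>i \<omega>. \<tau> (Suc i) (restrict \<omega> {0..<Suc i})"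
  have step: "(\<integral>\<omega>. horizon_value u (n - i) (\<omega> i) \<partial>?M) \<le>
      (\<integral>\<omega>. u (fst (\<omega> (Suc i)), snd (\<omega> i)) \<partial>?M) + (\<integral>\<omega>. horizon_value u (n - Suc i) (\<omega> (Suc i)) \<partial>?M)" if i: "i < n" for i
  proof -
    have ni: "n - i = Suc (n - Suc i)" using i by simp
    have ret: "(\<lambda>\<omega>. return borel (snd (\<omega> i))) \<in> ?M \<rightarrow>\<^sub>M prob_algebra borel"
      by (rule measurable_compose[OF gambling_processD(3)[OF P, of i] measurable_return_prob_space])
    note iu = integrable_mext_kernels[OF prob_space_play ub gambling_processD(4)[OF P, of i] ret]
    note iU = integrable_mext_kernels[OF prob_space_play Ub[of "n - Suc i"] gambling_processD(4,5)[OF P, of i]]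
    have "(\<integral>\<omega>. horizon_value u (n - i) (\<omega> i) \<partial>?M) \<le>
        (\<integral>\<omega>. mext u (?S i \<omega>) (return borel (snd (\<omega> i))) + mext (horizon_value u (n - Suc i)) (?S i \<omega>) (?R i \<omega>) \<partial>?M)"
    proof (rule integral_mono)
      show "integrable ?M (\<lambda>\<omega>. horizon_value u (n - i) (\<omega> i))"
        using process_integrable[OF P Ub, of "n - i" i i] by simp
      show "integrable ?M (\<lambda>\<omega>. mext u (?S i \<omega>) (return borel (snd (\<omega> i))) + mext (horizon_value u (n - Suc i)) (?S i \<omega>) (?R i \<omega>))"
        by (rule Bochner_Integration.integrable_add[OF iu iU])
      fix \<omega> assume w: "\<omega> \<in> space ?M"
      show "horizon_value u (n - i) (\<omega> i) \<le> mext u (?S i \<omega>) (return borel (snd (\<omega> i))) + mext (horizon_value u (n - Suc i)) (?S i \<omega>) (?R i \<omega>)"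
        using s(3)[OF gambling_processD(7)[OF P w, of i], of "n - Suc i" "fst (\<omega> i)"] unfolding ni by (simp add: \<sigma>_def)
    qed
    also have "\<dots> = (\<integral>\<omega>. mext u (?S i \<omega>) (return borel (snd (\<omega> i))) \<partial>?M) + (\<integral>\<omega>. mext (horizon_value u (n - Suc i)) (?S i \<omega>) (?R i \<omega>) \<partial>?M)"
      by (rule Bochner_Integration.integral_add[OF iu iU])
    also have "\<dots> = (\<integral>\<omega>. u (fst (\<omega> (Suc i)), snd (\<omega> i)) \<partial>?M) + (\<integral>\<omega>. horizon_value u (n - Suc i) (\<omega> (Suc i)) \<partial>?M)"
      using process_step(2)[OF P ub, of i] process_step(1)[OF P Ub, of "n - Suc i" i] by simp
    finally show ?thesis .
  qed
  \<comment> \<open>Payoff collected so far plus the value of the remaining horizon; at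
    \<open>m = n\<close> that value is 0.\<close>
  have "horizon_value u n z \<le> (\<Sum>i<m. \<integral>\<omega>. u (fst (\<omega> (Suc i)), snd (\<omega> i)) \<partial>?M) + (\<integral>\<omega>. horizon_value u (n - m) (\<omega> m) \<partial>?M)"
    if "m \<le> n" for m
    using that
  proof (induction m)
    case 0
    then show ?case by (simp add: integral_play_initial[OF Ub])
  next
    case (Suc m)
    then show ?case using step[of m] by simp
  qed
  from this[of n] have upper: "horizon_value u n z \<le> (\<Sum>i<n. \<integral>\<omega>. u (fst (\<omega> (Suc i)), snd (\<omega> i)) \<partial>?M)" by simp
  \<comment> \<open>In the exchanged game the mixed time is reversed: player 2 controls the current
    \<open>x\<close> with the next \<open>y\<close>.\<close>
  have "real n * (\<integral>\<omega>. ?v (snd (\<omega> 0), fst (\<omega> 0)) \<partial>?M) \<le> (\<Sum>i<n. \<integral>\<omega>. ?u (snd (\<omega> (Suc i)), fst (\<omega> i)) \<partial>?M)"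
  proof (rule adapted_sum_ge[OF P' ub' vb'])
    show "?v (y, x) \<le> mext ?v (return borel y) p" if "p \<in> \<Gamma> x" for x y p
      by (rule S.solutionD(3)[OF sol' that])
    show "?v (snd (\<omega> i), fst (\<omega> i)) \<le> mext ?v (?R i \<omega>) (return borel (fst (\<omega> i))) \<and>
        mext ?v (?R i \<omega>) (return borel (fst (\<omega> i))) \<le> mext ?u (?R i \<omega>) (return borel (fst (\<omega> i)))" for i \<omega>
      using spec[OF spec[OF r(2), of "snd (\<omega> i)"], of "fst (\<omega> i)"] by (simp add: \<tau>_def)
  qed
  then have lower: "(\<Sum>i<n. \<integral>\<omega>. u (fst (\<omega> i), snd (\<omega> (Suc i))) \<partial>?M) \<le> real n * v z"
    by (simp add: integral_play_initial[OF vb] sum_negf)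
  have d1: "integrable ?M (\<lambda>\<omega>. dist (fst (\<omega> i)) (fst (\<omega> (Suc i))))" for i by (rule process_dist_integrable[OF P])
  have d2: "integrable ?M (\<lambda>\<omega>. dist (snd (\<omega> i)) (snd (\<omega> (Suc i))))" for i by (rule process_dist_integrable[OF P'])
  let ?d1 = "\<lambda>i. \<integral>\<omega>. dist (fst (\<omega> i)) (fst (\<omega> (Suc i))) \<partial>?M" and ?d2 = "\<lambda>i. \<integral>\<omega>. dist (snd (\<omega> i)) (snd (\<omega> (Suc i))) \<partial>?M"
  have i1: "integrable ?M (\<lambda>\<omega>. u (fst (\<omega> i), snd (\<omega> j)))" for i j using process_integrable[OF P ub] .
  have "(\<integral>\<omega>. u (fst (\<omega> (Suc i)), snd (\<omega> i)) \<partial>?M) \<le> (\<integral>\<omega>. u (fst (\<omega> i), snd (\<omega> (Suc i))) \<partial>?M) + (e / 2 + C * (?d1 i + ?d2 i))" for i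
  proof -
    have "(\<integral>\<omega>. u (fst (\<omega> (Suc i)), snd (\<omega> i)) \<partial>?M) \<le>
        (\<integral>\<omega>. u (fst (\<omega> i), snd (\<omega> (Suc i))) + (e / 2 + C * (dist (fst (\<omega> i)) (fst (\<omega> (Suc i))) + dist (snd (\<omega> i)) (snd (\<omega> (Suc i))))) \<partial>?M)"
    proof (rule integral_mono)
      fix \<omega> :: "nat \<Rightarrow> 'a \<times> 'b"
      have "\<bar>u (fst (\<omega> i), snd (\<omega> i)) - u (fst (\<omega> (Suc i)), snd (\<omega> i))\<bar> \<le> e / 4 + C * dist (fst (\<omega> i)) (fst (\<omega> (Suc i)))"
        "\<bar>u (fst (\<omega> i), snd (\<omega> i)) - u (fst (\<omega> i), snd (\<omega> (Suc i)))\<bar> \<le> e / 4 + C * dist (snd (\<omega> i)) (snd (\<omega> (Suc i)))"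
        using C(2) unfolding osc2_le_def osc_le_def by blast+
      then show "u (fst (\<omega> (Suc i)), snd (\<omega> i)) \<le> u (fst (\<omega> i), snd (\<omega> (Suc i))) + (e / 2 + C * (dist (fst (\<omega> i)) (fst (\<omega> (Suc i))) + dist (snd (\<omega> i)) (snd (\<omega> (Suc i)))))"
        unfolding distrib_left by linarith
    qed (use i1 d1 d2 in auto)
    also have "\<dots> = (\<integral>\<omega>. u (fst (\<omega> i), snd (\<omega> (Suc i))) \<partial>?M) + (e / 2 + C * (?d1 i + ?d2 i))"
      using i1 d1 d2 by (simp add: prob_space)
    finally show ?thesis .
  qed
  then have "(\<Sum>i<n. \<integral>\<omega>. u (fst (\<omega> (Suc i)), snd (\<omega> i)) \<partial>?M) \<le>
      (\<Sum>i<n. (\<integral>\<omega>. u (fst (\<omega> i), snd (\<omega> (Suc i))) \<partial>?M) + (e / 2 + C * (?d1 i + ?d2 i)))" by (intro sum_mono)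
  also have "\<dots> = (\<Sum>i<n. \<integral>\<omega>. u (fst (\<omega> i), snd (\<omega> (Suc i))) \<partial>?M) + (real n * (e / 2) + (C * (\<Sum>i<n. ?d1 i) + C * (\<Sum>i<n. ?d2 i)))"
    by (simp add: sum.distrib sum_distrib_left distrib_left)
  finally have mid: "(\<Sum>i<n. \<integral>\<omega>. u (fst (\<omega> (Suc i)), snd (\<omega> i)) \<partial>?M) \<le>
      (\<Sum>i<n. \<integral>\<omega>. u (fst (\<omega> i), snd (\<omega> (Suc i))) \<partial>?M) + (real n * (e / 2) + (C * (\<Sum>i<n. ?d1 i) + C * (\<Sum>i<n. ?d2 i)))" .
  have Cd: "C * s \<le> e / 4 * real n" if "s \<le> e' * real n" for s
  proof -
    have "C * s \<le> C * (e' * real n)" using C(1) that by (intro mult_left_mono)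
    also have "\<dots> \<le> (C + 1) * e' * real n" using e'(1) by (simp add: distrib_right)
    finally show ?thesis using e'(2) by simp
  qed
  have "n \<ge> N1" "n \<ge> N2" by (simp_all add: n_def)
  then have "(\<Sum>i<n. ?d1 i) \<le> e' * real n" "(\<Sum>i<n. ?d2 i) \<le> e' * real n"
    using N1(2) N2(2) gambling_process_house_process[OF P] gambling_process_house_process[OF P'] by blast+
  from Cd[OF this(1)] Cd[OF this(2)] have "horizon_value u n z \<le> real n * v z + (real n * (e / 2) + (e / 4 * real n + e / 4 * real n))"
    using upper mid lower by linarith
  then have "horizon_value u n z \<le> real n * (v z + e)" by (simp add: algebra_simps)
  then show ?thesis using N1(1) by (intro exI[of _ n]) (simp add: n_def)
qed

lemma solution_le:
  assumes "continuous_on UNIV u" "continuous_on UNIV v" "solution u v" "solution u w"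
    and "vanishing_L1_variation \<Gamma>" "vanishing_L1_variation \<Lambda>"
  shows "w z \<le> v z"
proof (rule field_le_epsilon)
  fix e :: real assume "e > 0"
  then obtain n where n: "n \<ge> 1" "horizon_value u n z \<le> real n * (v z + e)"
    using horizon_value_le[OF assms(1-3,5,6)] by blast
  then have "real n * w z \<le> real n * (v z + e)"
    using solution_le_horizon_value[OF assms(1,4), of n z] by linarith
  then show "w z \<le> v z + e" using n(1) by simp
qed

end

text \<open>The comparison bounds a merely measurable solution by a continuous one. Applied to the
  exchanged game, where \<open>- v\<close> is again continuous, it gives the opposite
  inequality.\<close>

lemma solution_unique:
  fixes \<Gamma> :: "'a::compact_metric_space \<Rightarrow> 'a measure set" and \<Lambda> :: "'b::compact_metric_space \<Rightarrow> 'b measure set"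
  assumes h: "two_houses \<Gamma> \<Lambda>" and u: "continuous_on UNIV u" and v: "continuous_on UNIV v"
    and s: "two_houses.solution \<Gamma> \<Lambda> u v" "two_houses.solution \<Gamma> \<Lambda> u w"
    and van: "vanishing_L1_variation \<Gamma>" "vanishing_L1_variation \<Lambda>"
  shows "w = v"
proof
  fix z
  interpret two_houses \<Gamma> \<Lambda> by fact
  interpret S: two_houses \<Lambda> \<Gamma> by unfold_locales (rule \<Lambda> \<Gamma>)+
  note ub = continuous_bounded_measurable[OF u]
  have "- w (fst z, snd z) \<le> - v (fst z, snd z)"
    using S.solution_le[OF continuous_swap[OF u] continuous_swap[OF v] solution_swap[OF h ub s(1)] solution_swap[OF h ub s(2)] van(2,1), of "(snd z, fst z)"]
    by simp
  then show "w z = v z" using solution_le[OF u v s van, of z] by simp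
qed

theorem theorem7p17:
  fixes \<Gamma> :: "'a::compact_metric_space \<Rightarrow> 'a measure set"
    and \<Lambda> :: "'b::compact_metric_space \<Rightarrow> 'b measure set"
    and u :: "'a \<times> 'b \<Rightarrow> real"
  assumes "standard_gambling_game \<Gamma> \<Lambda> u"
    and "idempotent \<Gamma>" and "idempotent \<Lambda>"
    and "vanishing_L1_variation \<Gamma>" and "vanishing_L1_variation \<Lambda>"
  shows "\<exists>v.
    is_uniform_value \<Gamma> \<Lambda> u v \<and> (\<forall>w. is_uniform_value \<Gamma> \<Lambda> u w \<longrightarrow> w = v) \<and>
    (\<forall>\<sigma>. strategy1 \<Gamma> \<sigma> \<and> adapted1 u v \<sigma> \<longrightarrow> uniformly_guarantees1 \<Lambda> u \<sigma> v) \<and>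
    (\<forall>\<tau>. strategy2 \<Lambda> \<tau> \<and> adapted2 u v \<tau> \<longrightarrow> uniformly_guarantees2 \<Gamma> u \<tau> v) \<and>
    (v \<in> bounded_measurable \<and> excessive \<Gamma> v \<and> depressive \<Lambda> v \<and> Q1 \<Gamma> u v \<and> Q2 \<Lambda> u v) \<and>
    (\<forall>w. w \<in> bounded_measurable \<and> excessive \<Gamma> w \<and> depressive \<Lambda> w \<and> Q1 \<Gamma> u w \<and> Q2 \<Lambda> u w \<longrightarrow> w = v)"
proof -
  have house: "gambling_house \<Gamma>" "gambling_house \<Lambda>" and u: "continuous_on UNIV u"
    using assms(1) by (simp_all add: standard_gambling_game_def)
  interpret two_houses \<Gamma> \<Lambda> by unfold_locales (rule house)+
  interpret S: two_houses \<Lambda> \<Gamma> by unfold_locales (rule house)+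
  have h: "two_houses \<Gamma> \<Lambda>" by (rule two_houses_axioms)
  note ub = continuous_bounded_measurable[OF u]
  obtain v where lv: "limit_value u v" using limit_value_exists[OF u] by blast
  have v: "continuous_on UNIV v" using lv by (simp add: limit_value_def)
  have sol: "solution u v" by (rule limit_value_solution[OF assms(2,3) u lv])
  note D = solutionD[OF sol] and sol' = solution_swap[OF h ub sol]
  have g1: "uniformly_guarantees1 \<Lambda> u \<sigma> v" if "strategy1 \<Gamma> \<sigma>" "adapted1 u v \<sigma>" for \<sigma>
    using guarantee_of_adapted[OF house(1) assms(4) u D(1) D(3) that] by blast
  have g2: "uniformly_guarantees2 \<Gamma> u \<tau> v" if "strategy2 \<Lambda> \<tau>" "adapted2 u v \<tau>" for \<tau>
    using guarantee_of_adapted2[OF house(2) assms(5) u D(1) house(1) D(2) that] by blast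
  obtain s where s: "s \<in> borel \<rightarrow>\<^sub>M prob_algebra borel" "\<forall>x y. s (x, y) \<in> \<Gamma> x \<and>
    v (x, y) \<le> mext v (s (x, y)) (return borel y) \<and> mext v (s (x, y)) (return borel y) \<le> mext u (s (x, y)) (return borel y)"
    using adapted_selection[OF u v sol] by (elim exE conjE)
  let ?u = "\<lambda>z. - u (snd z, fst z)" and ?v = "\<lambda>z. - v (snd z, fst z)"
  obtain r where r: "r \<in> borel \<rightarrow>\<^sub>M prob_algebra borel" "\<forall>y x. r (y, x) \<in> \<Lambda> y \<and>
      ?v (y, x) \<le> mext ?v (r (y, x)) (return borel x) \<and> mext ?v (r (y, x)) (return borel x) \<le> mext ?u (r (y, x)) (return borel x)"
    using S.adapted_selection[OF continuous_swap[OF u] continuous_swap[OF v] sol'] by (elim exE conjE)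
  define \<sigma> :: "('a, 'b, 'a) strategy" where "\<sigma> t h = s (h (t - 1))" for t h
  define \<tau> :: "('a, 'b, 'b) strategy" where "\<tau> t h = r (snd (h (t - 1)), fst (h (t - 1)))" for t h
  have \<sigma>: "strategy1 \<Gamma> \<sigma>"
    unfolding \<sigma>_def[abs_def] by (rule strategy1_of_selections[of "\<lambda>t. s"]) (use s in blast)+
  have \<tau>: "strategy2 \<Lambda> \<tau>" unfolding \<tau>_def[abs_def] by (rule strategy2_of_selection[OF r(1)]) (use r(2) in blast)
  have \<sigma>a: "adapted1 u v \<sigma>" unfolding adapted1_def \<sigma>_def using s(2) by metis
  have \<tau>a: "adapted2 u v \<tau>"
    unfolding adapted2_def
  proof (intro allI impI ballI)
    fix t :: nat and h :: "nat \<Rightarrow> 'a \<times> 'b" and x y assume "h (t - 1) = (x, y)"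
    then have t: "\<tau> t h = r (y, x)" by (simp add: \<tau>_def)
    note R = spec[OF spec[OF r(2), of y], of x]
    note rD = \<Lambda>_Delta[OF conjunct1[OF R]]
    show "mext v (return borel x) (\<tau> t h) \<le> v (x, y) \<and> mext u (return borel x) (\<tau> t h) \<le> mext v (return borel x) (\<tau> t h)"
      using R unfolding t by (simp add: mext_neg_swap[OF D(1) return_in_Delta rD] mext_neg_swap[OF ub return_in_Delta rD])
  qed
  have G1: "uniformly_guarantees1 \<Lambda> u \<sigma> v" and G2: "uniformly_guarantees2 \<Gamma> u \<tau> v"
    by (rule g1[OF \<sigma> \<sigma>a], rule g2[OF \<tau> \<tau>a])
  have val: "is_uniform_value \<Gamma> \<Lambda> u v" unfolding is_uniform_value_def using D(1) \<sigma> \<tau> G1 G2 by blast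
  \<comment> \<open>Playing a strategy that guarantees \<open>w\<close> against one that guarantees
    \<open>w'\<close> bounds the same mean payoff from both sides; used in both directions with
    \<open>v\<close>, this gives uniqueness of the uniform value.\<close>
  have le: "w z \<le> w' z"
    if w: "strategy1 \<Gamma> \<sigma>1" "uniformly_guarantees1 \<Lambda> u \<sigma>1 w" and w': "strategy2 \<Lambda> \<tau>1" "uniformly_guarantees2 \<Gamma> u \<tau>1 w'"
    for w w' \<sigma>1 \<tau>1 z
  proof (rule field_le_epsilon)
    fix e :: real assume "e > 0"
    then have e: "e / 2 > 0" by simp
    obtain N1 where N1: "\<forall>n\<ge>N1. mean_payoff u n z \<sigma>1 \<tau>1 \<ge> w z - e / 2"
      using w(2) w'(1) e unfolding uniformly_guarantees1_def by blast
    obtain N2 where N2: "\<forall>n\<ge>N2. mean_payoff u n z \<sigma>1 \<tau>1 \<le> w' z + e / 2"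
      using w'(2) w(1) e unfolding uniformly_guarantees2_def by blast
    show "w z \<le> w' z + e" using N1[rule_format, of "max N1 N2"] N2[rule_format, of "max N1 N2"] by simp
  qed
  have "w = v" if w: "is_uniform_value \<Gamma> \<Lambda> u w" for w
  proof
    fix z
    obtain \<sigma>1 \<tau>1 where "strategy1 \<Gamma> \<sigma>1" "uniformly_guarantees1 \<Lambda> u \<sigma>1 w" "strategy2 \<Lambda> \<tau>1" "uniformly_guarantees2 \<Gamma> u \<tau>1 w"
      using w unfolding is_uniform_value_def by blast
    then show "w z = v z" using le[OF _ _ \<tau> G2, of \<sigma>1 w z] le[OF \<sigma> G1, of \<tau>1 w z] by simp
  qed
  moreover have "w = v" if "w \<in> bounded_measurable \<and> excessive \<Gamma> w \<and> depressive \<Lambda> w \<and> Q1 \<Gamma> u w \<and> Q2 \<Lambda> u w" for w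
    using solution_unique[OF h u v sol _ assms(4,5)] that unfolding solution_iff by blast
  ultimately show ?thesis using val g1 g2 iffD1[OF solution_iff sol] by (intro exI[of _ v]) blast
qed

end
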